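(* Let $n\ge 1$. There exists an isomorphism of superalgebras $$\Phi: \widehat{\mathcal{H}c}_n \stackrel{\simeq}{\longrightarrow} \mathcal{C}_n \otimes \widehat{\mathcal{H}}_n^-$$ which is the identity on $\mathcal{C}_n$ and satisfies $$\Phi(T_i)=-\tfrac12 R_i(c_i-c_{i+1})+\tfrac{\varepsilon}{2}(1-c_ic_{i+1})\quad(1\le i\le n-1),$$ $$\Phi (X_i) = p_i -c_iq_i, \qquad \Phi (X_i^{-1}) = p_i +c_iq_i\quad(1\le i\le n).$$ Its inverse $\Psi$ is the identity on $\mathcal{C}_n$ and satisfies $$\Psi(R_i)=(c_i-c_{i+1})T_i+\varepsilon c_{i+1}\quad(1\le i\le n-1),$$ $$\Psi (p_i) =\tfrac12 (X_i +X_i^{-1}), \qquad \Psi (q_i) =\tfrac12 (X_i -X_i^{-1})c_i\quad(1\le i\le n).$$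
   Context: Let $q$ be a formal parameter and $\varepsilon=q-q^{-1}$ (the parameter $q$ is not to be confused with the generators $q_i$). Algebras are unital and associative; superalgebra means $\mathbb{Z}_2$-graded algebra. The Clifford algebra $\mathcal{C}_n$ is the $\mathbb{C}$-superalgebra generated by odd elements $c_1,\dots,c_n$ with $c_i^2=1$ and $c_ic_j=-c_jc_i$ $(i\ne j)$. The affine Hecke-Clifford algebra $\widehat{\mathcal{H}c}_n$ is the $\mathbb{C}(q)$-algebra generated by $T_i$ $(1\le i\le n-1)$ and $c_i, X_i^{\pm1}$ $(1\le i\le n)$ subject to: $(T_i-q)(T_i+q^{-1})=0$; $T_iT_{i+1}T_i=T_{i+1}T_iT_{i+1}$; $T_iT_j=T_jT_i$ for $|i-j|>1$; $T_ic_i=c_{i+1}T_i$; $T_ic_j=c_jT_i$ for $j\ne i,i+1$; $c_i^2=1$; $c_ic_j=-c_jc_i$ for $i\neq j$; $X_iX_i^{-1}=X_i^{-1}X_i=1$; $(T_i+\varepsilon c_ic_{i+1})X_iT_i=X_{i+1}$; $T_iX_j=X_jT_i$ for $j\ne i,i+1$; $X_iX_j=X_jX_i$; $X_ic_i=c_iX_i^{-1}$; $X_ic_j=c_jX_i$ for $i\ne j$. It is a superalgebra with $T_i,X_i$ even and $c_i$ odd. The spin affine Hecke algebra $\widehat{\mathcal{H}}_n^-$ is the $\mathbb{C}(q)$-algebra generated by $R_i$ $(1\le i\le n-1)$ and $p_i,q_i$ $(1\le i\le n)$ subject to: $R_i^2=-\varepsilon^2-2$; $R_iR_j=-R_jR_i$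 for $|i-j|>1$; $R_iR_{i+1}R_i-R_{i+1}R_iR_{i+1}=\varepsilon^2(R_{i+1}-R_i)$; $p_ip_j=p_jp_i$ and $q_iq_j=-q_jq_i$ for $i\ne j$; $p_i^2+q_i^2=1$; $p_iq_j=q_jp_i$ for all $i,j$; $R_ip_j=p_jR_i$ and $R_iq_j=-q_jR_i$ for $j\ne i,i+1$; $R_ip_i=p_{i+1}R_i+\varepsilon(q_i-q_{i+1})$; $R_iq_i=-q_{i+1}R_i-\varepsilon(p_i+p_{i+1})$. It is a superalgebra with $p_i$ even and $q_i,R_i$ odd. The tensor product of superalgebras has multiplication $(c'\otimes b')(c\otimes b)=(-1)^{|b'||c|}c'c\otimes b'b$. One writes $c=c\otimes1$, $b=1\otimes b$, $cb=c\otimes b$. Here $\mathcal{C}_n$ is a $\mathbb{C}$-algebra and the tensor product is over $\mathbb{C}$ (equivalently, extend $\mathcal{C}_n$ to $\mathbb{C}(q)$ and tensor over $\mathbb{C}(q)$). *)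

theory Defs
  imports
    "HOL-Computational_Algebra.Polynomial"
    "HOL-Computational_Algebra.Fraction_Field"
    "HOL-Library.Poly_Mapping"
    "HOL-Library.Z2"
    "HOL-Algebra.Module"
    "HOL-Algebra.QuotRing"
begin

section \<open>Superalgebras over a field\<close>

definition field_ring :: "'k::field ring" where
  "field_ring = \<lparr>carrier = UNIV, mult = (*), one = 1, zero = 0, add = (+)\<rparr>"

record ('k, 'a) superalgebra = "('k, 'a) module" +
  part :: "bit \<Rightarrow> 'a set"

text \<open>The locale \<open>algebra\<close> of the library is restricted to commutative algebras.\<close>

locale superalgebra = module field_ring A + ring A
  for A :: "('k::field, 'a, 'm) superalgebra_scheme" (structure) +
  assumes smult_mult_left:
      "\<lbrakk>x \<in> carrier A; y \<in> carrier A\<rbrakk> \<Longrightarrow> (k \<odot> x) \<otimes> y = k \<odot> (x \<otimes> y)"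
    and smult_mult_right:
      "\<lbrakk>x \<in> carrier A; y \<in> carrier A\<rbrakk> \<Longrightarrow> x \<otimes> (k \<odot> y) = k \<odot> (x \<otimes> y)"
    and part_submodule: "submodule (part A s) field_ring A"
    and part_direct_sum:
      "x \<in> carrier A \<Longrightarrow> \<exists>!(y, z). y \<in> part A 0 \<and> z \<in> part A 1 \<and> x = y \<oplus> z"
    and part_mult: "\<lbrakk>x \<in> part A s; y \<in> part A t\<rbrakk> \<Longrightarrow> x \<otimes> y \<in> part A (s + t)"

locale superalgebra_hom = A?: superalgebra A + B?: superalgebra B
  for A :: "('k::field, 'a, 'm) superalgebra_scheme"
    and B :: "('k, 'b, 'l) superalgebra_scheme" +
  fixes h :: "'a \<Rightarrow> 'b"
  assumes hom_ring: "h \<in> ring_hom A B"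
    and hom_smult: "x \<in> carrier A \<Longrightarrow> h (k \<odot>\<^bsub>A\<^esub> x) = k \<odot>\<^bsub>B\<^esub> h x"
    and hom_part: "h ` part A s \<subseteq> part B s"

locale superalgebra_iso = superalgebra_hom +
  assumes iso_bij: "bij_betw h (carrier A) (carrier B)"

text \<open>
  Quotients.  For an ideal that is not homogeneous \<open>part\<close> need not be a grading.
  Scalars act through representatives, because the elementwise multiple of a coset
  is not a coset when the scalar is \<open>0\<close>.
\<close>

definition superquot ::
  "('k::field, 'a, 'm) superalgebra_scheme \<Rightarrow> 'a set \<Rightarrow> ('k, 'a set) superalgebra"
where
  "superquot A I =
    \<lparr>carrier = carrier (A Quot I), mult = monoid.mult (A Quot I), one = monoid.one (A Quot I),
     zero = ring.zero (A Quot I), add = ring.add (A Quot I),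
     smult = (\<lambda>k X. \<Union>x\<in>X. I +>\<^bsub>A\<^esub> (k \<odot>\<^bsub>A\<^esub> x)),
     part = (\<lambda>s. (\<lambda>x. I +>\<^bsub>A\<^esub> x) ` part A s)\<rparr>"


section \<open>Free superalgebras and presentations\<close>

text \<open>
  With concatenation as addition on lists, the convolution product of finitely supported
  functions on words is the product of noncommutative polynomials.
\<close>

instantiation list :: (type) monoid_add
begin

definition zero_list :: "'a list" where "zero_list = []"
definition plus_list :: "'a list \<Rightarrow> 'a list \<Rightarrow> 'a list" where "plus_list = (@)"

instance by standard (simp_all add: zero_list_def plus_list_def)

end

definition pscale :: "'k::field \<Rightarrow> ('x \<Rightarrow>\<^sub>0 'k) \<Rightarrow> ('x \<Rightarrow>\<^sub>0 'k)" where
  "pscale k f = Poly_Mapping.map (\<lambda>x. k * x) f"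

definition free_superalgebra ::
  "'g set \<Rightarrow> ('g \<Rightarrow> bit) \<Rightarrow> ('k::field, 'g list \<Rightarrow>\<^sub>0 'k) superalgebra"
where
  "free_superalgebra G par =
    \<lparr>carrier = {f. Poly_Mapping.keys f \<subseteq> lists G},
     mult = (*), one = 1, zero = 0, add = (+), smult = pscale,
     part = (\<lambda>s. {f. Poly_Mapping.keys f \<subseteq> {w \<in> lists G. sum_list (map par w) = s}})\<rparr>"

definition var :: "'g \<Rightarrow> ('g list \<Rightarrow>\<^sub>0 'k::field)" where
  "var g = Poly_Mapping.single [g] 1"

text \<open>A defining relation \<open>l = r\<close> is given as the pair \<open>(l, r)\<close>.\<close>

definition relation_ideal ::
  "'g set \<Rightarrow> ('g \<Rightarrow> bit) \<Rightarrow> (('g list \<Rightarrow>\<^sub>0 'k) \<times> ('g list \<Rightarrow>\<^sub>0 'k::field)) set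
    \<Rightarrow> ('g list \<Rightarrow>\<^sub>0 'k) set"
where
  "relation_ideal G par Rel =
    genideal (free_superalgebra G par) ((\<lambda>(l, r). l - r) ` Rel)"

definition presented ::
  "'g set \<Rightarrow> ('g \<Rightarrow> bit) \<Rightarrow> (('g list \<Rightarrow>\<^sub>0 'k) \<times> ('g list \<Rightarrow>\<^sub>0 'k::field)) set
    \<Rightarrow> ('k, ('g list \<Rightarrow>\<^sub>0 'k) set) superalgebra"
where
  "presented G par Rel =
    superquot (free_superalgebra G par) (relation_ideal G par Rel)"

definition generator ::
  "'g set \<Rightarrow> ('g \<Rightarrow> bit) \<Rightarrow> (('g list \<Rightarrow>\<^sub>0 'k) \<times> ('g list \<Rightarrow>\<^sub>0 'k::field)) set
    \<Rightarrow> 'g \<Rightarrow> ('g list \<Rightarrow>\<^sub>0 'k) set"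
where
  "generator G par Rel g =
    relation_ideal G par Rel +>\<^bsub>free_superalgebra G par\<^esub> var g"


section \<open>Tensor products of superalgebras\<close>

definition homogeneous_part ::
  "('k, 'a, 'm) superalgebra_scheme \<Rightarrow> bit \<Rightarrow> 'a \<Rightarrow> 'a"
where
  "homogeneous_part A s x =
    (THE y. y \<in> part A s \<and> (\<exists>z \<in> part A (s + 1). x = y \<oplus>\<^bsub>A\<^esub> z))"

definition koszul_sign :: "bit \<Rightarrow> bit \<Rightarrow> 'k::field" where
  "koszul_sign s t = (if s = 1 \<and> t = 1 then - 1 else 1)"

text \<open>
  The tensor product is the free vector space on \<open>carrier A \<times> carrier B\<close>
  modulo the bilinearity relations.  On basis pairs the product before passing to the
  quotient is
  \<open>(a', b') (a, b) = (\<Sum>s t. (-1)^(s t) (a' a\<^sub>t, b'\<^sub>s b))\<close>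
  with \<open>a\<^sub>t\<close> and \<open>b'\<^sub>s\<close> the components of degree \<open>t\<close> and \<open>s\<close>; this is the bilinear
  extension of the rule with the sign \<open>(-1)^(\<bar>b'\<bar> \<bar>a\<bar>)\<close> for homogeneous elements.
  It is an algebra only after passing to the quotient.
\<close>

definition pretensor_mult ::
  "('k::field, 'a, 'm) superalgebra_scheme \<Rightarrow> ('k, 'b, 'l) superalgebra_scheme
    \<Rightarrow> ('a \<times> 'b \<Rightarrow>\<^sub>0 'k) \<Rightarrow> ('a \<times> 'b \<Rightarrow>\<^sub>0 'k) \<Rightarrow> ('a \<times> 'b \<Rightarrow>\<^sub>0 'k)"
where
  "pretensor_mult A B f g =
    (\<Sum>(a', b') \<in> Poly_Mapping.keys f. \<Sum>(a, b) \<in> Poly_Mapping.keys g.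
      \<Sum>s \<in> {0, 1}. \<Sum>t \<in> {0, 1}.
        Poly_Mapping.single
          (a' \<otimes>\<^bsub>A\<^esub> homogeneous_part A t a, homogeneous_part B s b' \<otimes>\<^bsub>B\<^esub> b)
          (koszul_sign s t * Poly_Mapping.lookup f (a', b') * Poly_Mapping.lookup g (a, b)))"

definition pretensor ::
  "('k::field, 'a, 'm) superalgebra_scheme \<Rightarrow> ('k, 'b, 'l) superalgebra_scheme
    \<Rightarrow> ('k, 'a \<times> 'b \<Rightarrow>\<^sub>0 'k) superalgebra"
where
  "pretensor A B =
    \<lparr>carrier = {f. Poly_Mapping.keys f \<subseteq> carrier A \<times> carrier B},
     mult = pretensor_mult A B,
     one = Poly_Mapping.single (\<one>\<^bsub>A\<^esub>, \<one>\<^bsub>B\<^esub>) 1, zero = 0, add = (+), smult = pscale,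
     part = (\<lambda>s. {f. Poly_Mapping.keys f \<subseteq> (\<Union>t. part A t \<times> part B (s + t))})\<rparr>"

definition bilinear_relators ::
  "('k::field, 'a, 'm) superalgebra_scheme \<Rightarrow> ('k, 'b, 'l) superalgebra_scheme
    \<Rightarrow> ('a \<times> 'b \<Rightarrow>\<^sub>0 'k) set"
where
  "bilinear_relators A B =
    (let e = (\<lambda>a b. Poly_Mapping.single (a, b) (1::'k)) in
      {e (a \<oplus>\<^bsub>A\<^esub> a') b - e a b - e a' b | a a' b.
         a \<in> carrier A \<and> a' \<in> carrier A \<and> b \<in> carrier B} \<union>
      {e a (b \<oplus>\<^bsub>B\<^esub> b') - e a b - e a b' | a b b'.
         a \<in> carrier A \<and> b \<in> carrier B \<and> b' \<in> carrier B} \<union>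
      {e (k \<odot>\<^bsub>A\<^esub> a) b - pscale k (e a b) | k a b. a \<in> carrier A \<and> b \<in> carrier B} \<union>
      {e a (k \<odot>\<^bsub>B\<^esub> b) - pscale k (e a b) | k a b. a \<in> carrier A \<and> b \<in> carrier B})"

definition bilinear_ideal ::
  "('k::field, 'a, 'm) superalgebra_scheme \<Rightarrow> ('k, 'b, 'l) superalgebra_scheme
    \<Rightarrow> ('a \<times> 'b \<Rightarrow>\<^sub>0 'k) set"
where
  "bilinear_ideal A B = Modules.module.span pscale (bilinear_relators A B)"

definition super_tensor ::
  "('k::field, 'a, 'm) superalgebra_scheme \<Rightarrow> ('k, 'b, 'l) superalgebra_scheme
    \<Rightarrow> ('k, ('a \<times> 'b \<Rightarrow>\<^sub>0 'k) set) superalgebra"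
where
  "super_tensor A B = superquot (pretensor A B) (bilinear_ideal A B)"

definition pure_tensor ::
  "('k::field, 'a, 'm) superalgebra_scheme \<Rightarrow> ('k, 'b, 'l) superalgebra_scheme
    \<Rightarrow> 'a \<Rightarrow> 'b \<Rightarrow> ('a \<times> 'b \<Rightarrow>\<^sub>0 'k) set"
where
  "pure_tensor A B a b = bilinear_ideal A B +>\<^bsub>pretensor A B\<^esub> Poly_Mapping.single (a, b) 1"


section \<open>The three superalgebras\<close>

type_synonym Cq = "complex poly fract"

definition qpar :: Cq where "qpar = Fract [:0, 1:] 1"

definition eps :: Cq where "eps = qpar - inverse qpar"

definition scal :: "Cq \<Rightarrow> ('g list \<Rightarrow>\<^sub>0 Cq)" where
  "scal k = pscale k 1"

subsection \<open>Clifford algebra, with scalars extended to \<open>Cq\<close>\<close>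

datatype clifford_gen = GenC nat

definition clifford_gens :: "nat \<Rightarrow> clifford_gen set" where
  "clifford_gens n = GenC ` {1..n}"

definition clifford_parity :: "clifford_gen \<Rightarrow> bit" where
  "clifford_parity g = 1"

definition clifford_rels ::
  "nat \<Rightarrow> ((clifford_gen list \<Rightarrow>\<^sub>0 Cq) \<times> (clifford_gen list \<Rightarrow>\<^sub>0 Cq)) set"
where
  "clifford_rels n = (let c = (\<lambda>i. var (GenC i)) in
     {(c i * c i, 1) | i. i \<in> {1..n}} \<union>
     {(c i * c j, - (c j * c i)) | i j. i \<in> {1..n} \<and> j \<in> {1..n} \<and> i \<noteq> j})"

definition clifford :: "nat \<Rightarrow> (Cq, (clifford_gen list \<Rightarrow>\<^sub>0 Cq) set) superalgebra" where
  "clifford n = presented (clifford_gens n) clifford_parity (clifford_rels n)"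

definition clifford_c :: "nat \<Rightarrow> nat \<Rightarrow> (clifford_gen list \<Rightarrow>\<^sub>0 Cq) set" where
  "clifford_c n i =
    generator (clifford_gens n) clifford_parity (clifford_rels n) (GenC i)"

subsection \<open>Affine Hecke-Clifford algebra\<close>

text \<open>\<open>HXi i\<close> stands for the generator that is inverse to \<open>HX i\<close>.\<close>

datatype hc_gen = HT nat | HC nat | HX nat | HXi nat

definition hc_gens :: "nat \<Rightarrow> hc_gen set" where
  "hc_gens n = HT ` {1..<n} \<union> HC ` {1..n} \<union> HX ` {1..n} \<union> HXi ` {1..n}"

fun hc_parity :: "hc_gen \<Rightarrow> bit" where
  "hc_parity (HT i) = 0"
| "hc_parity (HC i) = 1"
| "hc_parity (HX i) = 0"
| "hc_parity (HXi i) = 0"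

definition hc_rels ::
  "nat \<Rightarrow> ((hc_gen list \<Rightarrow>\<^sub>0 Cq) \<times> (hc_gen list \<Rightarrow>\<^sub>0 Cq)) set"
where
  "hc_rels n =
    (let T = (\<lambda>i. var (HT i)); c = (\<lambda>i. var (HC i));
         X = (\<lambda>i. var (HX i)); Xi = (\<lambda>i. var (HXi i)) in
     {((T i - scal qpar) * (T i + scal (inverse qpar)), 0) | i. i \<in> {1..<n}} \<union>
     {(T i * T (i+1) * T i, T (i+1) * T i * T (i+1)) | i. i \<in> {1..<n} \<and> i + 1 \<in> {1..<n}} \<union>
     {(T i * T j, T j * T i) | i j.
        i \<in> {1..<n} \<and> j \<in> {1..<n} \<and> \<bar>int i - int j\<bar> > 1} \<union>
     {(T i * c i, c (i+1) * T i) | i. i \<in> {1..<n}} \<union>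
     {(T i * c j, c j * T i) | i j. i \<in> {1..<n} \<and> j \<in> {1..n} \<and> j \<noteq> i \<and> j \<noteq> i + 1} \<union>
     {(c i * c i, 1) | i. i \<in> {1..n}} \<union>
     {(c i * c j, - (c j * c i)) | i j. i \<in> {1..n} \<and> j \<in> {1..n} \<and> i \<noteq> j} \<union>
     {(X i * Xi i, 1) | i. i \<in> {1..n}} \<union>
     {(Xi i * X i, 1) | i. i \<in> {1..n}} \<union>
     {((T i + scal eps * c i * c (i+1)) * X i * T i, X (i+1)) | i. i \<in> {1..<n}} \<union>
     {(T i * X j, X j * T i) | i j. i \<in> {1..<n} \<and> j \<in> {1..n} \<and> j \<noteq> i \<and> j \<noteq> i + 1} \<union>
     {(X i * X j, X j * X i) | i j. i \<in> {1..n} \<and> j \<in> {1..n}} \<union>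
     {(X i * c i, c i * Xi i) | i. i \<in> {1..n}} \<union>
     {(X i * c j, c j * X i) | i j. i \<in> {1..n} \<and> j \<in> {1..n} \<and> i \<noteq> j})"

definition affine_hc :: "nat \<Rightarrow> (Cq, (hc_gen list \<Rightarrow>\<^sub>0 Cq) set) superalgebra" where
  "affine_hc n = presented (hc_gens n) hc_parity (hc_rels n)"

definition affine_hc_gen :: "nat \<Rightarrow> hc_gen \<Rightarrow> (hc_gen list \<Rightarrow>\<^sub>0 Cq) set" where
  "affine_hc_gen n = generator (hc_gens n) hc_parity (hc_rels n)"

subsection \<open>Spin affine Hecke algebra\<close>

datatype spin_gen = SR nat | SP nat | SQ nat

definition spin_gens :: "nat \<Rightarrow> spin_gen set" where
  "spin_gens n = SR ` {1..<n} \<union> SP ` {1..n} \<union> SQ ` {1..n}"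

fun spin_parity :: "spin_gen \<Rightarrow> bit" where
  "spin_parity (SR i) = 1"
| "spin_parity (SP i) = 0"
| "spin_parity (SQ i) = 1"

definition spin_rels ::
  "nat \<Rightarrow> ((spin_gen list \<Rightarrow>\<^sub>0 Cq) \<times> (spin_gen list \<Rightarrow>\<^sub>0 Cq)) set"
where
  "spin_rels n =
    (let R = (\<lambda>i. var (SR i)); p = (\<lambda>i. var (SP i)); q = (\<lambda>i. var (SQ i)) in
     {(R i * R i, scal (- (eps^2) - 2)) | i. i \<in> {1..<n}} \<union>
     {(R i * R j, - (R j * R i)) | i j.
        i \<in> {1..<n} \<and> j \<in> {1..<n} \<and> \<bar>int i - int j\<bar> > 1} \<union>
     {(R i * R (i+1) * R i - R (i+1) * R i * R (i+1), scal (eps^2) * (R (i+1) - R i)) | i.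
        i \<in> {1..<n} \<and> i + 1 \<in> {1..<n}} \<union>
     {(p i * p j, p j * p i) | i j. i \<in> {1..n} \<and> j \<in> {1..n} \<and> i \<noteq> j} \<union>
     {(q i * q j, - (q j * q i)) | i j. i \<in> {1..n} \<and> j \<in> {1..n} \<and> i \<noteq> j} \<union>
     {(p i * p i + q i * q i, 1) | i. i \<in> {1..n}} \<union>
     {(p i * q j, q j * p i) | i j. i \<in> {1..n} \<and> j \<in> {1..n}} \<union>
     {(R i * p j, p j * R i) | i j. i \<in> {1..<n} \<and> j \<in> {1..n} \<and> j \<noteq> i \<and> j \<noteq> i + 1} \<union>
     {(R i * q j, - (q j * R i)) | i j. i \<in> {1..<n} \<and> j \<in> {1..n} \<and> j \<noteq> i \<and> j \<noteq> i + 1} \<union>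
     {(R i * p i, p (i+1) * R i + scal eps * (q i - q (i+1))) | i. i \<in> {1..<n}} \<union>
     {(R i * q i, - (q (i+1) * R i) - scal eps * (p i + p (i+1))) | i. i \<in> {1..<n}})"

definition spin_affine_hecke :: "nat \<Rightarrow> (Cq, (spin_gen list \<Rightarrow>\<^sub>0 Cq) set) superalgebra" where
  "spin_affine_hecke n = presented (spin_gens n) spin_parity (spin_rels n)"

definition spin_affine_hecke_gen :: "nat \<Rightarrow> spin_gen \<Rightarrow> (spin_gen list \<Rightarrow>\<^sub>0 Cq) set" where
  "spin_affine_hecke_gen n = generator (spin_gens n) spin_parity (spin_rels n)"

end

theory Submission
  imports Defs
begin

text \<open>
  The Clifford algebra splits off the affine Hecke-Clifford algebra as a tensor factor because
  that algebra has enough elements that supercommute with all \<open>c\<^sub>j\<close>.  The element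
  \<open>R\<^sub>i = (c\<^sub>i - c\<^sub>i\<^sub>+\<^sub>1) T\<^sub>i + \<epsilon> c\<^sub>i\<^sub>+\<^sub>1\<close> anticommutes with every \<open>c\<^sub>j\<close>, the part
  \<open>p\<^sub>i = (X\<^sub>i + X\<^sub>i\<^sup>-\<^sup>1) / 2\<close> of \<open>X\<^sub>i\<close> that is fixed by conjugation with \<open>c\<^sub>i\<close> commutes with every
  \<open>c\<^sub>j\<close>, and the other part \<open>(X\<^sub>i - X\<^sub>i\<^sup>-\<^sup>1) / 2\<close> becomes odd and anticommuting after multiplication by \<open>c\<^sub>i\<close>; this
  is \<open>q\<^sub>i\<close>.  Nothing is lost on the way: \<open>(c\<^sub>i - c\<^sub>i\<^sub>+\<^sub>1)\<^sup>2 = 2\<close>, so \<open>T\<^sub>i\<close> can be recovered from \<open>R\<^sub>i\<close>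
  and the \<open>c\<^sub>j\<close>, and \<open>X\<^sub>i = p\<^sub>i - c\<^sub>i q\<^sub>i\<close>.  In terms of the \<open>R\<^sub>i\<close>, \<open>p\<^sub>i\<close>, \<open>q\<^sub>i\<close> the relations for the
  \<open>T\<^sub>i\<close> and \<open>X\<^sub>i\<close> become the relations of the spin affine Hecke algebra, and conversely.

  So \<open>\<Phi>\<close> comes from the presentation of the affine Hecke-Clifford algebra (\<open>hc_to_tensor\<close>), and
  \<open>\<Psi>\<close> from the presentations of the two tensor factors (\<open>clifford_to_hc\<close>, \<open>spin_to_hc\<close>) and the
  universal property of the tensor product (\<open>tensor_hom_exists\<close>), which asks for supercommutation
  of the two images.  Both composites are the identity because they fix generators and
  homomorphisms out of presented algebras and tensor products are determined by their values on
  generators (\<open>hom_unique\<close>, \<open>tensor_hom_unique\<close>).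

  Presented superalgebras and tensor products are both quotients of a space of finitely supported
  functions by a subspace, and for tensor products the multiplication becomes associative only in
  the quotient.  The locale \<open>presuperalgebra\<close> collects what is needed for such a quotient to be a
  superalgebra, so that both constructions share one proof.

  What remains is to check relations, which means comparing normal forms of noncommutative
  polynomials.  This is best done by rewriting in a type of class \<open>ring\<close>, where no membership in a
  carrier interferes.  A ring on a carrier is therefore embedded into the product of all rings
  whose elements have the given type.  This product is a type of class \<open>ring\<close>, but
  the unit of the factor becomes an idempotent \<open>e\<close>, and the relations are read in the corner that
  \<open>e\<close> cuts out (\<open>corner\<close>, \<open>hc_system\<close>, \<open>clifford_spin_system\<close>).
\<close>

section \<open>Linear maps on free vector spaces\<close>

abbreviation "keys \<equiv> Poly_Mapping.keys"

abbreviation "single \<equiv> Poly_Mapping.single"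

abbreviation "lookup \<equiv> Poly_Mapping.lookup"

lemma pscale_eq_mult: "pscale k f = single 0 k * (f :: 'x::monoid_add \<Rightarrow>\<^sub>0 'k::field)"
  by (simp add: pscale_def mult_map_scale_conv_mult)

lemma lookup_pscale [simp]: "lookup (pscale k f) x = k * lookup f x"
  unfolding pscale_def by transfer (simp add: when_def)

interpretation pscale: vector_space pscale
  by standard (auto intro!: poly_mapping_eqI simp: lookup_add algebra_simps)

lemma pscale_single [simp]: "pscale k (single x a) = single x (k * a)"
  by (rule poly_mapping_eqI) (simp add: lookup_single when_def)

lemma keys_pscale: "keys (pscale k f) \<subseteq> keys f"
  by (auto simp: in_keys_iff)

lemma poly_mapping_expand:
  "(f :: 'x \<Rightarrow>\<^sub>0 'k::comm_monoid_add) = (\<Sum>x\<in>keys f. single x (lookup f x))"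
  by (rule poly_mapping_eqI)
    (simp add: lookup_sum lookup_single when_def sum.delta in_keys_iff)

lemma poly_mapping_linear_induct [consumes 1, case_names zero single add]:
  fixes f :: "'x \<Rightarrow>\<^sub>0 'k::comm_monoid_add"
  assumes "keys f \<subseteq> X"
    and "P 0"
    and "\<And>x a. x \<in> X \<Longrightarrow> P (single x a)"
    and "\<And>f g. \<lbrakk>keys f \<subseteq> X; keys g \<subseteq> X; P f; P g\<rbrakk> \<Longrightarrow> P (f + g)"
  shows "P f"
proof -
  have "finite S \<Longrightarrow> S \<subseteq> X \<Longrightarrow>
      keys (\<Sum>x\<in>S. single x (lookup f x)) \<subseteq> X \<and>
      P (\<Sum>x\<in>S. single x (lookup f x))" for S
  proof (induction S rule: finite_induct)
    case empty
    then show ?case using assms(2) by simp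
  next
    case (insert x S)
    then show ?case
      using keys_add[of "single x (lookup f x)"
          "\<Sum>x\<in>S. single x (lookup f x)"]
      by (auto intro!: assms(3,4) split: if_splits)
  qed
  from this[of "keys f"] assms(1) show ?thesis
    by (simp flip: poly_mapping_expand)
qed

text \<open>
  Multilinear identities are reduced to words and to elementary tensors by this rule: a
  property that is stable under linear combinations need only be checked on basis vectors.
\<close>

lemma free_vector_space_induct [consumes 1, case_names zero basis scale add]:
  fixes f :: "'x \<Rightarrow>\<^sub>0 'k::field"
  assumes "keys f \<subseteq> X" and "P 0"
    and basis: "\<And>x. x \<in> X \<Longrightarrow> P (single x 1)"
    and scale: "\<And>k f. \<lbrakk>keys f \<subseteq> X; P f\<rbrakk> \<Longrightarrow> P (pscale k f)"
    and "\<And>f g. \<lbrakk>keys f \<subseteq> X; keys g \<subseteq> X; P f; P g\<rbrakk> \<Longrightarrow> P (f + g)"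
  shows "P f"
  using assms(1)
proof (induction f rule: poly_mapping_linear_induct)
  case (single x a)
  show ?case using scale[of "single x 1" a] basis[OF single] single by simp
qed (use assms in blast)+

text \<open>
  The linear extension of a function that is given on the basis.
\<close>

definition plin :: "('x \<Rightarrow> ('y \<Rightarrow>\<^sub>0 'k)) \<Rightarrow> ('x \<Rightarrow>\<^sub>0 'k::field) \<Rightarrow> ('y \<Rightarrow>\<^sub>0 'k)" where
  "plin \<phi> f = (\<Sum>x\<in>keys f. pscale (lookup f x) (\<phi> x))"

lemma plin_superset:
  assumes "finite S" "keys f \<subseteq> S"
  shows "plin \<phi> f = (\<Sum>x\<in>S. pscale (lookup f x) (\<phi> x))"
  unfolding plin_def using assms
  by (intro sum.mono_neutral_left) (auto simp: in_keys_iff)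

lemma plin_zero [simp]: "plin \<phi> 0 = 0"
  by (simp add: plin_def)

lemma plin_single [simp]: "plin \<phi> (single x a) = pscale a (\<phi> x)"
  by (simp add: plin_def)

lemma plin_add: "plin \<phi> (f + g) = plin \<phi> f + plin \<phi> g"
proof -
  let ?S = "keys f \<union> keys g"
  have "finite ?S" by simp
  moreover have "keys (f + g) \<subseteq> ?S" by (rule keys_add)
  ultimately show ?thesis
    by (simp add: plin_superset[of ?S] lookup_add pscale.scale_left_distrib sum.distrib)
qed

lemma plin_pscale: "plin \<phi> (pscale k f) = pscale k (plin \<phi> f)"
  using keys_pscale[of k f]
  by (simp add: plin_superset[of "keys f"] pscale.scale_sum_right)

lemma plin_uminus: "plin \<phi> (- f) = - plin \<phi> f"
  by (metis plin_pscale pscale.scale_minus_left pscale.scale_one)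

lemma plin_diff: "plin \<phi> (f - g) = plin \<phi> f - plin \<phi> g"
  by (metis diff_conv_add_uminus plin_add plin_uminus)

lemma keys_plin:
  assumes "\<And>x. x \<in> keys f \<Longrightarrow> keys (\<phi> x) \<subseteq> Y"
  shows "keys (plin \<phi> f) \<subseteq> Y"
proof -
  have "lookup (plin \<phi> f) y = 0" if "y \<notin> Y" for y
    using assms that by (fastforce simp: plin_def lookup_sum in_keys_iff intro!: sum.neutral)
  then show ?thesis by (auto simp: in_keys_iff)
qed

section \<open>Superalgebras\<close>

lemma field_ring_simps [simp]:
  "carrier field_ring = UNIV" "mult field_ring = (*)" "one field_ring = 1"
  "zero field_ring = 0" "add field_ring = (+)"
  by (simp_all add: field_ring_def)

lemma field_ring_cring: "cring (field_ring :: 'k::field ring)"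
proof (rule cringI)
  show "abelian_group (field_ring :: 'k ring)"
    by (rule abelian_groupI) (auto simp: algebra_simps, metis add.right_inverse)
  show "Group.comm_monoid (field_ring :: 'k ring)"
    by (rule comm_monoidI) (auto simp: algebra_simps)
qed (auto simp: algebra_simps)

lemma superalgebra_hom_memI:
  assumes "superalgebra A" "superalgebra B"
    and "\<And>x. x \<in> carrier A \<Longrightarrow> h x \<in> carrier B"
    and "\<And>x y. \<lbrakk>x \<in> carrier A; y \<in> carrier A\<rbrakk> \<Longrightarrow> h (x \<otimes>\<^bsub>A\<^esub> y) = h x \<otimes>\<^bsub>B\<^esub> h y"
    and "\<And>x y. \<lbrakk>x \<in> carrier A; y \<in> carrier A\<rbrakk> \<Longrightarrow> h (x \<oplus>\<^bsub>A\<^esub> y) = h x \<oplus>\<^bsub>B\<^esub> h y"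
    and "h \<one>\<^bsub>A\<^esub> = \<one>\<^bsub>B\<^esub>"
    and "\<And>k x. x \<in> carrier A \<Longrightarrow> h (k \<odot>\<^bsub>A\<^esub> x) = k \<odot>\<^bsub>B\<^esub> h x"
    and "\<And>s x. x \<in> part A s \<Longrightarrow> h x \<in> part B s"
  shows "superalgebra_hom A B h"
  using assms
  by (intro superalgebra_hom.intro superalgebra_hom_axioms.intro ring_hom_memI) auto

context superalgebra
begin

lemma smult_carrier [simp, intro]: "x \<in> carrier A \<Longrightarrow> k \<odot> x \<in> carrier A"
  by (rule smult_closed) simp_all

lemma smult_add_left: "x \<in> carrier A \<Longrightarrow> (k + l) \<odot> x = k \<odot> x \<oplus> l \<odot> x"
  using smult_l_distr[of k l x] by simp

lemma smult_add_right: "\<lbrakk>x \<in> carrier A; y \<in> carrier A\<rbrakk> \<Longrightarrow> k \<odot> (x \<oplus> y) = k \<odot> x \<oplus> k \<odot> y"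
  using smult_r_distr[of k x y] by simp

lemma smult_smult: "x \<in> carrier A \<Longrightarrow> k \<odot> (l \<odot> x) = (k * l) \<odot> x"
  using smult_assoc1[of k l x] by simp

lemma smult_1 [simp]: "x \<in> carrier A \<Longrightarrow> 1 \<odot> x = x"
  using smult_one[of x] by simp

lemma smult_0_left [simp]: "x \<in> carrier A \<Longrightarrow> 0 \<odot> x = \<zero>"
  using smult_l_null[of x] by simp

lemma smult_neg_1: "x \<in> carrier A \<Longrightarrow> (- 1) \<odot> x = \<ominus> x"
  by (metis add.right_inverse minus_equality smult_0_left smult_1 smult_carrier smult_add_left add.left_inverse)

lemma part_carrier: "x \<in> part A s \<Longrightarrow> x \<in> carrier A"
  using submoduleE(1)[OF part_submodule] by blast

lemma part_zero [simp, intro]: "\<zero> \<in> part A s"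
  using subgroup.one_closed[OF submodule.axioms(1)[OF part_submodule]] by simp

lemma part_add: "\<lbrakk>x \<in> part A s; y \<in> part A s\<rbrakk> \<Longrightarrow> x \<oplus> y \<in> part A s"
  using submoduleE(5)[OF part_submodule] by blast

lemma part_smult: "x \<in> part A s \<Longrightarrow> k \<odot> x \<in> part A s"
  using submoduleE(4)[OF part_submodule] by simp

lemma part_uminus: "x \<in> part A s \<Longrightarrow> \<ominus> x \<in> part A s"
  using submoduleE(3)[OF part_submodule] by blast

end

section \<open>Quotients of algebras that are associative modulo a subspace\<close>

text \<open>
  The free superalgebra modulo a homogeneous ideal and the tensor product both have this form.
  Associativity and the unit laws are required only modulo \<open>I\<close>, because the product of elementary
  tensors has these properties only after the bilinearity relations have been imposed.  For the
  same reason elements have to be sums of homogeneous ones only modulo \<open>I\<close>; that an even and an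
  odd element whose sum is in \<open>I\<close> both lie in \<open>I\<close> makes the decomposition of a class unique.
\<close>

locale presuperalgebra =
  fixes P :: "('k::field, 'x \<Rightarrow>\<^sub>0 'k) superalgebra" (structure) and I :: "('x \<Rightarrow>\<^sub>0 'k) set"
  assumes add_P [simp]: "add P = (+)" and zero_P [simp]: "zero P = 0"
    and smult_P [simp]: "smult P = pscale"
    and carrier_subspace: "pscale.subspace (carrier P)"
    and mult_carrier: "\<lbrakk>x \<in> carrier P; y \<in> carrier P\<rbrakk> \<Longrightarrow> x \<otimes> y \<in> carrier P"
    and one_carrier: "\<one> \<in> carrier P"
    and mult_add_left:
      "\<lbrakk>x \<in> carrier P; y \<in> carrier P; z \<in> carrier P\<rbrakk> \<Longrightarrow> (x + y) \<otimes> z = x \<otimes> z + y \<otimes> z"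
    and mult_add_right:
      "\<lbrakk>x \<in> carrier P; y \<in> carrier P; z \<in> carrier P\<rbrakk> \<Longrightarrow> z \<otimes> (x + y) = z \<otimes> x + z \<otimes> y"
    and mult_pscale_left:
      "\<lbrakk>x \<in> carrier P; y \<in> carrier P\<rbrakk> \<Longrightarrow> pscale k x \<otimes> y = pscale k (x \<otimes> y)"
    and mult_pscale_right:
      "\<lbrakk>x \<in> carrier P; y \<in> carrier P\<rbrakk> \<Longrightarrow> x \<otimes> pscale k y = pscale k (x \<otimes> y)"
    and I_subspace: "pscale.subspace I" and I_carrier: "I \<subseteq> carrier P"
    and I_left: "\<lbrakk>x \<in> carrier P; i \<in> I\<rbrakk> \<Longrightarrow> x \<otimes> i \<in> I"
    and I_right: "\<lbrakk>x \<in> carrier P; i \<in> I\<rbrakk> \<Longrightarrow> i \<otimes> x \<in> I"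
    and assoc_mod: "\<lbrakk>x \<in> carrier P; y \<in> carrier P; z \<in> carrier P\<rbrakk> \<Longrightarrow>
        (x \<otimes> y) \<otimes> z - x \<otimes> (y \<otimes> z) \<in> I"
    and one_left_mod: "x \<in> carrier P \<Longrightarrow> \<one> \<otimes> x - x \<in> I"
    and one_right_mod: "x \<in> carrier P \<Longrightarrow> x \<otimes> \<one> - x \<in> I"
    and part_subspace: "pscale.subspace (part P s)" and part_P_carrier: "part P s \<subseteq> carrier P"
    and part_sum_mod: "x \<in> carrier P \<Longrightarrow> \<exists>y\<in>part P 0. \<exists>z\<in>part P 1. x - (y + z) \<in> I"
    and part_direct_mod: "\<lbrakk>y \<in> part P 0; z \<in> part P 1; y + z \<in> I\<rbrakk> \<Longrightarrow> y \<in> I"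
    and part_mult_P: "\<lbrakk>x \<in> part P s; y \<in> part P t\<rbrakk> \<Longrightarrow> x \<otimes> y \<in> part P (s + t)"
begin

definition cls :: "('x \<Rightarrow>\<^sub>0 'k) \<Rightarrow> ('x \<Rightarrow>\<^sub>0 'k) set" where "cls x = I +> x"

lemma cls_eq: "cls x = {y. y - x \<in> I}"
proof -
  have "y \<in> cls x \<longleftrightarrow> y - x \<in> I" for y
    by (auto simp: cls_def a_r_coset_def r_coset_def intro: bexI[of _ "y - x"])
  then show ?thesis by auto
qed

lemma cls_eq_iff: "cls x = cls y \<longleftrightarrow> x - y \<in> I"
proof
  assume "cls x = cls y"
  moreover have "x \<in> cls x" using pscale.subspace_0[OF I_subspace] by (simp add: cls_eq)
  ultimately show "x - y \<in> I" by (simp add: cls_eq)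
next
  assume "x - y \<in> I"
  then have "z - x \<in> I \<longleftrightarrow> z - y \<in> I" for z
    using pscale.subspace_add[OF I_subspace, of "z - x" "x - y"]
      pscale.subspace_diff[OF I_subspace, of "z - y" "x - y"] by auto
  then show "cls x = cls y" by (simp add: cls_eq)
qed

lemma mult_minus_left:
  "\<lbrakk>x \<in> carrier P; y \<in> carrier P; z \<in> carrier P\<rbrakk> \<Longrightarrow> (x - y) \<otimes> z = x \<otimes> z - y \<otimes> z"
  using mult_add_left[of "x - y" y z] pscale.subspace_diff[OF carrier_subspace] by auto

lemma mult_minus_right:
  "\<lbrakk>x \<in> carrier P; y \<in> carrier P; z \<in> carrier P\<rbrakk> \<Longrightarrow> z \<otimes> (x - y) = z \<otimes> x - z \<otimes> y"
  using mult_add_right[of "x - y" y z] pscale.subspace_diff[OF carrier_subspace] by auto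

lemma mem_cls_carrier: "\<lbrakk>a \<in> cls x; x \<in> carrier P\<rbrakk> \<Longrightarrow> a \<in> carrier P"
  using I_carrier pscale.subspace_add[OF carrier_subspace, of "a - x" x] by (auto simp: cls_eq)

abbreviation Q where "Q \<equiv> superquot P I"

lemma quot_carrier: "carrier Q = cls ` carrier P"
  by (auto simp: superquot_def FactRing_def A_RCOSETS_def RCOSETS_def cls_def a_r_coset_def)

lemma quot_one: "one Q = cls \<one>"
  by (simp add: superquot_def FactRing_def cls_def)

lemma quot_zero: "zero Q = cls 0"
  by (simp add: superquot_def FactRing_def cls_eq)

lemma quot_part: "part Q s = cls ` part P s"
  by (simp add: superquot_def cls_def)

lemma quot_add: "cls x \<oplus>\<^bsub>Q\<^esub> cls y = cls (x + y)"
proof -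
  have *: "z \<in> cls x \<oplus>\<^bsub>Q\<^esub> cls y \<longleftrightarrow> (\<exists>a b. a - x \<in> I \<and> b - y \<in> I \<and> z = a + b)" for z
    by (auto simp: superquot_def FactRing_def set_add_def set_mult_def cls_eq)
  have "z \<in> cls x \<oplus>\<^bsub>Q\<^esub> cls y \<longleftrightarrow> z \<in> cls (x + y)" for z
  proof
    assume "z \<in> cls x \<oplus>\<^bsub>Q\<^esub> cls y"
    then obtain a b where "a - x \<in> I" "b - y \<in> I" "z = a + b" unfolding * by blast
    then show "z \<in> cls (x + y)"
      using pscale.subspace_add[OF I_subspace, of "a - x" "b - y"] by (simp add: cls_eq algebra_simps)
  next
    assume "z \<in> cls (x + y)"
    then have "(z - y) - x \<in> I" "y - y \<in> I" "z = (z - y) + y"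
      using pscale.subspace_0[OF I_subspace] by (simp_all add: cls_eq algebra_simps)
    then show "z \<in> cls x \<oplus>\<^bsub>Q\<^esub> cls y" unfolding * by blast
  qed
  then show ?thesis by blast
qed

text \<open>
  The product of two cosets is defined as a union over representatives.  As \<open>I\<close> absorbs products
  on both sides, all members of the union agree.
\<close>

lemma quot_mult:
  assumes "x \<in> carrier P" "y \<in> carrier P"
  shows "cls x \<otimes>\<^bsub>Q\<^esub> cls y = cls (x \<otimes> y)"
proof -
  have "cls (a \<otimes> b) = cls (x \<otimes> y)" if "a \<in> cls x" "b \<in> cls y" for a b
  proof -
    have c: "a \<in> carrier P" "b \<in> carrier P" using that assms mem_cls_carrier by auto
    have "(a - x) \<otimes> b + x \<otimes> (b - y) \<in> I"
      using that c assms I_left I_right pscale.subspace_add[OF I_subspace] by (simp add: cls_eq)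
    then show ?thesis using c assms by (simp add: cls_eq_iff mult_minus_left mult_minus_right)
  qed
  moreover have "x \<in> cls x" "y \<in> cls y" using pscale.subspace_0[OF I_subspace] by (simp_all add: cls_eq)
  moreover have "cls x \<otimes>\<^bsub>Q\<^esub> cls y = (\<Union>a\<in>cls x. \<Union>b\<in>cls y. cls (a \<otimes> b))"
    by (simp add: superquot_def FactRing_def rcoset_mult_def cls_def)
  ultimately show ?thesis by fast
qed

lemma quot_smult: "k \<odot>\<^bsub>Q\<^esub> cls x = cls (pscale k x)"
proof -
  have "cls (pscale k a) = cls (pscale k x)" if "a \<in> cls x" for a
    using that pscale.subspace_scale[OF I_subspace, of "a - x" k]
    by (simp add: cls_eq_iff pscale.scale_right_diff_distrib) (simp add: cls_eq)
  moreover have "x \<in> cls x" using pscale.subspace_0[OF I_subspace] by (simp add: cls_eq)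
  moreover have "k \<odot>\<^bsub>Q\<^esub> cls x = (\<Union>a\<in>cls x. cls (pscale k a))"
    by (simp add: superquot_def cls_def)
  ultimately show ?thesis by fast
qed

lemmas quot_simps = quot_carrier quot_one quot_zero quot_part quot_add quot_mult quot_smult

lemma carrier_closed [simp]:
  "0 \<in> carrier P" "x \<in> carrier P \<Longrightarrow> y \<in> carrier P \<Longrightarrow> x + y \<in> carrier P"
  "x \<in> carrier P \<Longrightarrow> y \<in> carrier P \<Longrightarrow> x - y \<in> carrier P"
  "x \<in> carrier P \<Longrightarrow> - x \<in> carrier P" "x \<in> carrier P \<Longrightarrow> pscale k x \<in> carrier P"
  using pscale.subspace_0[OF carrier_subspace] pscale.subspace_add[OF carrier_subspace]
    pscale.subspace_diff[OF carrier_subspace] pscale.subspace_neg[OF carrier_subspace]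
    pscale.subspace_scale[OF carrier_subspace] by blast+

lemma quot_abelian_group: "abelian_group Q"
proof (rule abelian_groupI)
  show "\<exists>Y\<in>carrier Q. Y \<oplus>\<^bsub>Q\<^esub> X = \<zero>\<^bsub>Q\<^esub>" if X: "X \<in> carrier Q" for X
  proof -
    obtain x where "x \<in> carrier P" "X = cls x" using X by (auto simp: quot_simps)
    then show ?thesis by (intro bexI[of _ "cls (- x)"]) (auto simp: quot_simps)
  qed
qed (auto simp: quot_simps ac_simps)

lemma quot_uminus:
  assumes "x \<in> carrier P" shows "\<ominus>\<^bsub>Q\<^esub> cls x = cls (- x)"
  by (rule abelian_group.minus_equality[OF quot_abelian_group])
    (use assms in \<open>auto simp: quot_simps\<close>)

lemma quot_ring: "ring Q"
proof (rule ringI)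
  show "abelian_group Q" by (rule quot_abelian_group)
  show "Group.monoid Q"
  proof (rule monoidI)
    show "(X \<otimes>\<^bsub>Q\<^esub> Y) \<otimes>\<^bsub>Q\<^esub> Z = X \<otimes>\<^bsub>Q\<^esub> (Y \<otimes>\<^bsub>Q\<^esub> Z)"
      if XYZ: "X \<in> carrier Q" "Y \<in> carrier Q" "Z \<in> carrier Q" for X Y Z
    proof -
      obtain x y z where "x \<in> carrier P" "y \<in> carrier P" "z \<in> carrier P"
        "X = cls x" "Y = cls y" "Z = cls z" using XYZ by (auto simp: quot_simps)
      then show ?thesis by (simp add: quot_simps mult_carrier cls_eq_iff assoc_mod)
    qed
    show "\<one>\<^bsub>Q\<^esub> \<otimes>\<^bsub>Q\<^esub> X = X" "X \<otimes>\<^bsub>Q\<^esub> \<one>\<^bsub>Q\<^esub> = X" if X: "X \<in> carrier Q" for X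
    proof -
      obtain x where "x \<in> carrier P" "X = cls x" using X by (auto simp: quot_simps)
      then show "\<one>\<^bsub>Q\<^esub> \<otimes>\<^bsub>Q\<^esub> X = X" "X \<otimes>\<^bsub>Q\<^esub> \<one>\<^bsub>Q\<^esub> = X"
        by (simp_all add: quot_simps one_carrier cls_eq_iff one_left_mod one_right_mod)
    qed
  qed (auto simp: quot_simps mult_carrier one_carrier)
qed (auto simp: quot_simps mult_carrier mult_add_left mult_add_right)

lemma quot_module: "module field_ring Q"
  by (rule moduleI)
    (auto simp: quot_simps field_ring_cring quot_abelian_group pscale.scale_left_distrib
      pscale.scale_right_distrib)

lemma quot_superalgebra: "superalgebra Q"
proof (rule superalgebra.intro[OF quot_module quot_ring], rule superalgebra_axioms.intro)
  interpret Q: module field_ring Q by (rule quot_module)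
  show "submodule (part Q s) field_ring Q" for s
    using part_P_carrier[of s] pscale.subspace_0[OF part_subspace[of s]]
      pscale.subspace_add[OF part_subspace[of s]] pscale.subspace_neg[OF part_subspace[of s]]
      pscale.subspace_scale[OF part_subspace[of s]]
    by (intro Q.submoduleI) (auto simp: quot_simps quot_uminus subset_iff)
  show "\<exists>!(y, z). y \<in> part Q 0 \<and> z \<in> part Q 1 \<and> X = y \<oplus>\<^bsub>Q\<^esub> z" if X: "X \<in> carrier Q" for X
  proof -
    obtain x where x: "x \<in> carrier P" "X = cls x" using X by (auto simp: quot_simps)
    obtain y z where yz: "y \<in> part P 0" "z \<in> part P 1" "x - (y + z) \<in> I"
      using part_sum_mod[OF x(1)] by blast
    show ?thesis
    proof (rule ex1I[of _ "(cls y, cls z)"])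
      show "case (cls y, cls z) of (y, z) \<Rightarrow> y \<in> part Q 0 \<and> z \<in> part Q 1 \<and> X = y \<oplus>\<^bsub>Q\<^esub> z"
        using yz x by (auto simp: quot_simps cls_eq_iff)
    next
      fix YZ assume "case YZ of (Y, Z) \<Rightarrow> Y \<in> part Q 0 \<and> Z \<in> part Q 1 \<and> X = Y \<oplus>\<^bsub>Q\<^esub> Z"
      then obtain y' z' where YZ: "YZ = (cls y', cls z')" "y' \<in> part P 0" "z' \<in> part P 1"
        "x - (y' + z') \<in> I"
        using x by (auto simp: quot_simps) (metis cls_eq_iff)
      have "(y' - y) + (z' - z) \<in> I"
        using pscale.subspace_diff[OF I_subspace yz(3) YZ(4)] by (simp add: algebra_simps)
      moreover have "y' - y \<in> part P 0" "z' - z \<in> part P 1"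
        using YZ yz pscale.subspace_diff[OF part_subspace] by auto
      ultimately have "y' - y \<in> I" "z' - z \<in> I"
        using part_direct_mod pscale.subspace_diff[OF I_subspace, of "(y' - y) + (z' - z)" "y' - y"]
        by auto
      then show "YZ = (cls y, cls z)" by (simp add: YZ cls_eq_iff)
    qed
  qed
  show "x \<otimes>\<^bsub>Q\<^esub> y \<in> part Q (s + t)" if XY: "x \<in> part Q s" "y \<in> part Q t" for x y s t
  proof -
    obtain a b where ab: "a \<in> part P s" "b \<in> part P t" "x = cls a" "y = cls b"
      using XY by (auto simp: quot_part)
    then have "a \<in> carrier P" "b \<in> carrier P" using part_P_carrier by auto
    with ab show ?thesis using part_mult_P by (simp add: quot_mult quot_part)
  qed
qed (auto simp: quot_simps mult_carrier mult_pscale_left mult_pscale_right)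

text \<open>
  A linear multiplicative map that vanishes on \<open>I\<close> takes the same value on all representatives
  of a class, so its values on chosen representatives define the induced homomorphism.
\<close>

lemma quot_hom:
  assumes D: "superalgebra D"
    and h: "\<And>x. x \<in> carrier P \<Longrightarrow> h x \<in> carrier D"
      "\<And>x y. \<lbrakk>x \<in> carrier P; y \<in> carrier P\<rbrakk> \<Longrightarrow> h (x + y) = h x \<oplus>\<^bsub>D\<^esub> h y"
      "\<And>x y. \<lbrakk>x \<in> carrier P; y \<in> carrier P\<rbrakk> \<Longrightarrow> h (x \<otimes> y) = h x \<otimes>\<^bsub>D\<^esub> h y"
      "h \<one> = \<one>\<^bsub>D\<^esub>"
      "\<And>k x. x \<in> carrier P \<Longrightarrow> h (pscale k x) = k \<odot>\<^bsub>D\<^esub> h x"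
      "\<And>s x. x \<in> part P s \<Longrightarrow> h x \<in> part D s"
      "\<And>x. x \<in> I \<Longrightarrow> h x = \<zero>\<^bsub>D\<^esub>"
  shows "\<exists>g. superalgebra_hom Q D g \<and> (\<forall>x\<in>carrier P. g (cls x) = h x)"
proof -
  interpret D: superalgebra D by (rule D)
  define g where "g X = h (SOME x. x \<in> X)" for X
  have g: "g (cls x) = h x" if x: "x \<in> carrier P" for x
  proof -
    have "x \<in> cls x" using pscale.subspace_0[OF I_subspace] by (simp add: cls_eq)
    then have y: "(SOME y. y \<in> cls x) \<in> cls x" (is "?y \<in> _") by (rule someI)
    then have "?y \<in> carrier P" "?y - x \<in> I" using x mem_cls_carrier by (auto simp: cls_eq)
    then have "h ?y = h (?y - x) \<oplus>\<^bsub>D\<^esub> h x" using h(2)[of "?y - x" x] x by simp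
    then show ?thesis using h(7)[OF \<open>?y - x \<in> I\<close>] h(1)[OF x] by (simp add: g_def)
  qed
  have "superalgebra_hom Q D g"
    using part_P_carrier
    by (intro superalgebra_hom_memI quot_superalgebra D)
      (auto simp: quot_simps g h mult_carrier one_carrier subset_iff)
  with g show ?thesis by blast
qed

end

section \<open>Linear maps from free vector spaces to superalgebras\<close>

text \<open>
  The counterpart of \<open>plin\<close> for maps into a module that is given by a carrier.
\<close>

definition lin ::
  "('k::field, 'd, 'm) superalgebra_scheme \<Rightarrow> ('x \<Rightarrow> 'd) \<Rightarrow> ('x \<Rightarrow>\<^sub>0 'k) \<Rightarrow> 'd"
where
  "lin D \<phi> f = (\<Oplus>\<^bsub>D\<^esub>x\<in>keys f. lookup f x \<odot>\<^bsub>D\<^esub> \<phi> x)"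

context superalgebra
begin

lemma lin_superset:
  assumes "finite S" "keys f \<subseteq> S" "\<phi> \<in> S \<rightarrow> carrier A"
  shows "lin A \<phi> f = (\<Oplus>x\<in>S. lookup f x \<odot> \<phi> x)"
  unfolding lin_def using assms
  by (intro add.finprod_mono_neutral_cong_left) (auto simp: in_keys_iff Pi_iff)

lemma lin_carrier: "\<phi> \<in> keys f \<rightarrow> carrier A \<Longrightarrow> lin A \<phi> f \<in> carrier A"
  unfolding lin_def by (intro finsum_closed) auto

lemma lin_0 [simp]: "lin A \<phi> 0 = \<zero>"
  by (simp add: lin_def)

lemma lin_single: "\<phi> x \<in> carrier A \<Longrightarrow> lin A \<phi> (single x a) = a \<odot> \<phi> x"
  by (cases "a = 0") (simp_all add: lin_def)

lemma lin_add:
  assumes "\<phi> \<in> X \<rightarrow> carrier A" "keys f \<subseteq> X" "keys g \<subseteq> X"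
  shows "lin A \<phi> (f + g) = lin A \<phi> f \<oplus> lin A \<phi> g"
proof -
  let ?S = "keys f \<union> keys g"
  have S: "finite ?S" "\<phi> \<in> ?S \<rightarrow> carrier A" using assms by auto
  moreover have "keys (f + g) \<subseteq> ?S" by (rule keys_add)
  moreover have "(\<Oplus>x\<in>?S. lookup (f + g) x \<odot> \<phi> x) =
      (\<Oplus>x\<in>?S. lookup f x \<odot> \<phi> x \<oplus> lookup g x \<odot> \<phi> x)"
    using S(2) by (intro finsum_cong') (auto simp: lookup_add smult_add_left Pi_iff)
  ultimately show ?thesis
    by (simp add: lin_superset[of ?S] finsum_addf Pi_iff)
qed

lemma lin_pscale:
  assumes "\<phi> \<in> keys f \<rightarrow> carrier A"
  shows "lin A \<phi> (pscale k f) = k \<odot> lin A \<phi> f"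
proof -
  have "lin A \<phi> (pscale k f) = (\<Oplus>x\<in>keys f. k \<odot> (lookup f x \<odot> \<phi> x))"
    using assms keys_pscale[of k f]
    by (subst lin_superset[of "keys f"]) (auto intro!: finsum_cong' simp: smult_smult Pi_iff)
  also have "\<dots> = k \<odot> lin A \<phi> f"
    unfolding lin_def using assms by (subst finsum_smult_ldistr) (auto simp: Pi_iff)
  finally show ?thesis .
qed

end

section \<open>Presentations\<close>

lemma sum_bit_word: "sum_list (map (par :: _ \<Rightarrow> bit) (u + v)) = sum_list (map par u) + sum_list (map par v)"
  by (simp add: plus_list_def)

lemma free_simps [simp]:
  "carrier (free_superalgebra G par) = {f. keys f \<subseteq> lists G}"
  "monoid.mult (free_superalgebra G par) = (*)" "one (free_superalgebra G par) = 1"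
  "zero (free_superalgebra G par) = 0" "add (free_superalgebra G par) = (+)"
  "smult (free_superalgebra G par) = pscale"
  "part (free_superalgebra G par) s =
     {f. keys f \<subseteq> {w \<in> lists G. sum_list (map par w) = s}}"
  by (simp_all add: free_superalgebra_def)

lemma subspace_keys: "pscale.subspace {f. keys f \<subseteq> X}"
  by (rule pscale.subspaceI) (auto simp: in_keys_iff lookup_add subset_iff, metis add.right_neutral)

lemma free_mult_carrier:
  assumes "keys f \<subseteq> lists G" "keys g \<subseteq> lists G"
  shows "keys (f * g) \<subseteq> lists G"
  using assms keys_mult[of f g] by (force simp: plus_list_def)

lemma scalar_central: "f * single 0 k = single 0 k * (f :: 'x::monoid_add \<Rightarrow>\<^sub>0 'k::field)"
proof -
  have "keys f \<subseteq> UNIV" by simp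
  then show ?thesis
    by (induction f rule: poly_mapping_linear_induct) (auto simp: mult_single algebra_simps)
qed

lemma free_mult_pscale: "f * pscale k g = pscale k (f * g :: 'x::monoid_add \<Rightarrow>\<^sub>0 'k::field)"
  by (metis mult.assoc pscale_eq_mult scalar_central)

lemma free_pscale_mult: "pscale k f * g = pscale k (f * g :: 'x::monoid_add \<Rightarrow>\<^sub>0 'k::field)"
  by (simp add: pscale_eq_mult mult.assoc)

lemma single_Nil: "single [] 1 = (1 :: 'g list \<Rightarrow>\<^sub>0 'k::field)"
  by (metis single_one zero_list_def)

lemma free_ring: "ring (free_superalgebra G par)"
proof (rule ringI)
  show "abelian_group (free_superalgebra G par)"
  proof (rule abelian_groupI)
    show "\<exists>y\<in>carrier (free_superalgebra G par).
        y \<oplus>\<^bsub>free_superalgebra G par\<^esub> x = \<zero>\<^bsub>free_superalgebra G par\<^esub>"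
      if "x \<in> carrier (free_superalgebra G par)" for x
      using that by (intro bexI[of _ "- x"]) simp_all
  qed (use pscale.subspace_add[OF subspace_keys] in \<open>simp_all add: ac_simps\<close>)
  show "Group.monoid (free_superalgebra G par)"
    by (rule monoidI) (auto simp: free_mult_carrier mult.assoc zero_list_def)
qed (auto simp: algebra_simps)

text \<open>
  The projection onto the span of the words of one parity.
\<close>

definition graded_part :: "('g \<Rightarrow> bit) \<Rightarrow> bit \<Rightarrow> ('g list \<Rightarrow>\<^sub>0 'k) \<Rightarrow> ('g list \<Rightarrow>\<^sub>0 'k::field)" where
  "graded_part par s =
     plin (\<lambda>w. if sum_list (map par w) = s then single w 1 else 0)"

lemma lookup_graded_part:
  "lookup (graded_part par s f) w =
    (if sum_list (map par w) = s then lookup f w else 0)"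
proof -
  have "keys f \<subseteq> UNIV" by simp
  then show ?thesis unfolding graded_part_def
    by (induction f rule: poly_mapping_linear_induct)
      (auto simp: plin_add lookup_add lookup_single when_def)
qed

lemma graded_part_mult:
  "graded_part par s (f * g) =
    graded_part par 0 f * graded_part par s g + graded_part par 1 f * graded_part par (s + 1) g"
proof -
  have f: "keys f \<subseteq> UNIV" and g: "keys g \<subseteq> UNIV" by simp_all
  have 1: "graded_part par s (single u a * g) =
      graded_part par 0 (single u a) * graded_part par s g +
      graded_part par 1 (single u a) * graded_part par (s + 1) g" for u a
    using g
  proof (induction g rule: poly_mapping_linear_induct)
    case (single v b)
    show ?case
      by (cases "sum_list (map par u)"; cases "sum_list (map par v)"; cases s)
        (simp_all add: graded_part_def mult_single sum_bit_word)
  next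
    case (add x y)
    then show ?case by (simp add: graded_part_def plin_add algebra_simps)
  qed (simp add: graded_part_def)
  show ?thesis using f
  proof (induction f rule: poly_mapping_linear_induct)
    case (add x y)
    then show ?case by (simp add: graded_part_def plin_add algebra_simps)
    next
    case (single u a)
    show ?case by (rule 1)
  qed (simp add: graded_part_def)
qed


text \<open>
  An ideal generated by homogeneous elements is homogeneous: the elements all of whose
  homogeneous components lie in the relation ideal form an ideal, by \<open>graded_part_mult\<close>, and
  this ideal contains the generators.
\<close>

lemma relation_ideal_presuperalgebra:
  assumes rel: "\<And>l r. (l, r) \<in> Rel \<Longrightarrow> \<exists>s. l - r \<in> part (free_superalgebra G par) s"
  shows "presuperalgebra (free_superalgebra G par) (relation_ideal G par Rel)"
    and "(l, r) \<in> Rel \<Longrightarrow> l - r \<in> relation_ideal G par Rel"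
    and "\<lbrakk>ideal J (free_superalgebra G par); \<And>l r. (l, r) \<in> Rel \<Longrightarrow> l - r \<in> J\<rbrakk>
      \<Longrightarrow> relation_ideal G par Rel \<subseteq> J"
proof -
  let ?F = "free_superalgebra G par" and ?I = "relation_ideal G par Rel"
  interpret F: ring ?F by (rule free_ring)
  have sub: "(\<lambda>(l, r). l - r) ` Rel \<subseteq> carrier ?F"
    using rel by fastforce
  interpret I: ideal ?I ?F
    unfolding relation_ideal_def by (rule F.genideal_ideal[OF sub])
  show relI: "l - r \<in> ?I" if "(l, r) \<in> Rel" for l r
    using F.genideal_self[OF sub] that unfolding relation_ideal_def by fastforce
  show min: "?I \<subseteq> J" if "ideal J ?F" "\<And>l r. (l, r) \<in> Rel \<Longrightarrow> l - r \<in> J" for J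
    unfolding relation_ideal_def using that by (intro F.genideal_minimal) auto
  have I_scale: "pscale k f \<in> ?I" if "f \<in> ?I" for k f
    using I.I_l_closed[OF that, of "single 0 k"]
    by (simp add: pscale_eq_mult zero_list_def)
  have I_sub: "pscale.subspace ?I"
    using I.zero_closed I.a_closed I_scale by (intro pscale.subspaceI) auto
  have I_carrier: "?I \<subseteq> carrier ?F" using I.a_subset by simp
  define J where "J = {f \<in> carrier ?F. \<forall>s. graded_part par s f \<in> ?I}"
  have gp_carrier: "graded_part par s f \<in> carrier ?F" if "f \<in> carrier ?F" for s f
    using that by (auto simp: in_keys_iff lookup_graded_part subset_iff split: if_splits)
  have gp_add: "graded_part par s (f + g) = graded_part par s f + graded_part par s g" for s f g
    by (simp add: graded_part_def plin_add)
  have "ideal J ?F"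
  proof (rule idealI)
    show "ring ?F" by (rule free_ring)
    show "subgroup J (add_monoid ?F)"
    proof (rule F.add.subgroupI)
      show "J \<noteq> {}" using I.zero_closed by (auto simp: J_def graded_part_def intro!: exI[of _ 0])
      show "\<ominus>\<^bsub>?F\<^esub> f \<in> J" if "f \<in> J" for f
      proof -
        have "\<ominus>\<^bsub>?F\<^esub> f = - f"
          using that by (intro F.minus_equality) (auto simp: J_def)
        then show ?thesis using that pscale.subspace_neg[OF I_sub]
          by (auto simp: J_def graded_part_def plin_uminus)
      qed
      show "f \<oplus>\<^bsub>?F\<^esub> g \<in> J" if "f \<in> J" "g \<in> J" for f g
        using that pscale.subspace_add[OF I_sub] pscale.subspace_add[OF subspace_keys, of f "lists G" g]
        by (simp add: J_def gp_add)
    qed (auto simp: J_def)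
    show "x \<otimes>\<^bsub>?F\<^esub> f \<in> J" "f \<otimes>\<^bsub>?F\<^esub> x \<in> J" if "f \<in> J" "x \<in> carrier ?F" for f x
      using that I.I_l_closed I.I_r_closed pscale.subspace_add[OF I_sub] gp_carrier[OF that(2)]
      by (simp_all add: J_def graded_part_mult free_mult_carrier)
  qed
  moreover have "l - r \<in> J" if lr: "(l, r) \<in> Rel" for l r
  proof -
    obtain s where s: "l - r \<in> part ?F s" using rel[OF lr] by blast
    have "graded_part par t (l - r) = (if t = s then l - r else 0)" for t
      using s by (intro poly_mapping_eqI) (auto simp: lookup_graded_part in_keys_iff subset_iff)
    then show ?thesis using relI[OF lr] s I.zero_closed by (auto simp: J_def)
  qed
  ultimately have IJ: "?I \<subseteq> J" by (rule min)
  show "presuperalgebra ?F ?I"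
  proof
    show "\<exists>y\<in>part ?F 0. \<exists>z\<in>part ?F 1. x - (y + z) \<in> ?I" if "x \<in> carrier ?F" for x
    proof (intro bexI)
      have "graded_part par 0 x + graded_part par 1 x = x"
        by (intro poly_mapping_eqI) (simp add: lookup_add lookup_graded_part)
      then show "x - (graded_part par 0 x + graded_part par 1 x) \<in> ?I" using I.zero_closed by simp
    qed (use that in \<open>auto simp: in_keys_iff lookup_graded_part subset_iff split: if_splits\<close>)
    show "y \<in> ?I" if "y \<in> part ?F 0" "z \<in> part ?F 1" "y + z \<in> ?I" for y z
    proof -
      have "graded_part par 0 (y + z) = y"
        using that(1,2) by (intro poly_mapping_eqI)
          (auto simp: lookup_add lookup_graded_part in_keys_iff subset_iff)
      moreover have "graded_part par 0 (y + z) \<in> ?I" using that(3) IJ by (auto simp: J_def)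
      ultimately show ?thesis by simp
    qed
    show "x \<otimes>\<^bsub>?F\<^esub> y \<in> part ?F (s + t)" if "x \<in> part ?F s" "y \<in> part ?F t" for x y s t
      using that keys_mult[of x y] by (fastforce simp: sum_bit_word plus_list_def)
  qed (use I_sub I_carrier I.I_l_closed I.I_r_closed in
      \<open>auto simp: subspace_keys free_mult_carrier algebra_simps zero_list_def free_pscale_mult
        free_mult_pscale pscale.subspace_0\<close>)
qed


fun word_prod :: "('k, 'd, 'm) superalgebra_scheme \<Rightarrow> ('g \<Rightarrow> 'd) \<Rightarrow> 'g list \<Rightarrow> 'd" where
  "word_prod D \<phi> [] = \<one>\<^bsub>D\<^esub>"
| "word_prod D \<phi> (g # w) = \<phi> g \<otimes>\<^bsub>D\<^esub> word_prod D \<phi> w"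

definition free_eval ::
  "('k::field, 'd, 'm) superalgebra_scheme \<Rightarrow> ('g \<Rightarrow> 'd) \<Rightarrow> ('g list \<Rightarrow>\<^sub>0 'k) \<Rightarrow> 'd"
where
  "free_eval D \<phi> = lin D (word_prod D \<phi>)"

lemma (in superalgebra) direct_sum_unique:
  assumes "y \<in> part A 0" "z \<in> part A 1" "y' \<in> part A 0" "z' \<in> part A 1" "y \<oplus> z = y' \<oplus> z'"
  shows "y = y'" "z = z'"
proof -
  obtain p where p: "\<And>r. (case r of (u, v) \<Rightarrow> u \<in> part A 0 \<and> v \<in> part A 1 \<and> y \<oplus> z = u \<oplus> v) \<Longrightarrow> r = p"
    using part_direct_sum[of "y \<oplus> z"] assms(1,2) part_carrier by (metis (no_types, lifting) add.m_closed)
  have "(y, z) = p" "(y', z') = p" using assms by (auto intro!: p)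
  then have "(y, z) = (y', z')" by simp
  then show "y = y'" "z = z'" by simp_all
qed

text \<open>
  Let \<open>1 = a + b\<close> with \<open>a\<close> even and \<open>b\<close> odd.  Comparing the components of \<open>a = a a + b a\<close> and
  \<open>b = a b + b b\<close> shows that \<open>b a\<close> and \<open>b b\<close> vanish, hence so does \<open>b = b a + b b\<close>.
\<close>

lemma (in superalgebra) one_part: "\<one> \<in> part A 0"
proof -
  obtain a b where ab: "a \<in> part A 0" "b \<in> part A 1" "\<one> = a \<oplus> b"
    using part_direct_sum[of \<one>] by auto
  note c = part_carrier[OF ab(1)] part_carrier[OF ab(2)]
  have p: "a \<otimes> a \<in> part A 0" "b \<otimes> a \<in> part A 1" "a \<otimes> b \<in> part A 1" "b \<otimes> b \<in> part A 0"
    using part_mult[OF ab(1,1)] part_mult[OF ab(2,1)] part_mult[OF ab(1,2)] part_mult[OF ab(2,2)]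
    by simp_all
  have "a = a \<otimes> a \<oplus> b \<otimes> a" "b = a \<otimes> b \<oplus> b \<otimes> b"
    using c l_one[OF c(1)] l_one[OF c(2)] by (simp_all add: ab(3) l_distr)
  then have "b \<otimes> a = \<zero>" "b \<otimes> b = \<zero>"
    using direct_sum_unique[of a \<zero> "a \<otimes> a" "b \<otimes> a"] direct_sum_unique[of \<zero> b "b \<otimes> b" "a \<otimes> b"]
      p ab c by (simp_all add: a_comm)
  moreover have "b = b \<otimes> a \<oplus> b \<otimes> b"
    using c r_one[OF c(2)] by (simp add: ab(3) r_distr)
  ultimately have "b = \<zero>" by simp
  with ab c show ?thesis by simp
qed

locale free_evaluation = superalgebra A for A :: "('k::field, 'a, 'm) superalgebra_scheme" (structure) +
  fixes G :: "'g set" and \<phi> :: "'g \<Rightarrow> 'a"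
  assumes \<phi>_carrier: "g \<in> G \<Longrightarrow> \<phi> g \<in> carrier A"
begin

lemma word_carrier: "w \<in> lists G \<Longrightarrow> word_prod A \<phi> w \<in> carrier A"
  by (induction w) (auto simp: \<phi>_carrier)

lemma word_append:
  "\<lbrakk>u \<in> lists G; v \<in> lists G\<rbrakk> \<Longrightarrow> word_prod A \<phi> (u + v) = word_prod A \<phi> u \<otimes> word_prod A \<phi> v"
  by (induction u) (auto simp: plus_list_def \<phi>_carrier word_carrier m_assoc)

lemma words: "word_prod A \<phi> \<in> lists G \<rightarrow> carrier A"
  using word_carrier by auto

lemma eval_carrier [simp]: "keys f \<subseteq> lists G \<Longrightarrow> free_eval A \<phi> f \<in> carrier A"
  unfolding free_eval_def using words by (intro lin_carrier) auto

lemma eval_0 [simp]: "free_eval A \<phi> 0 = \<zero>"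
  by (simp add: free_eval_def)

lemma eval_single: "w \<in> lists G \<Longrightarrow> free_eval A \<phi> (single w a) = a \<odot> word_prod A \<phi> w"
  by (simp add: free_eval_def lin_single word_carrier)

lemma eval_var [simp]: "g \<in> G \<Longrightarrow> free_eval A \<phi> (var g) = \<phi> g"
  by (simp add: var_def eval_single \<phi>_carrier)

lemma eval_1 [simp]: "free_eval A \<phi> 1 = \<one>"
  using eval_single[of "[]" 1] by (simp add: single_Nil)

lemma eval_add [simp]:
  "\<lbrakk>keys f \<subseteq> lists G; keys g \<subseteq> lists G\<rbrakk> \<Longrightarrow>
    free_eval A \<phi> (f + g) = free_eval A \<phi> f \<oplus> free_eval A \<phi> g"
  unfolding free_eval_def by (rule lin_add[OF words])

lemma eval_pscale [simp]:
  "keys f \<subseteq> lists G \<Longrightarrow> free_eval A \<phi> (pscale k f) = k \<odot> free_eval A \<phi> f"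
  unfolding free_eval_def using words by (intro lin_pscale) auto

lemma eval_uminus [simp]:
  "keys f \<subseteq> lists G \<Longrightarrow> free_eval A \<phi> (- f) = \<ominus> free_eval A \<phi> f"
  by (metis eval_carrier eval_pscale pscale.scale_minus_left pscale.scale_one smult_neg_1)

lemma eval_diff [simp]:
  "\<lbrakk>keys f \<subseteq> lists G; keys g \<subseteq> lists G\<rbrakk> \<Longrightarrow>
    free_eval A \<phi> (f - g) = free_eval A \<phi> f \<ominus> free_eval A \<phi> g"
  using eval_add[of f "- g"] by (simp add: a_minus_def)

lemma eval_mult [simp]:
  assumes f: "keys f \<subseteq> lists G" and g: "keys g \<subseteq> lists G"
  shows "free_eval A \<phi> (f * g) = free_eval A \<phi> f \<otimes> free_eval A \<phi> g"
proof -
  have 1: "free_eval A \<phi> (single u a * g) =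
      free_eval A \<phi> (single u a) \<otimes> free_eval A \<phi> g" if u: "u \<in> lists G" for u a
    using g
  proof (induction g rule: poly_mapping_linear_induct)
    case (single v b)
    have "u + v \<in> lists G" using u single by (simp add: plus_list_def)
    then show ?case using u single
      by (simp add: mult_single eval_single word_append word_carrier smult_mult_left
          smult_mult_right smult_smult mult.commute)
  next
    case (add x y)
    have "keys (single u a) \<subseteq> lists G" using u by simp
    note c = free_mult_carrier[OF this]
    show ?case using add c u by (simp add: distrib_left r_distr)
  qed (use u in simp)
  show ?thesis using f
  proof (induction f rule: poly_mapping_linear_induct)
    case (add x y)
    then show ?case using g by (simp add: distrib_right l_distr free_mult_carrier)
  next
    case (single u a)
    then show ?case by (rule 1)
  qed (use g in simp)
qed

end

lemma eval_scal:
  assumes "free_evaluation A G \<phi>"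
  shows "free_eval A \<phi> (scal k) = k \<odot>\<^bsub>A\<^esub> \<one>\<^bsub>A\<^esub>"
proof -
  interpret free_evaluation A G \<phi> by (rule assms)
  show ?thesis unfolding scal_def by (subst eval_pscale) (simp_all add: zero_list_def)
qed

lemma var_carrier [simp]: "g \<in> G \<Longrightarrow> keys (var g) \<subseteq> lists G"
  by (simp add: var_def)

lemma scal_carrier [simp]: "keys (scal k) \<subseteq> lists G"
  unfolding scal_def by (rule order_trans[OF keys_pscale]) (simp add: zero_list_def)

lemma carrier_closures [simp]:
  "keys (1 :: 'g list \<Rightarrow>\<^sub>0 'k::field) \<subseteq> lists G"
  "\<lbrakk>keys f \<subseteq> lists G; keys g \<subseteq> lists G\<rbrakk> \<Longrightarrow>
    keys (f + g) \<subseteq> lists (G :: 'g set)"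
  "\<lbrakk>keys f \<subseteq> lists G; keys g \<subseteq> lists G\<rbrakk> \<Longrightarrow>
    keys (f - g) \<subseteq> lists G"
  "\<lbrakk>keys f \<subseteq> lists G; keys g \<subseteq> lists G\<rbrakk> \<Longrightarrow>
    keys (f * g) \<subseteq> lists G" for f g :: "'g list \<Rightarrow>\<^sub>0 'k::field"
  using pscale.subspace_add[OF subspace_keys, of f "lists G" g]
    pscale.subspace_diff[OF subspace_keys, of f "lists G" g] free_mult_carrier[of f G g]
  by (auto simp: zero_list_def)

locale presentation =
  fixes G :: "'g set" and par :: "'g \<Rightarrow> bit"
    and Rel :: "(('g list \<Rightarrow>\<^sub>0 'k) \<times> ('g list \<Rightarrow>\<^sub>0 'k::field)) set"
  assumes homogeneous_rel: "(l, r) \<in> Rel \<Longrightarrow>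
      \<exists>s. l \<in> part (free_superalgebra G par) s \<and> r \<in> part (free_superalgebra G par) s"
begin

lemma homogeneous_diff:
  assumes "(l, r) \<in> Rel" shows "\<exists>s. l - r \<in> part (free_superalgebra G par) s"
proof -
  obtain s where "l \<in> part (free_superalgebra G par) s" "r \<in> part (free_superalgebra G par) s"
    using homogeneous_rel[OF assms] by blast
  then have "l - r \<in> part (free_superalgebra G par) s"
    using pscale.subspace_diff[OF subspace_keys] by simp
  then show ?thesis by blast
qed

lemma rel_keys:
  assumes "(l, r) \<in> Rel"
  shows "keys l \<subseteq> lists G" "keys r \<subseteq> lists G"
  using homogeneous_rel[OF assms] by auto

sublocale P: presuperalgebra "free_superalgebra G par" "relation_ideal G par Rel"
  by (rule relation_ideal_presuperalgebra(1)) (rule homogeneous_diff)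

abbreviation "Pres \<equiv> presented G par Rel"

abbreviation "gen \<equiv> generator G par Rel"

lemma Pres_eq: "Pres = superquot (free_superalgebra G par) (relation_ideal G par Rel)"
  by (simp add: presented_def)

lemma gen_eq: "gen g = P.cls (var g)"
  by (simp add: generator_def P.cls_def)

lemma superalgebra_Pres: "superalgebra Pres"
  unfolding Pres_eq by (rule P.quot_superalgebra)

lemma gen_part: "g \<in> G \<Longrightarrow> gen g \<in> part Pres (par g)"
  by (auto simp: Pres_eq gen_eq P.quot_part var_def intro!: imageI)

lemma gen_carrier: "g \<in> G \<Longrightarrow> gen g \<in> carrier Pres"
  using superalgebra.part_carrier[OF superalgebra_Pres gen_part] .

text \<open>
  The class of a noncommutative polynomial is its value at the generators.  So every element of
  the presented algebra is such a value.
\<close>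

lemma eval_gen:
  assumes "keys f \<subseteq> lists G" shows "free_eval Pres gen f = P.cls f"
proof -
  interpret Q: superalgebra Pres by (rule superalgebra_Pres)
  interpret ev: free_evaluation Pres G gen by unfold_locales (rule gen_carrier)
  have word: "word_prod Pres gen w = P.cls (single w 1)" if "w \<in> lists G" for w
    using that
  proof (induction w)
    case Nil
    then show ?case by (simp add: Pres_eq P.quot_one single_Nil)
  next
    case (Cons g w)
    have "P.cls (var g) \<otimes>\<^bsub>Pres\<^esub> P.cls (single w 1) = P.cls (var g * single w 1)"
      unfolding Pres_eq using Cons.hyps by (subst P.quot_mult) auto
    then show ?case using Cons by (simp add: gen_eq var_def mult_single plus_list_def)
  qed
  show ?thesis using assms
  proof (induction f rule: poly_mapping_linear_induct)
    case zero
    show ?case using ev.eval_0 by (simp add: Pres_eq P.quot_zero)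
  next
    case (single w a)
    then have "free_eval Pres gen (single w a) = a \<odot>\<^bsub>Pres\<^esub> P.cls (single w 1)"
      by (simp only: ev.eval_single word)
    then show ?case using P.quot_smult[of a "single w 1"] by (simp add: Pres_eq)
  next
    case (add f g)
    then have "free_eval Pres gen (f + g) = P.cls f \<oplus>\<^bsub>Pres\<^esub> P.cls g"
      by (simp only: ev.eval_add)
    then show ?case by (simp add: Pres_eq P.quot_add)
  qed
qed

lemma relation_gen:
  assumes "(l, r) \<in> Rel" shows "free_eval Pres gen l = free_eval Pres gen r"
proof -
  have "keys l \<subseteq> lists G" "keys r \<subseteq> lists G"
    using rel_keys[OF assms] by blast+
  moreover have "l - r \<in> relation_ideal G par Rel"
    by (rule relation_ideal_presuperalgebra(2)[OF homogeneous_diff]) (use assms in auto)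
  ultimately show ?thesis by (simp add: eval_gen P.cls_eq_iff)
qed

lemma hom_eval:
  assumes "superalgebra_hom Pres D h" "keys f \<subseteq> lists G"
  shows "h (P.cls f) = free_eval D (\<lambda>g. h (gen g)) f"
proof -
  interpret Q: superalgebra Pres by (rule superalgebra_Pres)
  interpret Q: free_evaluation Pres G gen by unfold_locales (rule gen_carrier)
  interpret h: superalgebra_hom Pres D h by (rule assms(1))
  interpret ev: free_evaluation D G "\<lambda>g. h (gen g)"
    using gen_carrier ring_hom_closed[OF h.hom_ring] by unfold_locales blast
  note hom = ring_hom_add[OF h.hom_ring] ring_hom_mult[OF h.hom_ring] ring_hom_one[OF h.hom_ring]
    h.hom_smult
  have word: "h (word_prod Pres gen w) = word_prod D (\<lambda>g. h (gen g)) w" if "w \<in> lists G" for w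
    using that by (induction w) (auto simp: hom gen_carrier Q.word_carrier)
  have "h (free_eval Pres gen f) = free_eval D (\<lambda>g. h (gen g)) f"
    using assms(2)
  proof (induction f rule: poly_mapping_linear_induct)
    case zero
    have "h \<zero>\<^bsub>Pres\<^esub> = h (0 \<odot>\<^bsub>Pres\<^esub> \<one>\<^bsub>Pres\<^esub>)" by (subst Q.smult_0_left) auto
    also have "\<dots> = \<zero>\<^bsub>D\<^esub>" by (subst hom(4)) (auto simp: hom(3))
    finally show ?case by simp
  qed (simp_all add: Q.eval_single ev.eval_single word hom Q.word_carrier)
  then show ?thesis by (simp add: eval_gen assms(2))
qed

lemma hom_unique:
  assumes "superalgebra_hom Pres D h" "superalgebra_hom Pres D h'"
    and "\<And>g. g \<in> G \<Longrightarrow> h (gen g) = h' (gen g)" and "x \<in> carrier Pres"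
  shows "h x = h' x"
proof -
  obtain f where f: "keys f \<subseteq> lists G" "x = P.cls f"
    using assms(4) by (auto simp: Pres_eq P.quot_carrier)
  have word: "word_prod D (\<lambda>g. h (gen g)) w = word_prod D (\<lambda>g. h' (gen g)) w" if "w \<in> lists G" for w
    using that by (induction w) (auto simp: assms(3))
  interpret D: superalgebra D using assms(1) by (rule superalgebra_hom.axioms)
  interpret h': superalgebra_hom Pres D h' by (rule assms(2))
  interpret ev: free_evaluation D G "\<lambda>g. h' (gen g)"
    using gen_carrier ring_hom_closed[OF h'.hom_ring] by unfold_locales blast
  have "free_eval D (\<lambda>g. h (gen g)) f = free_eval D (\<lambda>g. h' (gen g)) f"
    unfolding free_eval_def lin_def using f(1) ev.word_carrier
    by (intro D.finsum_cong') (auto simp: word subset_iff)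
  then show ?thesis using assms(1,2) f by (simp add: hom_eval)
qed

text \<open>
  The existence part of the universal property.  The kernel of the evaluation homomorphism is an
  ideal of the free superalgebra; it contains the relation ideal once it contains the relators.
\<close>

lemma hom_exists:
  assumes D: "superalgebra D" and part: "\<And>g. g \<in> G \<Longrightarrow> \<phi> g \<in> part D (par g)"
    and rel: "\<And>l r. (l, r) \<in> Rel \<Longrightarrow> free_eval D \<phi> l = free_eval D \<phi> r"
  shows "\<exists>h. superalgebra_hom Pres D h \<and> (\<forall>g\<in>G. h (gen g) = \<phi> g)"
proof -
  interpret D: superalgebra D by (rule D)
  interpret ev: free_evaluation D G \<phi> using part D.part_carrier by unfold_locales blast
  have word: "word_prod D \<phi> w \<in> part D (sum_list (map par w))" if "w \<in> lists G" for w
    using that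
  proof (induction w)
    case Nil
    show ?case using D.one_part by simp
  next
    case (Cons g w)
    then show ?case using D.part_mult[OF part[of g]] by simp
  qed
  have "relation_ideal G par Rel \<subseteq> {f. keys f \<subseteq> lists G \<and> free_eval D \<phi> f = \<zero>\<^bsub>D\<^esub>}"
    (is "_ \<subseteq> ?J")
  proof (rule relation_ideal_presuperalgebra(3)[OF homogeneous_diff])
    interpret F: ring "free_superalgebra G par" by (rule free_ring)
    show "ideal ?J (free_superalgebra G par)"
    proof (rule idealI)
      show "ring (free_superalgebra G par)" by (rule free_ring)
      show "subgroup ?J (add_monoid (free_superalgebra G par))"
      proof (rule F.add.subgroupI)
        show "\<ominus>\<^bsub>free_superalgebra G par\<^esub> f \<in> ?J" if "f \<in> ?J" for f
        proof -
          have "\<ominus>\<^bsub>free_superalgebra G par\<^esub> f = - f"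
            using that by (intro F.minus_equality) auto
          then show ?thesis using that by simp
        qed
      qed (auto intro!: exI[of _ 0] simp del: in_lists_conv_set simp: carrier_closures(2)[THEN subsetD])
    qed auto
    show "l - r \<in> ?J" if lr: "(l, r) \<in> Rel" for l r
      using rel_keys[OF lr] rel[OF lr] by (simp add: D.r_neg a_minus_def del: in_lists_conv_set)
  qed
  then have "\<exists>h. superalgebra_hom Pres D h \<and> (\<forall>f\<in>carrier (free_superalgebra G par). h (P.cls f) = free_eval D \<phi> f)"
    unfolding Pres_eq
  proof (intro P.quot_hom[OF D])
    show "free_eval D \<phi> f \<in> part D s" if "f \<in> part (free_superalgebra G par) s" for f s
    proof -
      have "keys f \<subseteq> {w \<in> lists G. sum_list (map par w) = s}" using that by simp
      then show ?thesis
      proof (induction f rule: poly_mapping_linear_induct)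
        case (single w a)
        then show ?case using D.part_smult[OF word] by (auto simp: ev.eval_single)
      next
        case (add f g)
        then show ?case using D.part_add by (subst ev.eval_add) auto
      qed simp
    qed
  qed auto
  then obtain h where h: "superalgebra_hom Pres D h"
    "\<And>f. f \<in> carrier (free_superalgebra G par) \<Longrightarrow> h (P.cls f) = free_eval D \<phi> f" by blast
  then have "h (gen g) = \<phi> g" if "g \<in> G" for g using that by (simp add: gen_eq)
  with h(1) show ?thesis by blast
qed

end

section \<open>Homogeneous components\<close>

lemma bit_add_self [simp]: "s + s = (0 :: bit)" "s + (s + t) = t" "s + t + t = s" for s t :: bit
  by (cases s; cases t; simp)+

context superalgebra
begin

lemma homogeneous_part_eqI:
  assumes "y \<in> part A s" "z \<in> part A (s + 1)" "x = y \<oplus> z"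
  shows "homogeneous_part A s x = y"
  unfolding homogeneous_part_def
proof (rule the_equality)
  show "y \<in> part A s \<and> (\<exists>z\<in>part A (s + 1). x = y \<oplus> z)" using assms by blast
next
  fix y' assume "y' \<in> part A s \<and> (\<exists>z\<in>part A (s + 1). x = y' \<oplus> z)"
  then obtain z' where "y' \<in> part A s" "z' \<in> part A (s + 1)" "y' \<oplus> z' = y \<oplus> z"
    using assms by auto
  then show "y' = y"
    using direct_sum_unique[of y z y' z'] direct_sum_unique[of z y z' y'] assms part_carrier
    by (cases s) (auto simp: a_comm)
qed

lemma homogeneous_decomposition:
  assumes "x \<in> carrier A"
  shows "\<exists>y\<in>part A s. \<exists>z\<in>part A (s + 1). x = y \<oplus> z"
proof -
  obtain y z where "y \<in> part A 0" "z \<in> part A 1" "x = y \<oplus> z"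
    using part_direct_sum[OF assms] by auto
  moreover from this have "x = z \<oplus> y" using part_carrier by (simp add: a_comm)
  ultimately show ?thesis by (cases s) (simp, blast, simp, metis)
qed

lemma homogeneous_part_part:
  assumes "x \<in> carrier A" shows "homogeneous_part A s x \<in> part A s"
proof -
  obtain y z where "y \<in> part A s" "z \<in> part A (s + 1)" "x = y \<oplus> z"
    using homogeneous_decomposition[OF assms] by metis
  then show ?thesis by (simp add: homogeneous_part_eqI)
qed

lemma homogeneous_part_carrier [simp]: "x \<in> carrier A \<Longrightarrow> homogeneous_part A s x \<in> carrier A"
  by (rule part_carrier[OF homogeneous_part_part])

lemma homogeneous_part_sum:
  assumes "x \<in> carrier A" shows "homogeneous_part A 0 x \<oplus> homogeneous_part A 1 x = x"
proof -
  obtain y z where yz: "y \<in> part A 0" "z \<in> part A 1" "x = y \<oplus> z"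
    using homogeneous_decomposition[OF assms, of 0] by auto
  moreover from this have "x = z \<oplus> y" using part_carrier by (simp add: a_comm)
  ultimately have "homogeneous_part A 0 x = y" "homogeneous_part A 1 x = z"
    using homogeneous_part_eqI[of y 0 z x] homogeneous_part_eqI[of z 1 y x] by simp_all
  with yz show ?thesis by simp
qed

lemma homogeneous_part_same: "x \<in> part A s \<Longrightarrow> homogeneous_part A s x = x"
  using part_carrier by (intro homogeneous_part_eqI[of x s \<zero>]) auto

lemma homogeneous_part_other:
  assumes "x \<in> part A s" "t \<noteq> s" shows "homogeneous_part A t x = \<zero>"
proof -
  have "t + 1 = s" using assms(2) by (cases s; cases t) auto
  then show ?thesis using assms part_carrier by (intro homogeneous_part_eqI[of \<zero> t x]) auto
qed

lemma homogeneous_part_add: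
  assumes "x \<in> carrier A" "y \<in> carrier A"
  shows "homogeneous_part A s (x \<oplus> y) = homogeneous_part A s x \<oplus> homogeneous_part A s y"
proof -
  obtain x0 x1 y0 y1 where *: "x0 \<in> part A s" "x1 \<in> part A (s + 1)" "x = x0 \<oplus> x1"
    "y0 \<in> part A s" "y1 \<in> part A (s + 1)" "y = y0 \<oplus> y1"
    using homogeneous_decomposition[OF assms(1)] homogeneous_decomposition[OF assms(2)] by metis
  then have "x \<oplus> y = (x0 \<oplus> y0) \<oplus> (x1 \<oplus> y1)" using part_carrier by (simp add: a_ac)
  then have "homogeneous_part A s (x \<oplus> y) = x0 \<oplus> y0"
    using * by (intro homogeneous_part_eqI) (auto intro: part_add)
  with * show ?thesis by (simp add: homogeneous_part_eqI)
qed

lemma homogeneous_part_smult: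
  assumes "x \<in> carrier A"
  shows "homogeneous_part A s (k \<odot> x) = k \<odot> homogeneous_part A s x"
proof -
  obtain y z where *: "y \<in> part A s" "z \<in> part A (s + 1)" "x = y \<oplus> z"
    using homogeneous_decomposition[OF assms] by metis
  then have "homogeneous_part A s (k \<odot> x) = k \<odot> y"
    using part_carrier by (intro homogeneous_part_eqI[of _ _ "k \<odot> z"]) (auto intro: part_smult simp: smult_add_right)
  with * show ?thesis by (simp add: homogeneous_part_eqI)
qed

end

section \<open>Tensor products\<close>

text \<open>
  The tensor product of two maps, before bilinearity is imposed.
\<close>

definition tensor_map ::
  "('a \<Rightarrow> 'c) \<Rightarrow> ('b \<Rightarrow> 'd) \<Rightarrow> ('a \<times> 'b \<Rightarrow>\<^sub>0 'k) \<Rightarrow> ('c \<times> 'd \<Rightarrow>\<^sub>0 'k::field)"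
where
  "tensor_map \<alpha> \<beta> = plin (\<lambda>(a, b). single (\<alpha> a, \<beta> b) 1)"

lemma tensor_map_single [simp]:
  "tensor_map \<alpha> \<beta> (single (a, b) k) = single (\<alpha> a, \<beta> b) k"
  by (simp add: tensor_map_def)

lemma tensor_map_linear [simp]:
  "tensor_map \<alpha> \<beta> 0 = 0" "tensor_map \<alpha> \<beta> (f + g) = tensor_map \<alpha> \<beta> f + tensor_map \<alpha> \<beta> g"
  "tensor_map \<alpha> \<beta> (f - g) = tensor_map \<alpha> \<beta> f - tensor_map \<alpha> \<beta> g"
  "tensor_map \<alpha> \<beta> (pscale k f) = pscale k (tensor_map \<alpha> \<beta> f)"
  by (simp_all add: tensor_map_def plin_add plin_diff plin_pscale)

lemma pretensor_simps [simp]: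
  "carrier (pretensor A B) = {f. keys f \<subseteq> carrier A \<times> carrier B}"
  "monoid.mult (pretensor A B) = pretensor_mult A B"
  "one (pretensor A B) = single (\<one>\<^bsub>A\<^esub>, \<one>\<^bsub>B\<^esub>) 1"
  "zero (pretensor A B) = 0" "add (pretensor A B) = (+)" "smult (pretensor A B) = pscale"
  "part (pretensor A B) s = {f. keys f \<subseteq> (\<Union>t. part A t \<times> part B (s + t))}"
  by (simp_all add: pretensor_def)

text \<open>
  This form shows the bilinearity of the product, which the sums over supports hide.
\<close>

lemma pretensor_mult_plin:
  "pretensor_mult A B f g =
    plin (\<lambda>(a', b'). plin (\<lambda>(a, b). \<Sum>s\<in>{0, 1}. \<Sum>t\<in>{0, 1}. pscale (koszul_sign s t)
      (single (a' \<otimes>\<^bsub>A\<^esub> homogeneous_part A t a, homogeneous_part B s b' \<otimes>\<^bsub>B\<^esub> b) 1)) g) f"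
  by (simp add: pretensor_mult_def plin_def case_prod_unfold pscale.scale_sum_right
      pscale.scale_right_distrib algebra_simps)

locale superalgebra_pair = A: superalgebra A + B: superalgebra B
  for A :: "('k::field, 'a, 'm) superalgebra_scheme"
    and B :: "('k, 'b, 'l) superalgebra_scheme"
begin

abbreviation "I \<equiv> bilinear_ideal A B"

abbreviation e :: "'a \<Rightarrow> 'b \<Rightarrow> ('a \<times> 'b \<Rightarrow>\<^sub>0 'k)" where
  "e a b \<equiv> single (a, b) 1"

abbreviation pmult (infixl "\<star>" 70) where "f \<star> g \<equiv> pretensor_mult A B f g"

lemma I_subspace: "pscale.subspace I"
  by (simp add: bilinear_ideal_def)

lemmas I_closed = pscale.subspace_0[OF I_subspace] pscale.subspace_add[OF I_subspace]
  pscale.subspace_diff[OF I_subspace] pscale.subspace_scale[OF I_subspace]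
  pscale.subspace_neg[OF I_subspace]

lemma bilinear_relators_iff:
  "x \<in> bilinear_relators A B \<longleftrightarrow>
    (\<exists>a a' b. x = e (a \<oplus>\<^bsub>A\<^esub> a') b - e a b - e a' b \<and> a \<in> carrier A \<and> a' \<in> carrier A \<and> b \<in> carrier B) \<or>
    (\<exists>a b b'. x = e a (b \<oplus>\<^bsub>B\<^esub> b') - e a b - e a b' \<and> a \<in> carrier A \<and> b \<in> carrier B \<and> b' \<in> carrier B) \<or>
    (\<exists>k a b. x = e (k \<odot>\<^bsub>A\<^esub> a) b - pscale k (e a b) \<and> a \<in> carrier A \<and> b \<in> carrier B) \<or>
    (\<exists>k a b. x = e a (k \<odot>\<^bsub>B\<^esub> b) - pscale k (e a b) \<and> a \<in> carrier A \<and> b \<in> carrier B)"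
  unfolding bilinear_relators_def Let_def Un_iff mem_Collect_eq by (simp only: disj_assoc)

lemma bilinear_mod:
  assumes "a \<in> carrier A" "b \<in> carrier B"
  shows "a' \<in> carrier A \<Longrightarrow> e (a \<oplus>\<^bsub>A\<^esub> a') b - e a b - e a' b \<in> I"
    and "b' \<in> carrier B \<Longrightarrow> e a (b \<oplus>\<^bsub>B\<^esub> b') - e a b - e a b' \<in> I"
    and "e (k \<odot>\<^bsub>A\<^esub> a) b - pscale k (e a b) \<in> I"
    and "e a (k \<odot>\<^bsub>B\<^esub> b) - pscale k (e a b) \<in> I"
proof -
  have "x \<in> I" if "x \<in> bilinear_relators A B" for x
    unfolding bilinear_ideal_def using that by (rule pscale.span_base)
  then show "a' \<in> carrier A \<Longrightarrow> e (a \<oplus>\<^bsub>A\<^esub> a') b - e a b - e a' b \<in> I"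
    and "b' \<in> carrier B \<Longrightarrow> e a (b \<oplus>\<^bsub>B\<^esub> b') - e a b - e a b' \<in> I"
    and "e (k \<odot>\<^bsub>A\<^esub> a) b - pscale k (e a b) \<in> I"
    and "e a (k \<odot>\<^bsub>B\<^esub> b) - pscale k (e a b) \<in> I"
    unfolding bilinear_relators_iff using assms by metis+
qed

lemma zero_mod:
  "b \<in> carrier B \<Longrightarrow> e \<zero>\<^bsub>A\<^esub> b \<in> I" "a \<in> carrier A \<Longrightarrow> e a \<zero>\<^bsub>B\<^esub> \<in> I"
  using bilinear_mod(3)[of "\<zero>\<^bsub>A\<^esub>" b 0] bilinear_mod(4)[of a "\<zero>\<^bsub>B\<^esub>" 0] by auto

lemma I_induct [consumes 1, case_names zero add scale add_left add_right scale_left scale_right]: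
  assumes "x \<in> I" "P 0" "\<And>x y. P x \<Longrightarrow> P y \<Longrightarrow> P (x + y)" "\<And>k x. P x \<Longrightarrow> P (pscale k x)"
    "\<And>a a' b. \<lbrakk>a \<in> carrier A; a' \<in> carrier A; b \<in> carrier B\<rbrakk> \<Longrightarrow> P (e (a \<oplus>\<^bsub>A\<^esub> a') b - e a b - e a' b)"
    "\<And>a b b'. \<lbrakk>a \<in> carrier A; b \<in> carrier B; b' \<in> carrier B\<rbrakk> \<Longrightarrow> P (e a (b \<oplus>\<^bsub>B\<^esub> b') - e a b - e a b')"
    "\<And>k a b. \<lbrakk>a \<in> carrier A; b \<in> carrier B\<rbrakk> \<Longrightarrow> P (e (k \<odot>\<^bsub>A\<^esub> a) b - pscale k (e a b))"
    "\<And>k a b. \<lbrakk>a \<in> carrier A; b \<in> carrier B\<rbrakk> \<Longrightarrow> P (e a (k \<odot>\<^bsub>B\<^esub> b) - pscale k (e a b))"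
  shows "P x"
proof -
  have "I \<subseteq> {x. P x}"
    unfolding bilinear_ideal_def
  proof (rule pscale.span_minimal)
    show "pscale.subspace {x. P x}" using assms(2-4) by (intro pscale.subspaceI) auto
    show "bilinear_relators A B \<subseteq> {x. P x}"
      using assms(5-) by (auto simp only: bilinear_relators_iff mem_Collect_eq subset_iff)
  qed
  with assms(1) show ?thesis by blast
qed

lemma I_carrier: "I \<subseteq> {f. keys f \<subseteq> carrier A \<times> carrier B}"
proof
  fix x assume "x \<in> I"
  then show "x \<in> {f. keys f \<subseteq> carrier A \<times> carrier B}"
    by (induction rule: I_induct)
      (intro pscale.subspace_diff[OF subspace_keys] pscale.subspace_add[OF subspace_keys]
        pscale.subspace_scale[OF subspace_keys] pscale.subspace_0[OF subspace_keys];
       simp del: pscale_single)+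
qed

text \<open>
  Linear maps send each bilinearity relator to another bilinearity relator.
\<close>

lemma tensor_map_I:
  assumes \<alpha>: "\<And>a. a \<in> carrier A \<Longrightarrow> \<alpha> a \<in> carrier A"
      "\<And>a a'. \<lbrakk>a \<in> carrier A; a' \<in> carrier A\<rbrakk> \<Longrightarrow> \<alpha> (a \<oplus>\<^bsub>A\<^esub> a') = \<alpha> a \<oplus>\<^bsub>A\<^esub> \<alpha> a'"
      "\<And>k a. a \<in> carrier A \<Longrightarrow> \<alpha> (k \<odot>\<^bsub>A\<^esub> a) = k \<odot>\<^bsub>A\<^esub> \<alpha> a"
    and \<beta>: "\<And>b. b \<in> carrier B \<Longrightarrow> \<beta> b \<in> carrier B"
      "\<And>b b'. \<lbrakk>b \<in> carrier B; b' \<in> carrier B\<rbrakk> \<Longrightarrow> \<beta> (b \<oplus>\<^bsub>B\<^esub> b') = \<beta> b \<oplus>\<^bsub>B\<^esub> \<beta> b'"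
      "\<And>k b. b \<in> carrier B \<Longrightarrow> \<beta> (k \<odot>\<^bsub>B\<^esub> b) = k \<odot>\<^bsub>B\<^esub> \<beta> b"
    and x: "x \<in> I"
  shows "tensor_map \<alpha> \<beta> x \<in> I"
  using x
  by (induction rule: I_induct)
    (use bilinear_mod in \<open>simp_all add: \<alpha> \<beta> I_closed del: pscale_single\<close>)

lemma mult_linear [simp]:
  "0 \<star> g = 0" "f \<star> 0 = 0"
  "(f + f') \<star> g = f \<star> g + f' \<star> g" "f \<star> (g + g') = f \<star> g + f \<star> g'"
  "(f - f') \<star> g = f \<star> g - f' \<star> g" "f \<star> (g - g') = f \<star> g - f \<star> g'"
  "pscale k f \<star> g = pscale k (f \<star> g)" "f \<star> pscale k g = pscale k (f \<star> g)"
  unfolding pretensor_mult_plin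
  by (simp_all add: plin_add plin_pscale plin_diff)
    (simp_all add: plin_def case_prod_unfold pscale.scale_right_distrib sum.distrib
      pscale.scale_right_diff_distrib sum_subtractf pscale.scale_sum_right mult.commute mult.left_commute)

text \<open>
  Multiplication by an elementary tensor is a combination of tensor products of linear maps.  By
  \<open>tensor_map_I\<close> it preserves the bilinearity relations, which makes their span an ideal.
\<close>

lemma mult_single_right:
  "f \<star> e a b = (\<Sum>s\<in>{0, 1}. \<Sum>t\<in>{0, 1}. pscale (koszul_sign s t)
    (tensor_map (\<lambda>a'. a' \<otimes>\<^bsub>A\<^esub> homogeneous_part A t a) (\<lambda>b'. homogeneous_part B s b' \<otimes>\<^bsub>B\<^esub> b) f))"
  unfolding pretensor_mult_plin tensor_map_def plin_def[of _ f]
  by (simp add: case_prod_unfold pscale.scale_sum_right pscale.scale_right_distrib sum.distrib mult.commute)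

lemma mult_single_left:
  "e a' b' \<star> g = (\<Sum>s\<in>{0, 1}. \<Sum>t\<in>{0, 1}. pscale (koszul_sign s t)
    (tensor_map (\<lambda>a. a' \<otimes>\<^bsub>A\<^esub> homogeneous_part A t a) (\<lambda>b. homogeneous_part B s b' \<otimes>\<^bsub>B\<^esub> b) g))"
  unfolding pretensor_mult_plin tensor_map_def plin_def[of _ g]
  by (simp add: case_prod_unfold pscale.scale_sum_right pscale.scale_right_distrib sum.distrib mult.commute
      plin_def[of _ g])

lemma I_right:
  assumes i: "i \<in> I" and g: "keys g \<subseteq> carrier A \<times> carrier B"
  shows "i \<star> g \<in> I"
  using g
proof (induction g rule: free_vector_space_induct)
  case (basis x)
  then obtain a b where x: "x = (a, b)" "a \<in> carrier A" "b \<in> carrier B" by auto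
  show ?case
    unfolding x(1) mult_single_right
    by (intro pscale.subspace_sum[OF I_subspace] I_closed(4) tensor_map_I)
      (auto simp: x i A.l_distr A.smult_mult_left B.homogeneous_part_add B.homogeneous_part_smult
        B.l_distr B.smult_mult_left)
qed (simp_all add: I_closed)

lemma I_left:
  assumes i: "i \<in> I" and f: "keys f \<subseteq> carrier A \<times> carrier B"
  shows "f \<star> i \<in> I"
  using f
proof (induction f rule: free_vector_space_induct)
  case (basis x)
  then obtain a b where x: "x = (a, b)" "a \<in> carrier A" "b \<in> carrier B" by auto
  show ?case
    unfolding x(1) mult_single_left
    by (intro pscale.subspace_sum[OF I_subspace] I_closed(4) tensor_map_I)
      (auto simp: x i B.r_distr B.smult_mult_right A.homogeneous_part_add A.homogeneous_part_smult
        A.r_distr A.smult_mult_right)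
qed (simp_all add: I_closed)

definition cong :: "('a \<times> 'b \<Rightarrow>\<^sub>0 'k) \<Rightarrow> ('a \<times> 'b \<Rightarrow>\<^sub>0 'k) \<Rightarrow> bool" (infix "\<approx>" 50) where
  "f \<approx> g \<longleftrightarrow> f - g \<in> I"

lemma cong_refl [simp]: "f \<approx> f" by (simp add: cong_def I_closed)

lemma cong_sym: "f \<approx> g \<Longrightarrow> g \<approx> f"
  unfolding cong_def using I_closed(5)[of "f - g"] by simp

lemma cong_trans [trans]: "f \<approx> g \<Longrightarrow> g \<approx> h \<Longrightarrow> f \<approx> h"
  unfolding cong_def using I_closed(2)[of "f - g" "g - h"] by simp

lemma cong_add: "f \<approx> f' \<Longrightarrow> g \<approx> g' \<Longrightarrow> f + g \<approx> f' + g'"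
  unfolding cong_def using I_closed(2)[of "f - f'" "g - g'"] by (simp add: algebra_simps)

lemma cong_pscale: "f \<approx> f' \<Longrightarrow> pscale k f \<approx> pscale k f'"
  unfolding cong_def using I_closed(4)[of "f - f'" k] by (simp add: pscale.scale_right_diff_distrib)

lemma cong_sum: "(\<And>i. i \<in> S \<Longrightarrow> f i \<approx> g i) \<Longrightarrow> sum f S \<approx> sum g S"
  by (induction S rule: infinite_finite_induct) (auto intro: cong_add)

lemma cong_mult:
  assumes "f \<approx> f'" "g \<approx> g'" "keys f' \<subseteq> carrier A \<times> carrier B"
    "keys g \<subseteq> carrier A \<times> carrier B"
  shows "f \<star> g \<approx> f' \<star> g'"
proof -
  have "f \<star> g - f' \<star> g \<in> I" "f' \<star> g - f' \<star> g' \<in> I"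
    using I_right[of "f - f'" g] I_left[of "g - g'" f'] assms by (simp_all add: cong_def)
  then show ?thesis using I_closed(2) unfolding cong_def by fastforce
qed

lemma e_cong:
  assumes "a \<in> carrier A" "b \<in> carrier B"
  shows "a' \<in> carrier A \<Longrightarrow> e (a \<oplus>\<^bsub>A\<^esub> a') b \<approx> e a b + e a' b"
    and "b' \<in> carrier B \<Longrightarrow> e a (b \<oplus>\<^bsub>B\<^esub> b') \<approx> e a b + e a b'"
    and "e (k \<odot>\<^bsub>A\<^esub> a) b \<approx> pscale k (e a b)"
    and "e a (k \<odot>\<^bsub>B\<^esub> b) \<approx> pscale k (e a b)"
    and "e \<zero>\<^bsub>A\<^esub> b \<approx> 0" and "e a \<zero>\<^bsub>B\<^esub> \<approx> 0"
  unfolding cong_def using bilinear_mod[OF assms] zero_mod assms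
  by (simp_all add: diff_diff_eq del: pscale_single)

definition homogeneous_pairs :: "('a \<times> 'b) set" where
  "homogeneous_pairs = (\<Union>s. \<Union>t. part A s \<times> part B t)"

lemma homogeneous_pairs_carrier: "homogeneous_pairs \<subseteq> carrier A \<times> carrier B"
  using A.part_carrier B.part_carrier by (auto simp: homogeneous_pairs_def)

lemma homogeneous_expansion:
  assumes "a \<in> carrier A" "b \<in> carrier B"
  shows "e a b \<approx>
    (e (homogeneous_part A 0 a) (homogeneous_part B 0 b) + e (homogeneous_part A 0 a) (homogeneous_part B 1 b)) +
    (e (homogeneous_part A 1 a) (homogeneous_part B 0 b) + e (homogeneous_part A 1 a) (homogeneous_part B 1 b))"
proof -
  have 1: "e a' b \<approx> e a' (homogeneous_part B 0 b) + e a' (homogeneous_part B 1 b)" if "a' \<in> carrier A" for a'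
    using e_cong(2)[of a' "homogeneous_part B 0 b" "homogeneous_part B 1 b"] that assms
    by (simp add: B.homogeneous_part_sum)
  have "e a b \<approx> e (homogeneous_part A 0 a) b + e (homogeneous_part A 1 a) b"
    using e_cong(1)[of "homogeneous_part A 0 a" b "homogeneous_part A 1 a"] assms
    by (simp add: A.homogeneous_part_sum)
  also have "\<dots> \<approx> (e (homogeneous_part A 0 a) (homogeneous_part B 0 b) + e (homogeneous_part A 0 a) (homogeneous_part B 1 b)) +
    (e (homogeneous_part A 1 a) (homogeneous_part B 0 b) + e (homogeneous_part A 1 a) (homogeneous_part B 1 b))"
    by (intro cong_add 1) (use assms in auto)
  finally show ?thesis .
qed

text \<open>
  Modulo bilinearity every element is a combination of homogeneous elementary tensors, the even
  and the odd ones being collected in \<open>g0\<close> and \<open>g1\<close>.  On homogeneous elementary tensors the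
  product obeys the usual sign rule, see \<open>mult_homogeneous\<close>, so associativity and the unit laws
  need only be checked there.
\<close>

lemma homogeneous_representative:
  assumes "keys f \<subseteq> carrier A \<times> carrier B"
  shows "\<exists>g0 g1. keys g0 \<subseteq> (\<Union>t. part A t \<times> part B t) \<and>
    keys g1 \<subseteq> (\<Union>t. part A t \<times> part B (1 + t)) \<and> f \<approx> g0 + g1"
  using assms
proof (induction f rule: poly_mapping_linear_induct)
  case zero
  show ?case by (intro exI[of _ 0]) simp
next
  case (single x k)
  obtain a b where x: "x = (a, b)" "a \<in> carrier A" "b \<in> carrier B" using single by auto
  let ?h = "\<lambda>s t. e (homogeneous_part A s a) (homogeneous_part B t b)"
  have p: "homogeneous_part A s a \<in> part A s" "homogeneous_part B s b \<in> part B s" for s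
    using x A.homogeneous_part_part B.homogeneous_part_part by auto
  have "pscale k (e a b) \<approx> pscale k (?h 0 0 + ?h 0 1 + (?h 1 0 + ?h 1 1))"
    by (rule cong_pscale[OF homogeneous_expansion[OF x(2,3)]])
  also have "pscale k (?h 0 0 + ?h 0 1 + (?h 1 0 + ?h 1 1)) =
      pscale k (?h 0 0 + ?h 1 1) + pscale k (?h 0 1 + ?h 1 0)"
    by (simp add: pscale.scale_right_distrib ac_simps del: pscale_single)
  finally have "single x k \<approx> pscale k (?h 0 0 + ?h 1 1) + pscale k (?h 0 1 + ?h 1 0)"
    by (simp add: x)
  moreover have "keys (pscale k (?h 0 0 + ?h 1 1)) \<subseteq> (\<Union>t. part A t \<times> part B t)"
    using p by (intro order_trans[OF keys_pscale] order_trans[OF keys_add]) auto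
  moreover have "keys (pscale k (?h 0 1 + ?h 1 0)) \<subseteq> (\<Union>t. part A t \<times> part B (1 + t))"
  proof (intro order_trans[OF keys_pscale] order_trans[OF keys_add])
    have "(homogeneous_part A 0 a, homogeneous_part B 1 b) \<in> (\<Union>t. part A t \<times> part B (1 + t))"
      "(homogeneous_part A 1 a, homogeneous_part B 0 b) \<in> (\<Union>t. part A t \<times> part B (1 + t))"
      using p by (auto intro: UN_I[of 0] UN_I[of 1])
    then show "keys (?h 0 1) \<union> keys (?h 1 0) \<subseteq> (\<Union>t. part A t \<times> part B (1 + t))"
      by (simp split: if_splits)
  qed
  ultimately show ?case by blast
next
  case (add f f')
  obtain g0 g1 g0' g1' where *: "keys g0 \<subseteq> (\<Union>t. part A t \<times> part B t)"
    "keys g1 \<subseteq> (\<Union>t. part A t \<times> part B (1 + t))" "f \<approx> g0 + g1"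
    "keys g0' \<subseteq> (\<Union>t. part A t \<times> part B t)"
    "keys g1' \<subseteq> (\<Union>t. part A t \<times> part B (1 + t))" "f' \<approx> g0' + g1'"
    using add.IH by (elim exE conjE)
  show ?case
  proof (intro exI conjI)
    show "f + f' \<approx> (g0 + g0') + (g1 + g1')"
      using cong_add[OF *(3,6)] by (simp add: ac_simps)
    show "keys (g0 + g0') \<subseteq> (\<Union>t. part A t \<times> part B t)"
      by (rule order_trans[OF keys_add Un_least[OF *(1,4)]])
    show "keys (g1 + g1') \<subseteq> (\<Union>t. part A t \<times> part B (1 + t))"
      by (rule order_trans[OF keys_add Un_least[OF *(2,5)]])
  qed
qed

lemma homogeneous_representative':
  assumes "keys f \<subseteq> carrier A \<times> carrier B"
  obtains g where "keys g \<subseteq> homogeneous_pairs" "f \<approx> g"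
proof -
  obtain g0 g1 where g: "keys g0 \<subseteq> (\<Union>t. part A t \<times> part B t)"
    "keys g1 \<subseteq> (\<Union>t. part A t \<times> part B (1 + t))" "f \<approx> g0 + g1"
    using homogeneous_representative[OF assms] by blast
  have "keys (g0 + g1) \<subseteq> homogeneous_pairs"
  proof (rule order_trans[OF keys_add Un_least])
    have "part A t \<times> part B s \<subseteq> homogeneous_pairs" for s t by (auto simp: homogeneous_pairs_def)
    then show "keys g0 \<subseteq> homogeneous_pairs" "keys g1 \<subseteq> homogeneous_pairs"
      using order_trans[OF g(1) UN_least] order_trans[OF g(2) UN_least] by simp_all
  qed
  with g(3) show ?thesis using that by blast
qed

text \<open>
  Of the four summands of the product only the one at the degrees of \<open>b'\<close> and \<open>a\<close> counts; each of
  the others has a factor zero.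
\<close>

lemma mult_homogeneous:
  assumes "a' \<in> carrier A" "b' \<in> part B s" "a \<in> part A t" "b \<in> carrier B"
  shows "e a' b' \<star> e a b \<approx> pscale (koszul_sign s t) (e (a' \<otimes>\<^bsub>A\<^esub> a) (b' \<otimes>\<^bsub>B\<^esub> b))"
proof -
  have c: "a \<in> carrier A" "b' \<in> carrier B" using assms A.part_carrier B.part_carrier by auto
  have z: "single (\<zero>\<^bsub>A\<^esub>, y) k \<approx> 0" "single (x, \<zero>\<^bsub>B\<^esub>) k \<approx> 0"
    if "y \<in> carrier B" "x \<in> carrier A" for x y k
    using cong_pscale[OF e_cong(5)[of x y], of k] cong_pscale[OF e_cong(6)[of x y], of k] that by auto
  have s: "homogeneous_part B u b' = (if u = s then b' else \<zero>\<^bsub>B\<^esub>)" for u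
    using assms B.homogeneous_part_same B.homogeneous_part_other by auto
  have t: "homogeneous_part A u a = (if u = t then a else \<zero>\<^bsub>A\<^esub>)" for u
    using assms A.homogeneous_part_same A.homogeneous_part_other by auto
  have *: "(if u = s \<and> v = t then pscale (koszul_sign s t) (e (a' \<otimes>\<^bsub>A\<^esub> a) (b' \<otimes>\<^bsub>B\<^esub> b)) else 0) \<approx>
      pscale (koszul_sign u v) (e (a' \<otimes>\<^bsub>A\<^esub> homogeneous_part A v a) (homogeneous_part B u b' \<otimes>\<^bsub>B\<^esub> b))" for u v
    using assms c by (auto simp: s t intro: cong_sym z)
  have "e a' b' \<star> e a b = (\<Sum>u\<in>{0, 1}. \<Sum>v\<in>{0, 1}. pscale (koszul_sign u v)
      (e (a' \<otimes>\<^bsub>A\<^esub> homogeneous_part A v a) (homogeneous_part B u b' \<otimes>\<^bsub>B\<^esub> b)))"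
    by (simp add: mult_single_right)
  also have "\<dots> \<approx> (\<Sum>u\<in>{0, 1}. \<Sum>v\<in>{0, 1}.
      if u = s \<and> v = t then pscale (koszul_sign s t) (e (a' \<otimes>\<^bsub>A\<^esub> a) (b' \<otimes>\<^bsub>B\<^esub> b)) else 0)"
    by (intro cong_sum cong_sym[OF *])
  also have "\<dots> = pscale (koszul_sign s t) (e (a' \<otimes>\<^bsub>A\<^esub> a) (b' \<otimes>\<^bsub>B\<^esub> b))"
    by (cases s; cases t) simp_all
  finally show ?thesis .
qed

lemma mult_keys:
  assumes "keys f \<subseteq> carrier A \<times> carrier B" "keys g \<subseteq> carrier A \<times> carrier B"
  shows "keys (f \<star> g) \<subseteq> carrier A \<times> carrier B"
  unfolding pretensor_mult_plin
proof (intro keys_plin)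
  fix x assume "x \<in> keys f"
  then obtain a' b' where x: "x = (a', b')" "a' \<in> carrier A" "b' \<in> carrier B" using assms by auto
  have "keys (case y of (a, b) \<Rightarrow> \<Sum>s\<in>{0, 1}. \<Sum>t\<in>{0, 1}. pscale (koszul_sign s t)
      (e (a' \<otimes>\<^bsub>A\<^esub> homogeneous_part A t a) (homogeneous_part B s b' \<otimes>\<^bsub>B\<^esub> b))) \<subseteq> carrier A \<times> carrier B"
    if y: "y \<in> keys g" for y
  proof -
    obtain a b where y: "y = (a, b)" "a \<in> carrier A" "b \<in> carrier B" using y assms by auto
    have "(\<Sum>s\<in>{0, 1}. \<Sum>t\<in>{0, 1}. pscale (koszul_sign s t)
      (e (a' \<otimes>\<^bsub>A\<^esub> homogeneous_part A t a) (homogeneous_part B s b' \<otimes>\<^bsub>B\<^esub> b))) \<in>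
      {f. keys f \<subseteq> carrier A \<times> carrier B}"
      by (intro pscale.subspace_sum[OF subspace_keys] pscale.subspace_scale[OF subspace_keys])
        (use x y in simp)
    then show ?thesis by (simp add: y)
  qed
  then show "keys (case x of (a', b') \<Rightarrow> plin (\<lambda>(a, b). \<Sum>s\<in>{0, 1}. \<Sum>t\<in>{0, 1}.
      pscale (koszul_sign s t) (e (a' \<otimes>\<^bsub>A\<^esub> homogeneous_part A t a) (homogeneous_part B s b' \<otimes>\<^bsub>B\<^esub> b))) g)
      \<subseteq> carrier A \<times> carrier B"
    unfolding x(1) by (auto intro!: keys_plin)
qed


text \<open>
  In degrees \<open>v1, v2\<close> of the right factors and \<open>u2, u3\<close> of the left factors, both sides carry the
  sign with exponent \<open>v1 u2 + v1 u3 + v2 u3\<close>.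
\<close>

lemma assoc_homogeneous:
  assumes "x \<in> homogeneous_pairs" "y \<in> homogeneous_pairs" "z \<in> homogeneous_pairs"
  shows "(single x 1 \<star> single y 1) \<star> single z 1 \<approx>
    single x 1 \<star> (single y 1 \<star> single z 1)"
proof -
  obtain a1 b1 u1 v1 a2 b2 u2 v2 a3 b3 u3 v3 where
    x: "x = (a1, b1)" "a1 \<in> part A u1" "b1 \<in> part B v1" and
    y: "y = (a2, b2)" "a2 \<in> part A u2" "b2 \<in> part B v2" and
    z: "z = (a3, b3)" "a3 \<in> part A u3" "b3 \<in> part B v3"
    using assms by (auto simp: homogeneous_pairs_def)
  note c = A.part_carrier[OF x(2)] A.part_carrier[OF y(2)] A.part_carrier[OF z(2)]
    B.part_carrier[OF x(3)] B.part_carrier[OF y(3)] B.part_carrier[OF z(3)]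
  have xy: "e a1 b1 \<star> e a2 b2 \<approx> pscale (koszul_sign v1 u2) (e (a1 \<otimes>\<^bsub>A\<^esub> a2) (b1 \<otimes>\<^bsub>B\<^esub> b2))"
    by (intro mult_homogeneous) (use x y c in auto)
  have yz: "e a2 b2 \<star> e a3 b3 \<approx> pscale (koszul_sign v2 u3) (e (a2 \<otimes>\<^bsub>A\<^esub> a3) (b2 \<otimes>\<^bsub>B\<^esub> b3))"
    by (intro mult_homogeneous) (use y z c in auto)
  have "(e a1 b1 \<star> e a2 b2) \<star> e a3 b3 \<approx>
      pscale (koszul_sign v1 u2) (e (a1 \<otimes>\<^bsub>A\<^esub> a2) (b1 \<otimes>\<^bsub>B\<^esub> b2)) \<star> e a3 b3"
    by (intro cong_mult xy cong_refl) (use c in simp_all)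
  also have "\<dots> = pscale (koszul_sign v1 u2) (e (a1 \<otimes>\<^bsub>A\<^esub> a2) (b1 \<otimes>\<^bsub>B\<^esub> b2) \<star> e a3 b3)"
    by (simp only: mult_linear)
  also have "\<dots> \<approx> pscale (koszul_sign v1 u2) (pscale (koszul_sign (v1 + v2) u3)
      (e ((a1 \<otimes>\<^bsub>A\<^esub> a2) \<otimes>\<^bsub>A\<^esub> a3) ((b1 \<otimes>\<^bsub>B\<^esub> b2) \<otimes>\<^bsub>B\<^esub> b3)))"
    by (intro cong_pscale mult_homogeneous B.part_mult) (use x y z c in auto)
  also have "\<dots> = pscale (koszul_sign v2 u3) (pscale (koszul_sign v1 (u2 + u3))
      (e (a1 \<otimes>\<^bsub>A\<^esub> (a2 \<otimes>\<^bsub>A\<^esub> a3)) (b1 \<otimes>\<^bsub>B\<^esub> (b2 \<otimes>\<^bsub>B\<^esub> b3))))"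
    using c by (cases v1; cases v2; cases u2; cases u3) (simp_all add: koszul_sign_def A.m_assoc B.m_assoc)
  also have "\<dots> \<approx> pscale (koszul_sign v2 u3) (e a1 b1 \<star> e (a2 \<otimes>\<^bsub>A\<^esub> a3) (b2 \<otimes>\<^bsub>B\<^esub> b3))"
    by (intro cong_pscale cong_sym[OF mult_homogeneous] A.part_mult) (use x y z c in auto)
  also have "\<dots> = e a1 b1 \<star> pscale (koszul_sign v2 u3) (e (a2 \<otimes>\<^bsub>A\<^esub> a3) (b2 \<otimes>\<^bsub>B\<^esub> b3))"
    by (simp only: mult_linear)
  also have "\<dots> \<approx> e a1 b1 \<star> (e a2 b2 \<star> e a3 b3)"
    by (intro cong_mult cong_sym[OF yz] cong_refl) (use c in \<open>auto simp: keys_pscale\<close>)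
  finally show ?thesis by (simp add: x y z)
qed

lemma assoc_cong:
  assumes f: "keys f \<subseteq> carrier A \<times> carrier B" and g: "keys g \<subseteq> carrier A \<times> carrier B"
    and h: "keys h \<subseteq> carrier A \<times> carrier B"
  shows "(f \<star> g) \<star> h \<approx> f \<star> (g \<star> h)"
proof -
  let ?e = "\<lambda>x. single x 1"
  have 1: "(?e x \<star> ?e y) \<star> h \<approx> ?e x \<star> (?e y \<star> h)"
    if xy: "x \<in> homogeneous_pairs" "y \<in> homogeneous_pairs" and "keys h \<subseteq> homogeneous_pairs" for x y h
    using that(3)
    by (induction h rule: free_vector_space_induct)
      (simp_all add: assoc_homogeneous[OF xy] cong_add cong_pscale)
  have 2: "(?e x \<star> g) \<star> h \<approx> ?e x \<star> (g \<star> h)"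
    if "x \<in> homogeneous_pairs" "keys g \<subseteq> homogeneous_pairs"
      and h: "keys h \<subseteq> homogeneous_pairs" for x g h
    using that(2)
    by (induction g rule: free_vector_space_induct)
      (simp_all add: 1[OF that(1) _ h] cong_add cong_pscale)
  have 3: "(f \<star> g) \<star> h \<approx> f \<star> (g \<star> h)"
    if "keys f \<subseteq> homogeneous_pairs" and g: "keys g \<subseteq> homogeneous_pairs"
      and h: "keys h \<subseteq> homogeneous_pairs" for f g h
    using that(1)
    by (induction f rule: free_vector_space_induct)
      (simp_all add: 2[OF _ g h] cong_add cong_pscale)
  obtain f' where f': "keys f' \<subseteq> homogeneous_pairs" "f \<approx> f'" using homogeneous_representative'[OF f] .
  obtain g' where g': "keys g' \<subseteq> homogeneous_pairs" "g \<approx> g'" using homogeneous_representative'[OF g] .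
  obtain h' where h': "keys h' \<subseteq> homogeneous_pairs" "h \<approx> h'" using homogeneous_representative'[OF h] .
  note c = f'(1)[THEN order_trans, OF homogeneous_pairs_carrier] g'(1)[THEN order_trans, OF homogeneous_pairs_carrier]
    h'(1)[THEN order_trans, OF homogeneous_pairs_carrier]
  have "(f \<star> g) \<star> h \<approx> (f' \<star> g') \<star> h'"
    by (intro cong_mult f' g' h' mult_keys c f g h)
  also have "\<dots> \<approx> f' \<star> (g' \<star> h')" by (intro 3 f' g' h')
  also have "\<dots> \<approx> f \<star> (g \<star> h)"
    by (intro cong_mult cong_sym[OF f'(2)] cong_sym[OF g'(2)] cong_sym[OF h'(2)] mult_keys c f g h)
  finally show ?thesis .
qed

lemma one_cong:
  assumes "keys f \<subseteq> carrier A \<times> carrier B"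
  shows "e \<one>\<^bsub>A\<^esub> \<one>\<^bsub>B\<^esub> \<star> f \<approx> f" "f \<star> e \<one>\<^bsub>A\<^esub> \<one>\<^bsub>B\<^esub> \<approx> f"
proof -
  have sgn: "koszul_sign 0 s = 1" "koszul_sign s 0 = 1" for s by (simp_all add: koszul_sign_def)
  have 1: "e \<one>\<^bsub>A\<^esub> \<one>\<^bsub>B\<^esub> \<star> g \<approx> g \<and> g \<star> e \<one>\<^bsub>A\<^esub> \<one>\<^bsub>B\<^esub> \<approx> g" if "keys g \<subseteq> homogeneous_pairs" for g
    using that
  proof (induction g rule: free_vector_space_induct)
    case (basis x)
    then obtain a b u v where x: "x = (a, b)" "a \<in> part A u" "b \<in> part B v"
      by (auto simp: homogeneous_pairs_def)
    note c = A.part_carrier[OF x(2)] B.part_carrier[OF x(3)]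
    show ?case
      using mult_homogeneous[OF A.one_closed B.one_part x(2) c(2)]
        mult_homogeneous[OF c(1) x(3) A.one_part B.one_closed] c
      by (simp add: x(1) sgn)
  qed (simp_all add: cong_add cong_pscale)
  obtain f' where f': "keys f' \<subseteq> homogeneous_pairs" "f \<approx> f'" using homogeneous_representative'[OF assms] .
  note c = f'(1)[THEN order_trans, OF homogeneous_pairs_carrier]
  have "e \<one>\<^bsub>A\<^esub> \<one>\<^bsub>B\<^esub> \<star> f \<approx> e \<one>\<^bsub>A\<^esub> \<one>\<^bsub>B\<^esub> \<star> f'" "f \<star> e \<one>\<^bsub>A\<^esub> \<one>\<^bsub>B\<^esub> \<approx> f' \<star> e \<one>\<^bsub>A\<^esub> \<one>\<^bsub>B\<^esub>"
    using f' c assms by (intro cong_mult; simp)+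
  then show "e \<one>\<^bsub>A\<^esub> \<one>\<^bsub>B\<^esub> \<star> f \<approx> f" "f \<star> e \<one>\<^bsub>A\<^esub> \<one>\<^bsub>B\<^esub> \<approx> f"
    using 1[OF f'(1)] cong_sym[OF f'(2)] cong_trans by blast+
qed

text \<open>
  The projection to total degree zero.  It is a sum of tensor products of linear maps and
  therefore preserves the bilinearity relations, so their span is homogeneous.
\<close>

definition graded_proj :: "('a \<times> 'b \<Rightarrow>\<^sub>0 'k) \<Rightarrow> ('a \<times> 'b \<Rightarrow>\<^sub>0 'k)" where
  "graded_proj f = (\<Sum>t\<in>{0, 1}. tensor_map (homogeneous_part A t) (homogeneous_part B t) f)"

lemma graded_proj_linear:
  "graded_proj 0 = 0" "graded_proj (f + g) = graded_proj f + graded_proj g"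
  "graded_proj (pscale k f) = pscale k (graded_proj f)"
  by (simp_all add: graded_proj_def sum.distrib pscale.scale_right_distrib)

lemma graded_proj_I: "f \<in> I \<Longrightarrow> graded_proj f \<in> I"
  unfolding graded_proj_def
  by (intro pscale.subspace_sum[OF I_subspace] tensor_map_I)
    (simp_all add: A.homogeneous_part_add A.homogeneous_part_smult
      B.homogeneous_part_add B.homogeneous_part_smult)

lemma graded_proj_part:
  assumes "keys f \<subseteq> (\<Union>t. part A t \<times> part B (s + t))"
  shows "graded_proj f \<approx> (if s = 0 then f else 0)"
  using assms
proof (induction f rule: free_vector_space_induct)
  case (basis x)
  then obtain a b t where x: "x = (a, b)" "a \<in> part A t" "b \<in> part B (s + t)" by auto
  note c = A.part_carrier[OF x(2)] B.part_carrier[OF x(3)]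
  have a: "homogeneous_part A u a = (if u = t then a else \<zero>\<^bsub>A\<^esub>)" for u
    using x A.homogeneous_part_same A.homogeneous_part_other by auto
  have b: "homogeneous_part B u b = (if u = s + t then b else \<zero>\<^bsub>B\<^esub>)" for u
    using x B.homogeneous_part_same B.homogeneous_part_other by auto
  have "graded_proj (e a b) \<approx> (if s = 0 then e a b else 0)"
  proof (cases "s = 0")
    case True
    have "e \<zero>\<^bsub>A\<^esub> \<zero>\<^bsub>B\<^esub> \<approx> 0" by (rule e_cong(5)) (auto simp: c)
    then have "e a b + e \<zero>\<^bsub>A\<^esub> \<zero>\<^bsub>B\<^esub> \<approx> e a b + 0" by (intro cong_add) simp
    then show ?thesis using True by (cases t) (simp_all add: graded_proj_def a b add.commute)
  next
    case False
    then have s: "s = 1" by (cases s) auto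
    have "e a \<zero>\<^bsub>B\<^esub> \<approx> 0" "e \<zero>\<^bsub>A\<^esub> b \<approx> 0" using e_cong(5,6)[OF c] by auto
    then have "e a \<zero>\<^bsub>B\<^esub> + e \<zero>\<^bsub>A\<^esub> b \<approx> 0 + 0" by (rule cong_add)
    then show ?thesis using s by (cases t) (simp_all add: graded_proj_def a b add.commute)
  qed
  then show ?case by (simp only: x(1))
next
  case (scale k f)
  then show ?case using cong_pscale[OF scale.IH, of k]
    by (cases "s = 0") (simp_all add: graded_proj_linear)
next
  case (add f g)
  then show ?case by (auto simp: graded_proj_linear dest: cong_add)
qed (simp add: graded_proj_linear)

lemma mult_part:
  assumes f: "keys f \<subseteq> (\<Union>u. part A u \<times> part B (s + u))"
    and g: "keys g \<subseteq> (\<Union>v. part A v \<times> part B (t + v))"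
  shows "keys (f \<star> g) \<subseteq> (\<Union>w. part A w \<times> part B (s + t + w))"
  unfolding pretensor_mult_plin
proof (rule keys_plin)
  fix x assume "x \<in> keys f"
  then obtain a' b' u where x: "x = (a', b')" "a' \<in> part A u" "b' \<in> part B (s + u)" using f by auto
  have "keys (case y of (a, b) \<Rightarrow> \<Sum>i\<in>{0, 1}. \<Sum>j\<in>{0, 1}. pscale (koszul_sign i j)
      (e (a' \<otimes>\<^bsub>A\<^esub> homogeneous_part A j a) (homogeneous_part B i b' \<otimes>\<^bsub>B\<^esub> b)))
      \<subseteq> (\<Union>w. part A w \<times> part B (s + t + w))"
    if y: "y \<in> keys g" for y
  proof -
    obtain a b v where y: "y = (a, b)" "a \<in> part A v" "b \<in> part B (t + v)" using y g by auto
    note c = A.part_carrier[OF x(2)] B.part_carrier[OF x(3)] A.part_carrier[OF y(2)] B.part_carrier[OF y(3)]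
    have p: "a' \<otimes>\<^bsub>A\<^esub> a \<in> part A (u + v)" "b' \<otimes>\<^bsub>B\<^esub> b \<in> part B ((s + u) + (t + v))"
      using A.part_mult[OF x(2) y(2)] B.part_mult[OF x(3) y(3)] .
    have "\<exists>w. a' \<otimes>\<^bsub>A\<^esub> homogeneous_part A j a \<in> part A w \<and>
        homogeneous_part B i b' \<otimes>\<^bsub>B\<^esub> b \<in> part B (s + t + w)" for i j
    proof (cases "j = v")
      case True
      then have "a' \<otimes>\<^bsub>A\<^esub> homogeneous_part A j a \<in> part A (u + v)"
        using p(1) by (simp add: A.homogeneous_part_same[OF y(2)])
      moreover have "homogeneous_part B i b' \<otimes>\<^bsub>B\<^esub> b \<in> part B (s + t + (u + v))"
      proof -
        have "homogeneous_part B i b' = b' \<or> homogeneous_part B i b' = \<zero>\<^bsub>B\<^esub>"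
          using B.homogeneous_part_same[OF x(3)] B.homogeneous_part_other[OF x(3), of i] by blast
        moreover have "(s + u) + (t + v) = s + t + (u + v)" by (simp only: ac_simps)
        ultimately show ?thesis using p(2) B.part_zero c by (elim disjE) (simp_all only: B.l_null)
      qed
      ultimately show ?thesis by blast
    next
      case False
      then have "a' \<otimes>\<^bsub>A\<^esub> homogeneous_part A j a = \<zero>\<^bsub>A\<^esub>"
        using c by (simp add: A.homogeneous_part_other[OF y(2)])
      \<comment> \<open>Zero lies in every component of \<open>A\<close>, so the degree in \<open>A\<close> can be chosen to fit that in \<open>B\<close>.\<close>
      moreover have "homogeneous_part B i b' \<otimes>\<^bsub>B\<^esub> b \<in> part B (s + t + (s + t + (i + (t + v))))"
        using B.part_mult[OF B.homogeneous_part_part[OF c(2)] y(3)] by (simp only: bit_add_self)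
      ultimately show ?thesis by (metis A.part_zero)
    qed
    then have *: "(a' \<otimes>\<^bsub>A\<^esub> homogeneous_part A j a, homogeneous_part B i b' \<otimes>\<^bsub>B\<^esub> b) \<in>
        (\<Union>w. part A w \<times> part B (s + t + w))" for i j by simp
    have "(\<Sum>i\<in>{0, 1}. \<Sum>j\<in>{0, 1}. pscale (koszul_sign i j)
      (e (a' \<otimes>\<^bsub>A\<^esub> homogeneous_part A j a) (homogeneous_part B i b' \<otimes>\<^bsub>B\<^esub> b))) \<in>
      {f. keys f \<subseteq> (\<Union>w. part A w \<times> part B (s + t + w))}"
    proof (intro pscale.subspace_sum[OF subspace_keys] pscale.subspace_scale[OF subspace_keys])
      show "e (a' \<otimes>\<^bsub>A\<^esub> homogeneous_part A j a) (homogeneous_part B i b' \<otimes>\<^bsub>B\<^esub> b) \<in>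
        {f. keys f \<subseteq> (\<Union>w. part A w \<times> part B (s + t + w))}" for i j
        using *[of j i] by (simp only: mem_Collect_eq keys_single) simp
    qed
    then show ?thesis by (simp only: y mem_Collect_eq prod.case)
  qed
  then show "keys (case x of (a', b') \<Rightarrow> plin (\<lambda>(a, b). \<Sum>i\<in>{0, 1}. \<Sum>j\<in>{0, 1}.
      pscale (koszul_sign i j) (e (a' \<otimes>\<^bsub>A\<^esub> homogeneous_part A j a) (homogeneous_part B i b' \<otimes>\<^bsub>B\<^esub> b))) g)
      \<subseteq> (\<Union>w. part A w \<times> part B (s + t + w))"
    unfolding x(1) prod.case by (rule keys_plin)
qed

sublocale P: presuperalgebra "pretensor A B" I
proof
  have pt: "(\<Union>t. part A t \<times> part B (s + t)) \<subseteq> carrier A \<times> carrier B" for s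
    using A.part_carrier B.part_carrier by auto
  show "part (pretensor A B) s \<subseteq> carrier (pretensor A B)" for s
    using order_trans[OF _ pt[of s]] by (simp only: pretensor_simps) blast
  show "\<exists>y\<in>part (pretensor A B) 0. \<exists>z\<in>part (pretensor A B) 1. x - (y + z) \<in> I"
    if "x \<in> carrier (pretensor A B)" for x
  proof -
    have "keys x \<subseteq> carrier A \<times> carrier B" using that by simp
    from homogeneous_representative[OF this] obtain y z where
      "keys y \<subseteq> (\<Union>t. part A t \<times> part B t)"
      "keys z \<subseteq> (\<Union>t. part A t \<times> part B (1 + t))" "x \<approx> y + z"
      by (elim exE conjE)
    then show ?thesis
      by (intro bexI[of _ y] bexI[of _ z]) (simp_all only: cong_def pretensor_simps mem_Collect_eq add_0)
  qed
  show "y \<in> I" if y: "y \<in> part (pretensor A B) 0" and z: "z \<in> part (pretensor A B) 1" and "y + z \<in> I" for y z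
  proof -
    have "graded_proj y \<approx> y" using graded_proj_part[of y 0] y by simp
    moreover have "graded_proj z \<approx> 0" using graded_proj_part[of z 1] z by simp
    ultimately have "graded_proj (y + z) \<approx> y + 0" unfolding graded_proj_linear by (rule cong_add)
    then have "y \<approx> graded_proj (y + z)" using cong_sym by simp
    moreover have "graded_proj (y + z) \<approx> 0" using graded_proj_I[OF \<open>y + z \<in> I\<close>] by (simp add: cong_def)
    ultimately have "y \<approx> 0" by (rule cong_trans)
    then show ?thesis by (simp add: cong_def)
  qed
  show "x \<otimes>\<^bsub>pretensor A B\<^esub> y \<in> part (pretensor A B) (s + t)"
    if "x \<in> part (pretensor A B) s" "y \<in> part (pretensor A B) t" for x y s t
    using mult_part[of x s y t] that by (simp only: pretensor_simps mem_Collect_eq)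
qed (use I_subspace I_carrier I_left I_right assoc_cong one_cong mult_keys subspace_keys in
      \<open>simp_all add: cong_def\<close>)

end

section \<open>Superalgebra homomorphisms\<close>

context superalgebra_hom
begin

lemma hom_carrier: "x \<in> carrier A \<Longrightarrow> h x \<in> carrier B"
  by (rule ring_hom_closed[OF hom_ring])

lemma hom_mult: "\<lbrakk>x \<in> carrier A; y \<in> carrier A\<rbrakk> \<Longrightarrow> h (x \<otimes>\<^bsub>A\<^esub> y) = h x \<otimes>\<^bsub>B\<^esub> h y"
  by (rule ring_hom_mult[OF hom_ring])

lemma hom_add: "\<lbrakk>x \<in> carrier A; y \<in> carrier A\<rbrakk> \<Longrightarrow> h (x \<oplus>\<^bsub>A\<^esub> y) = h x \<oplus>\<^bsub>B\<^esub> h y"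
  by (rule ring_hom_add[OF hom_ring])

lemma hom_one: "h \<one>\<^bsub>A\<^esub> = \<one>\<^bsub>B\<^esub>"
  by (rule ring_hom_one[OF hom_ring])

lemma hom_zero: "h \<zero>\<^bsub>A\<^esub> = \<zero>\<^bsub>B\<^esub>"
  using hom_smult[of "\<one>\<^bsub>A\<^esub>" 0] by (simp add: hom_one)

lemma hom_uminus: "x \<in> carrier A \<Longrightarrow> h (\<ominus>\<^bsub>A\<^esub> x) = \<ominus>\<^bsub>B\<^esub> h x"
  using hom_smult[of x "- 1"] by (simp add: A.smult_neg_1 B.smult_neg_1 hom_carrier)

lemma hom_diff: "\<lbrakk>x \<in> carrier A; y \<in> carrier A\<rbrakk> \<Longrightarrow> h (x \<ominus>\<^bsub>A\<^esub> y) = h x \<ominus>\<^bsub>B\<^esub> h y"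
  by (simp add: a_minus_def hom_add hom_uminus)

end

lemma superalgebra_hom_id: "superalgebra A \<Longrightarrow> superalgebra_hom A A (\<lambda>x. x)"
  by (intro superalgebra_hom_memI) auto

lemma superalgebra_hom_comp:
  assumes "superalgebra_hom A B g" "superalgebra_hom B C h"
  shows "superalgebra_hom A C (\<lambda>x. h (g x))"
proof -
  interpret g: superalgebra_hom A B g by fact
  interpret h: superalgebra_hom B C h by fact
  have "h (g x) \<in> part C s" if "x \<in> part A s" for x s
    using that g.hom_part[of s] h.hom_part[of s] by (meson image_subset_iff)
  then show ?thesis
    by (intro superalgebra_hom_memI g.A.superalgebra_axioms h.B.superalgebra_axioms)
      (auto simp: g.hom_carrier h.hom_carrier g.hom_mult h.hom_mult g.hom_add h.hom_add
        g.hom_one h.hom_one g.hom_smult h.hom_smult)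
qed

lemma superalgebra_isoI:
  assumes "superalgebra_hom A B h" "superalgebra_hom B A g"
    and "\<And>x. x \<in> carrier A \<Longrightarrow> g (h x) = x" "\<And>y. y \<in> carrier B \<Longrightarrow> h (g y) = y"
  shows "superalgebra_iso A B h"
proof -
  interpret h: superalgebra_hom A B h by fact
  interpret g: superalgebra_hom B A g by fact
  have "bij_betw h (carrier A) (carrier B)"
    by (rule bij_betw_byWitness[of _ g]) (use assms(3,4) h.hom_carrier g.hom_carrier in auto)
  then show ?thesis by (intro superalgebra_iso.intro superalgebra_iso_axioms.intro assms(1))
qed

section \<open>The universal property of the tensor product\<close>

context superalgebra_pair
begin

abbreviation "Ten \<equiv> super_tensor A B"

abbreviation "inl a \<equiv> pure_tensor A B a \<one>\<^bsub>B\<^esub>"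

abbreviation "inr b \<equiv> pure_tensor A B \<one>\<^bsub>A\<^esub> b"

lemma Ten_eq: "Ten = superquot (pretensor A B) I"
  by (simp add: super_tensor_def)

lemma pure_eq: "pure_tensor A B a b = P.cls (e a b)"
  by (simp add: pure_tensor_def P.cls_def)

lemma superalgebra_Ten: "superalgebra Ten"
  unfolding Ten_eq by (rule P.quot_superalgebra)

sublocale T: superalgebra Ten
  by (rule superalgebra_Ten)

lemma cls_cong: "P.cls f = P.cls g \<longleftrightarrow> f \<approx> g"
  by (simp add: P.cls_eq_iff cong_def)

lemma pure_carrier: "\<lbrakk>a \<in> carrier A; b \<in> carrier B\<rbrakk> \<Longrightarrow> pure_tensor A B a b \<in> carrier Ten"
  by (simp add: pure_eq Ten_eq P.quot_carrier)

lemma pure_one: "pure_tensor A B \<one>\<^bsub>A\<^esub> \<one>\<^bsub>B\<^esub> = \<one>\<^bsub>Ten\<^esub>"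
  by (simp add: pure_eq Ten_eq P.quot_one)

lemma pure_add:
  "\<lbrakk>a \<in> carrier A; a' \<in> carrier A; b \<in> carrier B\<rbrakk> \<Longrightarrow>
    pure_tensor A B (a \<oplus>\<^bsub>A\<^esub> a') b = pure_tensor A B a b \<oplus>\<^bsub>Ten\<^esub> pure_tensor A B a' b"
  "\<lbrakk>a \<in> carrier A; b \<in> carrier B; b' \<in> carrier B\<rbrakk> \<Longrightarrow>
    pure_tensor A B a (b \<oplus>\<^bsub>B\<^esub> b') = pure_tensor A B a b \<oplus>\<^bsub>Ten\<^esub> pure_tensor A B a b'"
  by (simp_all add: pure_eq Ten_eq P.quot_add cls_cong e_cong)

lemma pure_smult:
  "\<lbrakk>a \<in> carrier A; b \<in> carrier B\<rbrakk> \<Longrightarrow>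
    pure_tensor A B (k \<odot>\<^bsub>A\<^esub> a) b = k \<odot>\<^bsub>Ten\<^esub> pure_tensor A B a b"
  "\<lbrakk>a \<in> carrier A; b \<in> carrier B\<rbrakk> \<Longrightarrow>
    pure_tensor A B a (k \<odot>\<^bsub>B\<^esub> b) = k \<odot>\<^bsub>Ten\<^esub> pure_tensor A B a b"
  using e_cong(3,4)[of a b k] by (simp_all add: pure_eq Ten_eq P.quot_smult cls_cong)

lemma pure_mult:
  assumes "a' \<in> carrier A" "b' \<in> part B s" "a \<in> part A t" "b \<in> carrier B"
  shows "pure_tensor A B a' b' \<otimes>\<^bsub>Ten\<^esub> pure_tensor A B a b =
    koszul_sign s t \<odot>\<^bsub>Ten\<^esub> pure_tensor A B (a' \<otimes>\<^bsub>A\<^esub> a) (b' \<otimes>\<^bsub>B\<^esub> b)"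
  using mult_homogeneous[OF assms] assms A.part_carrier B.part_carrier
  by (simp add: pure_eq Ten_eq P.quot_mult P.quot_smult cls_cong)

lemma pure_part: "\<lbrakk>a \<in> part A s; b \<in> part B t\<rbrakk> \<Longrightarrow> pure_tensor A B a b \<in> part Ten (s + t)"
proof -
  assume ab: "a \<in> part A s" "b \<in> part B t"
  have "s + t + s = t" by (cases s; cases t) simp_all
  then have "(a, b) \<in> (\<Union>u. part A u \<times> part B (s + t + u))" using ab by (intro UN_I[of s]) auto
  then show "pure_tensor A B a b \<in> part Ten (s + t)"
    unfolding pure_eq Ten_eq P.quot_part
    by (intro imageI) (simp only: pretensor_simps mem_Collect_eq keys_single, simp)
qed

text \<open>
  Elementary tensors span the tensor product.
\<close>

lemma pure_linear_hom:
  "\<lbrakk>superalgebra_hom Ten D h; superalgebra_hom Ten D h';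
    \<And>a b. \<lbrakk>a \<in> carrier A; b \<in> carrier B\<rbrakk> \<Longrightarrow> h (pure_tensor A B a b) = h' (pure_tensor A B a b);
    x \<in> carrier Ten\<rbrakk> \<Longrightarrow> h x = h' x"
proof -
  assume h: "superalgebra_hom Ten D h" and h': "superalgebra_hom Ten D h'"
    and eq: "\<And>a b. \<lbrakk>a \<in> carrier A; b \<in> carrier B\<rbrakk> \<Longrightarrow> h (pure_tensor A B a b) = h' (pure_tensor A B a b)"
    and "x \<in> carrier Ten"
  interpret h: superalgebra_hom Ten D h by (rule h)
  interpret h': superalgebra_hom Ten D h' by (rule h')
  obtain f where f: "keys f \<subseteq> carrier A \<times> carrier B" "x = P.cls f"
    using \<open>x \<in> carrier Ten\<close> by (auto simp: Ten_eq P.quot_carrier)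
  have "P.cls f \<in> carrier Ten \<and> h (P.cls f) = h' (P.cls f)" using f(1)
  proof (induction f rule: poly_mapping_linear_induct)
    case zero
    have "P.cls 0 = \<zero>\<^bsub>Ten\<^esub>" by (simp add: Ten_eq P.quot_zero)
    then show ?case using T.zero_closed h.hom_zero h'.hom_zero by simp
  next
    case (single x k)
    then obtain a b where x: "x = (a, b)" "a \<in> carrier A" "b \<in> carrier B" by auto
    have "P.cls (single x k) = k \<odot>\<^bsub>Ten\<^esub> pure_tensor A B a b"
      by (simp add: x pure_eq Ten_eq P.quot_smult)
    then show ?case using x pure_carrier eq by (simp add: h.hom_smult h'.hom_smult)
  next
    case (add f g)
    have "P.cls (f + g) = P.cls f \<oplus>\<^bsub>Ten\<^esub> P.cls g" by (simp add: Ten_eq P.quot_add)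
    then show ?case using add.IH by (simp add: h.hom_add h'.hom_add)
  qed
  then show "h x = h' x" by (simp add: f(2))
qed

lemma inl_hom: "superalgebra_hom A Ten (\<lambda>a. inl a)"
proof (intro superalgebra_hom_memI A.superalgebra_axioms superalgebra_Ten)
  fix x y assume xy: "x \<in> carrier A" "y \<in> carrier A"
  obtain y0 y1 where y: "y0 \<in> part A 0" "y1 \<in> part A 1" "y = y0 \<oplus>\<^bsub>A\<^esub> y1"
    using A.homogeneous_decomposition[OF xy(2), of 0] by auto
  note c = A.part_carrier[OF y(1)] A.part_carrier[OF y(2)]
  have "inl (x \<otimes>\<^bsub>A\<^esub> z) = inl x \<otimes>\<^bsub>Ten\<^esub> inl z" if "z \<in> part A t" for z t
    using pure_mult[OF xy(1) B.one_part that B.one_closed] xy A.part_carrier[OF that]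
    by (simp add: koszul_sign_def pure_carrier)
  then have "inl (x \<otimes>\<^bsub>A\<^esub> y0) \<oplus>\<^bsub>Ten\<^esub> inl (x \<otimes>\<^bsub>A\<^esub> y1) = inl x \<otimes>\<^bsub>Ten\<^esub> (inl y0 \<oplus>\<^bsub>Ten\<^esub> inl y1)"
    using y c xy by (simp add: T.r_distr pure_carrier)
  then show "inl (x \<otimes>\<^bsub>A\<^esub> y) = inl x \<otimes>\<^bsub>Ten\<^esub> inl y"
    using xy c by (simp add: y(3) A.r_distr pure_add)
next
  show "inl x \<in> part Ten s" if "x \<in> part A s" for s x
    using pure_part[OF that B.one_part] by (simp only: add_0_right)
qed (auto simp: pure_carrier pure_add pure_smult pure_one)

lemma inr_hom: "superalgebra_hom B Ten (\<lambda>b. inr b)"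
proof (intro superalgebra_hom_memI B.superalgebra_axioms superalgebra_Ten)
  fix x y assume xy: "x \<in> carrier B" "y \<in> carrier B"
  obtain x0 x1 where x: "x0 \<in> part B 0" "x1 \<in> part B 1" "x = x0 \<oplus>\<^bsub>B\<^esub> x1"
    using B.homogeneous_decomposition[OF xy(1), of 0] by auto
  note c = B.part_carrier[OF x(1)] B.part_carrier[OF x(2)]
  have "inr (z \<otimes>\<^bsub>B\<^esub> y) = inr z \<otimes>\<^bsub>Ten\<^esub> inr y" if "z \<in> part B t" for z t
    using pure_mult[OF A.one_closed that A.one_part xy(2)] xy B.part_carrier[OF that]
    by (simp add: koszul_sign_def pure_carrier)
  then have "inr (x0 \<otimes>\<^bsub>B\<^esub> y) \<oplus>\<^bsub>Ten\<^esub> inr (x1 \<otimes>\<^bsub>B\<^esub> y) = (inr x0 \<oplus>\<^bsub>Ten\<^esub> inr x1) \<otimes>\<^bsub>Ten\<^esub> inr y"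
    using x c xy by (simp add: T.l_distr pure_carrier)
  then show "inr (x \<otimes>\<^bsub>B\<^esub> y) = inr x \<otimes>\<^bsub>Ten\<^esub> inr y"
    using xy c by (simp add: x(3) B.l_distr pure_add)
next
  show "inr x \<in> part Ten s" if "x \<in> part B s" for s x
    using pure_part[OF A.one_part that] by (simp only: add_0)
qed (auto simp: pure_carrier pure_add pure_smult pure_one)

lemma inl_inr:
  assumes "a \<in> carrier A" "b \<in> carrier B"
  shows "inl a \<otimes>\<^bsub>Ten\<^esub> inr b = pure_tensor A B a b"
  using pure_mult[OF assms(1) B.one_part A.one_part assms(2)] assms
  by (simp add: koszul_sign_def pure_carrier)

lemma inr_inl:
  assumes "a \<in> part A t" "b \<in> part B s"
  shows "inr b \<otimes>\<^bsub>Ten\<^esub> inl a = koszul_sign s t \<odot>\<^bsub>Ten\<^esub> (inl a \<otimes>\<^bsub>Ten\<^esub> inr b)"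
  using pure_mult[OF A.one_closed assms(2,1) B.one_closed] A.part_carrier[OF assms(1)] B.part_carrier[OF assms(2)]
  by (simp add: inl_inr)

lemma tensor_hom_unique:
  assumes h: "superalgebra_hom Ten D h" "superalgebra_hom Ten D h'"
    and "\<And>a. a \<in> carrier A \<Longrightarrow> h (inl a) = h' (inl a)" "\<And>b. b \<in> carrier B \<Longrightarrow> h (inr b) = h' (inr b)"
    and "x \<in> carrier Ten"
  shows "h x = h' x"
proof (rule pure_linear_hom[OF h _ assms(5)])
  fix a b assume ab: "a \<in> carrier A" "b \<in> carrier B"
  interpret h: superalgebra_hom Ten D h by (rule h)
  interpret h': superalgebra_hom Ten D h' by (rule h)
  show "h (pure_tensor A B a b) = h' (pure_tensor A B a b)"
    unfolding inl_inr[OF ab, symmetric]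
    using ab assms(3,4) by (simp only: h.hom_mult h'.hom_mult pure_carrier A.one_closed B.one_closed)
qed

text \<open>
  The map \<open>a \<otimes> b \<mapsto> f a \<cdot> g b\<close> is bilinear, and it is multiplicative since moving \<open>g b'\<close> past
  \<open>f a\<close> produces the sign that the product of the tensor product contains.
\<close>

lemma tensor_hom_exists:
  assumes f: "superalgebra_hom A D f" and g: "superalgebra_hom B D g"
    and super: "\<And>a b s t. \<lbrakk>a \<in> part A t; b \<in> part B s\<rbrakk> \<Longrightarrow>
      g b \<otimes>\<^bsub>D\<^esub> f a = koszul_sign s t \<odot>\<^bsub>D\<^esub> (f a \<otimes>\<^bsub>D\<^esub> g b)"
  shows "\<exists>h. superalgebra_hom Ten D h \<and> (\<forall>a\<in>carrier A. h (inl a) = f a) \<and> (\<forall>b\<in>carrier B. h (inr b) = g b)"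
proof -
  interpret D: superalgebra D using f by (rule superalgebra_hom.axioms)
  interpret f: superalgebra_hom A D f by (rule f)
  interpret g: superalgebra_hom B D g by (rule g)
  define \<phi> where "\<phi> = (\<lambda>(a, b). f a \<otimes>\<^bsub>D\<^esub> g b)"
  have \<phi>: "\<phi> \<in> carrier A \<times> carrier B \<rightarrow> carrier D"
    by (auto simp: \<phi>_def f.hom_carrier g.hom_carrier)
  have \<phi>e: "lin D \<phi> (single (a, b) k) = k \<odot>\<^bsub>D\<^esub> (f a \<otimes>\<^bsub>D\<^esub> g b)"
    if "a \<in> carrier A" "b \<in> carrier B" for a b k
    using that by (subst D.lin_single) (auto simp: \<phi>_def f.hom_carrier g.hom_carrier)
  let ?V = "{x. keys x \<subseteq> carrier A \<times> carrier B}"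
  have V: "x + y \<in> ?V" "x - y \<in> ?V" "- x \<in> ?V" "pscale k x \<in> ?V" if "x \<in> ?V" "y \<in> ?V" for x y k
    using pscale.subspace_add[OF subspace_keys that] pscale.subspace_diff[OF subspace_keys that]
      pscale.subspace_neg[OF subspace_keys that(1)] pscale.subspace_scale[OF subspace_keys that(1)]
    by simp_all
  have Ve: "single (a, b) k \<in> ?V" if "a \<in> carrier A" "b \<in> carrier B" for a b and k :: 'k
    using that by simp
  have lin_carrier: "lin D \<phi> x \<in> carrier D" if "x \<in> ?V" for x
    using that \<phi> by (intro D.lin_carrier) auto
  have lin_add: "lin D \<phi> (x + y) = lin D \<phi> x \<oplus>\<^bsub>D\<^esub> lin D \<phi> y" if "x \<in> ?V" "y \<in> ?V" for x y
    using that by (intro D.lin_add[OF \<phi>]) auto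
  have lin_scale: "lin D \<phi> (pscale k x) = k \<odot>\<^bsub>D\<^esub> lin D \<phi> x" if "x \<in> ?V" for k x
    using that \<phi> by (intro D.lin_pscale) auto
  have lin_diff: "lin D \<phi> (x - y) = lin D \<phi> x \<ominus>\<^bsub>D\<^esub> lin D \<phi> y" if "x \<in> ?V" "y \<in> ?V" for x y
  proof -
    have "lin D \<phi> (- y) = \<ominus>\<^bsub>D\<^esub> lin D \<phi> y"
      using lin_scale[OF that(2), of "- 1"] lin_carrier[OF that(2)] by (simp add: D.smult_neg_1)
    then show ?thesis using lin_add[OF that(1) V(3)[OF that(2,2)]] by (simp add: a_minus_def)
  qed
  have lin_mult: "lin D \<phi> (x \<star> y) = lin D \<phi> x \<otimes>\<^bsub>D\<^esub> lin D \<phi> y" if "x \<in> ?V" "y \<in> ?V" for x y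
  proof -
    have on_basis: "lin D \<phi> (e a' b' \<star> e a b) = lin D \<phi> (e a' b') \<otimes>\<^bsub>D\<^esub> lin D \<phi> (e a b)"
      if ab: "a' \<in> carrier A" "b' \<in> carrier B" "a \<in> carrier A" "b \<in> carrier B" for a' b' a b
    proof -
      let ?w = "\<lambda>s t. pscale (koszul_sign s t)
        (e (a' \<otimes>\<^bsub>A\<^esub> homogeneous_part A t a) (homogeneous_part B s b' \<otimes>\<^bsub>B\<^esub> b))"
      let ?y = "\<lambda>s t. f a' \<otimes>\<^bsub>D\<^esub> ((g (homogeneous_part B s b') \<otimes>\<^bsub>D\<^esub> f (homogeneous_part A t a)) \<otimes>\<^bsub>D\<^esub> g b)"
      have w: "?w s t \<in> ?V" for s t using ab by simp
      have wy: "lin D \<phi> (?w s t) = ?y s t" for s t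
        using ab super[OF A.homogeneous_part_part[OF ab(3)] B.homogeneous_part_part[OF ab(2)], of s t]
        by (simp add: \<phi>e f.hom_mult g.hom_mult f.hom_carrier g.hom_carrier D.m_assoc
            D.smult_mult_left D.smult_mult_right)
      have "e a' b' \<star> e a b = (?w 0 0 + ?w 0 1) + (?w 1 0 + ?w 1 1)"
        by (simp add: mult_single_right)
      then have "lin D \<phi> (e a' b' \<star> e a b) = (?y 0 0 \<oplus>\<^bsub>D\<^esub> ?y 0 1) \<oplus>\<^bsub>D\<^esub> (?y 1 0 \<oplus>\<^bsub>D\<^esub> ?y 1 1)"
        by (simp only: lin_add V w wy)
      also have "\<dots> = f a' \<otimes>\<^bsub>D\<^esub> (((g (homogeneous_part B 0 b') \<oplus>\<^bsub>D\<^esub> g (homogeneous_part B 1 b')) \<otimes>\<^bsub>D\<^esub>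
          (f (homogeneous_part A 0 a) \<oplus>\<^bsub>D\<^esub> f (homogeneous_part A 1 a))) \<otimes>\<^bsub>D\<^esub> g b)"
        using ab by (simp add: f.hom_carrier g.hom_carrier D.l_distr D.r_distr D.a_ac)
      also have "\<dots> = f a' \<otimes>\<^bsub>D\<^esub> ((g b' \<otimes>\<^bsub>D\<^esub> f a) \<otimes>\<^bsub>D\<^esub> g b)"
        using ab by (simp add: A.homogeneous_part_sum B.homogeneous_part_sum flip: f.hom_add g.hom_add)
      also have "\<dots> = lin D \<phi> (e a' b') \<otimes>\<^bsub>D\<^esub> lin D \<phi> (e a b)"
        using ab by (simp add: \<phi>e f.hom_carrier g.hom_carrier D.m_assoc)
      finally show ?thesis .
    qed
    have left: "lin D \<phi> (e a' b' \<star> y) = lin D \<phi> (e a' b') \<otimes>\<^bsub>D\<^esub> lin D \<phi> y"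
      if ab: "a' \<in> carrier A" "b' \<in> carrier B" and y: "keys y \<subseteq> carrier A \<times> carrier B" for a' b' y
      using y
    proof (induction y rule: free_vector_space_induct)
      case (basis z)
      then show ?case using on_basis[OF ab] by (cases z) simp
    next
      case (scale k x)
      have "e a' b' \<star> x \<in> ?V" using ab scale.hyps mult_keys by simp
      then show ?case using scale ab lin_carrier Ve by (simp add: lin_scale D.smult_mult_right)
    next
      case (add x y)
      have "e a' b' \<star> x \<in> ?V" "e a' b' \<star> y \<in> ?V" using ab add.hyps mult_keys by simp_all
      then show ?case using add ab lin_carrier Ve by (simp add: lin_add D.r_distr)
    qed (use lin_carrier[OF Ve[OF ab]] in simp)
    have "keys x \<subseteq> carrier A \<times> carrier B" using \<open>x \<in> ?V\<close> by simp
    then show ?thesis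
    proof (induction x rule: free_vector_space_induct)
      case (basis z)
      then show ?case using left \<open>y \<in> ?V\<close> by (cases z) simp
    next
      case (scale k x)
      have "x \<star> y \<in> ?V" using \<open>y \<in> ?V\<close> scale.hyps mult_keys by simp
      then show ?case using scale lin_carrier \<open>y \<in> ?V\<close> by (simp add: lin_scale D.smult_mult_left)
    next
      case (add x x')
      have "x \<star> y \<in> ?V" "x' \<star> y \<in> ?V" using \<open>y \<in> ?V\<close> add.hyps mult_keys by simp_all
      then show ?case using add lin_carrier \<open>y \<in> ?V\<close> by (simp add: lin_add D.l_distr)
    qed (use lin_carrier[OF \<open>y \<in> ?V\<close>] in simp)
  qed
  have lin_I: "x \<in> ?V \<and> lin D \<phi> x = \<zero>\<^bsub>D\<^esub>" if "x \<in> I" for x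
    using that
  proof (induction rule: I_induct)
    case (add x y)
    then show ?case using V(1)[of x y] lin_add[of x y] by simp
  next
    case (scale k x)
    then show ?case using V(4)[of x x k] lin_scale[of x k] by simp
  next
    case (add_left a a' b)
    have m: "e (a \<oplus>\<^bsub>A\<^esub> a') b \<in> ?V" "e a b \<in> ?V" "e a' b \<in> ?V"
      using add_left by (intro Ve; simp)+
    have "lin D \<phi> (e (a \<oplus>\<^bsub>A\<^esub> a') b - e a b - e a' b) =
        (f (a \<oplus>\<^bsub>A\<^esub> a') \<otimes>\<^bsub>D\<^esub> g b) \<ominus>\<^bsub>D\<^esub> (f a \<otimes>\<^bsub>D\<^esub> g b) \<ominus>\<^bsub>D\<^esub> (f a' \<otimes>\<^bsub>D\<^esub> g b)"
      using add_left lin_diff[OF V(2)[OF m(1,2)] m(3)] lin_diff[OF m(1,2)]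
      by (simp add: \<phi>e f.hom_carrier g.hom_carrier)
    also have "\<dots> = \<zero>\<^bsub>D\<^esub>"
      using add_left by (simp add: f.hom_add f.hom_carrier g.hom_carrier D.l_distr D.minus_eq D.a_ac D.r_neg D.r_neg2)
    finally show ?case using V(2)[OF V(2)[OF m(1,2)] m(3)] by blast
  next
    case (add_right a b b')
    have m: "e a (b \<oplus>\<^bsub>B\<^esub> b') \<in> ?V" "e a b \<in> ?V" "e a b' \<in> ?V"
      using add_right by (intro Ve; simp)+
    have "lin D \<phi> (e a (b \<oplus>\<^bsub>B\<^esub> b') - e a b - e a b') =
        (f a \<otimes>\<^bsub>D\<^esub> g (b \<oplus>\<^bsub>B\<^esub> b')) \<ominus>\<^bsub>D\<^esub> (f a \<otimes>\<^bsub>D\<^esub> g b) \<ominus>\<^bsub>D\<^esub> (f a \<otimes>\<^bsub>D\<^esub> g b')"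
      using add_right lin_diff[OF V(2)[OF m(1,2)] m(3)] lin_diff[OF m(1,2)]
      by (simp add: \<phi>e f.hom_carrier g.hom_carrier)
    also have "\<dots> = \<zero>\<^bsub>D\<^esub>"
      using add_right by (simp add: g.hom_add f.hom_carrier g.hom_carrier D.r_distr D.minus_eq D.a_ac D.r_neg D.r_neg2)
    finally show ?case using V(2)[OF V(2)[OF m(1,2)] m(3)] by blast
  next
    case (scale_left k a b)
    have m: "e (k \<odot>\<^bsub>A\<^esub> a) b \<in> ?V" "e a b \<in> ?V" using scale_left by (intro Ve; simp)+
    show ?case
      using scale_left lin_diff[OF m(1) V(4)[OF m(2,2)], of k] lin_scale[OF m(2), of k] V(2)[OF m(1) V(4)[OF m(2,2)], of k]
      by (simp add: \<phi>e f.hom_smult f.hom_carrier g.hom_carrier D.smult_mult_left D.minus_eq D.r_neg del: pscale_single)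
  next
    case (scale_right k a b)
    have m: "e a (k \<odot>\<^bsub>B\<^esub> b) \<in> ?V" "e a b \<in> ?V" using scale_right by (intro Ve; simp)+
    show ?case
      using scale_right lin_diff[OF m(1) V(4)[OF m(2,2)], of k] lin_scale[OF m(2), of k] V(2)[OF m(1) V(4)[OF m(2,2)], of k]
      by (simp add: \<phi>e g.hom_smult f.hom_carrier g.hom_carrier D.smult_mult_right D.minus_eq D.r_neg del: pscale_single)
  qed simp
  have lin_part: "lin D \<phi> x \<in> part D s" if "keys x \<subseteq> (\<Union>t. part A t \<times> part B (s + t))" for x s
  proof -
    have sub: "(\<Union>t. part A t \<times> part B (s + t)) \<subseteq> carrier A \<times> carrier B"
      using A.part_carrier B.part_carrier by auto
    show ?thesis using that
    proof (induction x rule: poly_mapping_linear_induct)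
      case (single x k)
      then obtain a b t where x: "x = (a, b)" "a \<in> part A t" "b \<in> part B (s + t)" by auto
      have "f a \<otimes>\<^bsub>D\<^esub> g b \<in> part D (t + (s + t))"
        using f.hom_part[of t] g.hom_part[of "s + t"] x by (intro D.part_mult) blast+
      moreover have "t + (s + t) = s" by (cases s; cases t) simp_all
      ultimately show ?case
        using x A.part_carrier B.part_carrier by (simp only: \<phi>e D.part_smult)
    next
      case (add x y)
      have "x \<in> ?V" "y \<in> ?V" using add.hyps order_trans[OF _ sub] by auto
      then show ?case using add.IH by (simp only: lin_add D.part_add)
    qed simp
  qed
  have "\<exists>h. superalgebra_hom Ten D h \<and> (\<forall>x\<in>carrier (pretensor A B). h (P.cls x) = lin D \<phi> x)"
    unfolding Ten_eq
  proof (rule P.quot_hom[OF D.superalgebra_axioms])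
    show "lin D \<phi> \<one>\<^bsub>pretensor A B\<^esub> = \<one>\<^bsub>D\<^esub>" by (simp add: \<phi>e f.hom_one g.hom_one)
    show "lin D \<phi> x \<in> part D s" if "x \<in> part (pretensor A B) s" for s x
      using lin_part that by (simp only: pretensor_simps mem_Collect_eq)
  qed (use lin_carrier lin_add lin_mult lin_scale lin_I in simp_all)
  then obtain h where h: "superalgebra_hom Ten D h"
    "\<And>x. x \<in> ?V \<Longrightarrow> h (P.cls x) = lin D \<phi> x" by auto
  have "h (inl a) = f a" if "a \<in> carrier A" for a
    unfolding pure_eq using that by (simp add: h(2) \<phi>e g.hom_one f.hom_carrier)
  moreover have "h (inr b) = g b" if "b \<in> carrier B" for b
    unfolding pure_eq using that by (simp add: h(2) \<phi>e f.hom_one g.hom_carrier)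
  ultimately show ?thesis using h(1) by blast
qed

end

section \<open>Computing in a corner of a ring\<close>

text \<open>
  Rewriting takes place on right-nested products.  A rule for \<open>a * b\<close> has to be supplemented by
  its consequence for \<open>a * (b * x)\<close>.
\<close>

lemma mult_extend: "a * b = c \<Longrightarrow> a * (b * x) = c * (x :: 'a::ring)"
  by (metis mult.assoc)

lemma mult_extend3: "a * (b * d) = c \<Longrightarrow> a * (b * (d * x)) = c * (x :: 'a::ring)"
  by (metis mult.assoc)

text \<open>
  The set \<open>M\<close> is a ring with unit \<open>e\<close> inside a larger ring, of which \<open>e\<close> need not be the unit.
  The central elements \<open>z\<close> and \<open>h\<close> stand for the scalars \<open>\<epsilon>\<close> and \<open>1/2\<close>.
\<close>

locale corner =
  fixes M :: "'w::ring set" and e z h :: 'w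
  assumes unit: "x \<in> M \<Longrightarrow> e * x = x" "x \<in> M \<Longrightarrow> x * e = x"
    and central: "x \<in> M \<Longrightarrow> x * z = z * x" "x \<in> M \<Longrightarrow> x * h = h * x"
    and scalars_mem: "e \<in> M" "z \<in> M" "h \<in> M"
    and closed: "\<lbrakk>x \<in> M; y \<in> M\<rbrakk> \<Longrightarrow> x + y \<in> M" "\<lbrakk>x \<in> M; y \<in> M\<rbrakk> \<Longrightarrow> x - y \<in> M"
      "\<lbrakk>x \<in> M; y \<in> M\<rbrakk> \<Longrightarrow> x * y \<in> M" "x \<in> M \<Longrightarrow> - x \<in> M"
    and half: "h + h = e"
begin

lemma half_double: "x \<in> M \<Longrightarrow> h * (x + x) = x"
  by (metis distrib_left distrib_right half unit(1))

lemma half_double': "x \<in> M \<Longrightarrow> h * x + h * x = x"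
  by (metis distrib_right half unit(1))

lemma half_double'': "x \<in> M \<Longrightarrow> z * (h * x) + z * (h * x) = z * x"
  by (metis distrib_left half_double')

lemma quarters: "h * h + (h * h + (h * h + h * h)) = e"
  by (metis add.assoc distrib_left half half_double' scalars_mem(3))

lemma scalar_rules: "e * e = e" "e * z = z" "z * e = z" "e * h = h" "h * e = h" "h * z = z * h"
  using unit(1)[OF scalars_mem(1)] unit(1)[OF scalars_mem(2)] unit(2)[OF scalars_mem(2)]
    unit(1)[OF scalars_mem(3)] unit(2)[OF scalars_mem(3)] central(1)[OF scalars_mem(3)] .

lemmas scalar_simps = scalar_rules scalar_rules[THEN mult_extend]

end

locale clifford_system = corner M e z h for M :: "'w::ring set" and e z h +
  fixes n :: nat and c :: "nat \<Rightarrow> 'w"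
  assumes c_mem: "i \<in> {1..n} \<Longrightarrow> c i \<in> M"
    and c_sq: "i \<in> {1..n} \<Longrightarrow> c i * c i = e"
    and c_anti: "\<lbrakk>i \<in> {1..n}; j \<in> {1..n}; i \<noteq> j\<rbrakk> \<Longrightarrow> c i * c j = - (c j * c i)"
begin

text \<open>
  The Clifford relation would loop as a rewrite rule; the condition \<open>i < j\<close> directs it.
\<close>

lemma c_order: "\<lbrakk>i \<in> {1..n}; j \<in> {1..n}; i < j\<rbrakk> \<Longrightarrow> c j * c i = - (c i * c j)"
  using c_anti[of j i] by simp

lemmas c_rules = c_sq c_order unit[OF c_mem] central[OF c_mem]

lemmas c_simps = c_rules c_rules[THEN mult_extend]

end

section \<open>Spin relations in a Hecke-Clifford system\<close>

text \<open>
  The relations of the affine Hecke-Clifford algebra in a corner.  The relation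
  \<open>(T\<^sub>i - q) (T\<^sub>i + q\<^sup>-\<^sup>1) = 0\<close> enters in the form \<open>T\<^sub>i\<^sup>2 = \<epsilon> T\<^sub>i + 1\<close>, in which only \<open>\<epsilon>\<close> occurs.
\<close>

locale hc_system = clifford_system M e z h n c
  for M :: "'w::ring set" and e z h and n :: nat and c :: "nat \<Rightarrow> 'w" +
  fixes T X Xi :: "nat \<Rightarrow> 'w"
  assumes T_mem: "i \<in> {1..<n} \<Longrightarrow> T i \<in> M"
    and X_mem: "i \<in> {1..n} \<Longrightarrow> X i \<in> M" and Xi_mem: "i \<in> {1..n} \<Longrightarrow> Xi i \<in> M"
    and T_sq: "i \<in> {1..<n} \<Longrightarrow> T i * T i = z * T i + e"
    and T_braid: "\<lbrakk>i \<in> {1..<n}; Suc i \<in> {1..<n}\<rbrakk> \<Longrightarrow>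
      T i * (T (Suc i) * T i) = T (Suc i) * (T i * T (Suc i))"
    and T_far: "\<lbrakk>i \<in> {1..<n}; j \<in> {1..<n}; Suc i < j\<rbrakk> \<Longrightarrow> T j * T i = T i * T j"
    and T_c: "i \<in> {1..<n} \<Longrightarrow> T i * c i = c (Suc i) * T i"
    and T_c_far: "\<lbrakk>i \<in> {1..<n}; j \<in> {1..n}; j \<noteq> i; j \<noteq> Suc i\<rbrakk> \<Longrightarrow> T i * c j = c j * T i"
    and X_Xi: "i \<in> {1..n} \<Longrightarrow> X i * Xi i = e" and Xi_X: "i \<in> {1..n} \<Longrightarrow> Xi i * X i = e"
    and T_X_T: "i \<in> {1..<n} \<Longrightarrow> (T i + z * c i * c (Suc i)) * X i * T i = X (Suc i)"
    and T_X_far: "\<lbrakk>i \<in> {1..<n}; j \<in> {1..n}; j \<noteq> i; j \<noteq> Suc i\<rbrakk> \<Longrightarrow> T i * X j = X j * T i"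
    and X_comm: "\<lbrakk>i \<in> {1..n}; j \<in> {1..n}\<rbrakk> \<Longrightarrow> X i * X j = X j * X i"
    and X_c: "i \<in> {1..n} \<Longrightarrow> X i * c i = c i * Xi i"
    and X_c_far: "\<lbrakk>i \<in> {1..n}; j \<in> {1..n}; i \<noteq> j\<rbrakk> \<Longrightarrow> X i * c j = c j * X i"
begin

lemmas mem = scalars_mem c_mem T_mem X_mem Xi_mem

lemmas unit_rules = unit[OF c_mem] unit[OF T_mem] unit[OF X_mem] unit[OF Xi_mem]
  central[OF c_mem] central[OF T_mem] central[OF X_mem] central[OF Xi_mem]

lemmas unit_simps = unit_rules unit_rules[THEN mult_extend] scalar_simps

text \<open>
  By the quadratic relation \<open>T\<^sub>i\<close> has the inverse \<open>T\<^sub>i - \<epsilon>\<close>.  Multiplying \<open>T\<^sub>i c\<^sub>i = c\<^sub>i\<^sub>+\<^sub>1 T\<^sub>i\<close> by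
  \<open>T\<^sub>i\<close> on the left and by this inverse on the right moves \<open>T\<^sub>i\<close> past \<open>c\<^sub>i\<^sub>+\<^sub>1\<close>.
\<close>

lemma T_c_Suc:
  assumes "i \<in> {1..<n}"
  shows "T i * c (Suc i) = c i * T i + z * c (Suc i) - z * c i"
proof -
  have i: "i \<in> {1..n}" "Suc i \<in> {1..n}" using assms by auto
  have inv: "T i * (T i - z) = e"
    using assms by (simp add: algebra_simps T_sq unit_simps)
  have "T i * c (Suc i) * T i = z * (c (Suc i) * T i) + c i"
  proof -
    have "T i * c (Suc i) * T i = T i * T i * c i"
      using assms by (simp add: T_c mult.assoc)
    also have "\<dots> = z * (c (Suc i) * T i) + c i"
      using assms i by (simp add: T_sq T_c distrib_right mult.assoc unit_simps)
    finally show ?thesis .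
  qed
  then have "T i * c (Suc i) * (T i * (T i - z)) = (z * (c (Suc i) * T i) + c i) * (T i - z)"
    by (simp only: mult.assoc[symmetric])
  also have "\<dots> = z * (c (Suc i) * (T i * (T i - z))) + c i * T i - z * c i"
    using i by (simp add: algebra_simps unit_simps)
  finally show ?thesis
    using i assms by (simp add: unit_simps T_sq T_sq[THEN mult_extend] algebra_simps)
qed

lemma inverse_commute:
  assumes "x * x' = e" "x' * x = e" "y * x = x * y'" "x \<in> M" "x' \<in> M" "y \<in> M" "y' \<in> M"
  shows "y' * x' = x' * y"
proof -
  have "x' * (y * x) * x' = x' * (x * y') * x'" using assms(3) by simp
  then show ?thesis using assms unit by (metis mult.assoc)
qed

lemma Xi_c: "i \<in> {1..n} \<Longrightarrow> Xi i * c i = c i * X i"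
proof -
  assume i: "i \<in> {1..n}"
  have "c i * (X i * c i) * c i = c i * (c i * Xi i) * c i" using i by (simp add: X_c)
  then have "c i * (X i * (c i * c i)) = (c i * c i) * Xi i * c i" by (simp add: mult.assoc)
  then show "Xi i * c i = c i * X i" using i by (simp add: c_sq unit_simps)
qed

lemma Xi_c_far: "\<lbrakk>i \<in> {1..n}; j \<in> {1..n}; i \<noteq> j\<rbrakk> \<Longrightarrow> Xi i * c j = c j * Xi i"
  using inverse_commute[of "X i" "Xi i" "c j" "c j"] X_Xi Xi_X X_c_far mem by simp

lemma T_Xi_far: "\<lbrakk>i \<in> {1..<n}; j \<in> {1..n}; j \<noteq> i; j \<noteq> Suc i\<rbrakk> \<Longrightarrow> T i * Xi j = Xi j * T i"
  using inverse_commute[of "X j" "Xi j" "T i" "T i"] X_Xi Xi_X T_X_far mem by simp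

lemma X_Xi_comm: "\<lbrakk>i \<in> {1..n}; j \<in> {1..n}\<rbrakk> \<Longrightarrow> X i * Xi j = Xi j * X i"
  using inverse_commute[of "X j" "Xi j" "X i" "X i"] X_Xi Xi_X X_comm mem by simp

lemma Xi_Xi_comm: "\<lbrakk>i \<in> {1..n}; j \<in> {1..n}\<rbrakk> \<Longrightarrow> Xi i * Xi j = Xi j * Xi i"
  using inverse_commute[of "X j" "Xi j" "Xi i" "Xi i"] X_Xi Xi_X X_Xi_comm[of j i] mem by simp

text \<open>
  Cancel the right factor \<open>T\<^sub>i\<close> in the relation that expresses \<open>X\<^sub>i\<^sub>+\<^sub>1\<close> through \<open>X\<^sub>i\<close>.
\<close>

lemma T_X:
  assumes "i \<in> {1..<n}"
  shows "T i * X i = X (Suc i) * T i - z * X (Suc i) - z * (c i * (c (Suc i) * X i))"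
proof -
  have i: "i \<in> {1..n}" "Suc i \<in> {1..n}" using assms by auto
  have inv: "T i * (T i - z) = e"
    using assms by (simp add: algebra_simps T_sq unit_simps)
  have "X (Suc i) * (T i - z) = (T i + z * c i * c (Suc i)) * X i * (T i * (T i - z))"
    using T_X_T[OF assms] by (simp only: mult.assoc[symmetric])
  also have "\<dots> = T i * X i + z * (c i * (c (Suc i) * X i))"
    using i assms by (simp add: T_sq T_sq[THEN mult_extend] algebra_simps unit_simps)
  finally show ?thesis using i by (simp add: algebra_simps unit_simps)
qed

lemmas hc_basic_rules = T_sq T_far T_c T_c_far T_c_Suc X_c X_c_far Xi_c Xi_c_far T_X T_X_far T_Xi_far X_Xi Xi_X

text \<open>
  Conjugation by \<open>c\<^sub>i\<close> exchanges \<open>X\<^sub>i\<close> with its inverse, so this follows from \<open>T_X\<close>.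
\<close>

lemma T_Xi:
  assumes "i \<in> {1..<n}"
  shows "T i * Xi i = Xi (Suc i) * T i + z * (c i * (c (Suc i) * X (Suc i))) + z * Xi i"
proof -
  have i: "i \<in> {1..n}" "Suc i \<in> {1..n}" using assms by auto
  have "T i * (Xi i * (c i * c i)) = T i * c i * X i * c i"
    using i assms by (simp add: mult.assoc Xi_c Xi_c[THEN mult_extend])
  then have "T i * Xi i = c (Suc i) * (T i * X i) * c i"
    using i assms by (simp add: mult.assoc c_sq unit_simps T_c T_c[THEN mult_extend])
  also have "\<dots> = Xi (Suc i) * T i + z * (c i * (c (Suc i) * X (Suc i))) + z * Xi i"
    using i assms
    by (simp add: T_X algebra_simps c_simps unit_simps hc_basic_rules hc_basic_rules[THEN mult_extend])
  finally show ?thesis .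
qed

lemma Xi_X_comm: "\<lbrakk>i \<in> {1..n}; j \<in> {1..n}\<rbrakk> \<Longrightarrow> Xi j * X i = X i * Xi j"
  by (simp add: X_Xi_comm)

lemma X_left_comm:
  assumes "i \<in> {1..n}" "j \<in> {1..n}"
  shows "X i * (X j * x) = X j * (X i * x)" "Xi i * (Xi j * x) = Xi j * (Xi i * x)"
  using X_comm[OF assms] Xi_Xi_comm[OF assms] by (metis mult.assoc)+

lemmas hc_rules = hc_basic_rules T_Xi Xi_X_comm

text \<open>
  These rules move the \<open>c\<^sub>j\<close> to the left and the \<open>T\<^sub>i\<close> to the right of the \<open>X\<^sub>j\<close> and then
  normalise the words within each group.  The relations between \<open>R\<^sub>i\<close>, \<open>p\<^sub>i\<close> and \<open>q\<^sub>i\<close> below hold because both sides have the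
  same normal form.
\<close>

lemmas hc_simps = hc_rules hc_rules[THEN mult_extend] T_braid T_braid[THEN mult_extend3]
  X_comm Xi_Xi_comm X_left_comm unit_simps c_simps

definition R :: "nat \<Rightarrow> 'w" where "R i = (c i - c (Suc i)) * T i + z * c (Suc i)"
definition p :: "nat \<Rightarrow> 'w" where "p i = h * (X i + Xi i)"
definition q :: "nat \<Rightarrow> 'w" where "q i = h * ((X i - Xi i) * c i)"

lemma R_sq: "i \<in> {1..<n} \<Longrightarrow> R i * R i = - (z * z) - e - e"
  by (simp add: R_def algebra_simps hc_simps)

lemma R_braid:
  assumes "i \<in> {1..<n}" "Suc i \<in> {1..<n}"
  shows "R i * R (Suc i) * R i - R (Suc i) * R i * R (Suc i) = z * z * (R (Suc i) - R i)"
  using assms by (simp add: R_def algebra_simps hc_simps)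

lemma R_far: "\<lbrakk>i \<in> {1..<n}; j \<in> {1..<n}; Suc i < j\<rbrakk> \<Longrightarrow> R j * R i = - (R i * R j)"
  by (simp add: R_def algebra_simps hc_simps)

lemma R_far_sym:
  assumes "i \<in> {1..<n}" "j \<in> {1..<n}" "\<bar>int i - int j\<bar> > 1"
  shows "R i * R j = - (R j * R i)"
proof (cases "Suc i < j")
  case False
  then have "Suc j < i" using assms(3) by linarith
  then show ?thesis using R_far[OF assms(2,1)] by simp
qed (use R_far[OF assms(1,2)] in simp)

lemma R_c: "\<lbrakk>i \<in> {1..<n}; j \<in> {1..n}\<rbrakk> \<Longrightarrow> R i * c j = - (c j * R i)"
  by (cases "j < i"; cases "j = i"; cases "j = Suc i") (simp_all add: R_def algebra_simps hc_simps)

lemma R_p_far: "\<lbrakk>i \<in> {1..<n}; j \<in> {1..n}; j \<noteq> i; j \<noteq> Suc i\<rbrakk> \<Longrightarrow> R i * p j = p j * R i"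
  by (simp add: R_def p_def algebra_simps hc_simps)

lemma R_q_far: "\<lbrakk>i \<in> {1..<n}; j \<in> {1..n}; j \<noteq> i; j \<noteq> Suc i\<rbrakk> \<Longrightarrow> R i * q j = - (q j * R i)"
  by (cases "j < i") (simp_all add: R_def q_def algebra_simps hc_simps)

lemma R_p: "i \<in> {1..<n} \<Longrightarrow> R i * p i = p (Suc i) * R i + z * (q i - q (Suc i))"
  by (simp add: R_def p_def q_def algebra_simps hc_simps)

lemma R_q: "i \<in> {1..<n} \<Longrightarrow> R i * q i = - (q (Suc i) * R i) - z * (p i + p (Suc i))"
  by (simp add: R_def p_def q_def algebra_simps hc_simps)

lemma p_p: "\<lbrakk>i \<in> {1..n}; j \<in> {1..n}\<rbrakk> \<Longrightarrow> p i * p j = p j * p i"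
  by (cases i j rule: linorder_cases) (simp_all add: p_def algebra_simps hc_simps)

lemma q_q: "\<lbrakk>i \<in> {1..n}; j \<in> {1..n}; i \<noteq> j\<rbrakk> \<Longrightarrow> q i * q j = - (q j * q i)"
  by (cases i j rule: linorder_cases) (simp_all add: q_def algebra_simps hc_simps)

lemma p_q: "\<lbrakk>i \<in> {1..n}; j \<in> {1..n}\<rbrakk> \<Longrightarrow> p i * q j = q j * p i"
  by (cases i j rule: linorder_cases) (simp_all add: q_def p_def algebra_simps hc_simps)

lemma p_sq_q_sq: "i \<in> {1..n} \<Longrightarrow> p i * p i + q i * q i = e"
  by (simp add: q_def p_def algebra_simps hc_simps quarters)

lemma p_c: "\<lbrakk>i \<in> {1..n}; j \<in> {1..n}\<rbrakk> \<Longrightarrow> p i * c j = c j * p i"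
  by (cases "i = j") (simp_all add: p_def algebra_simps hc_simps)

lemma q_c: "\<lbrakk>i \<in> {1..n}; j \<in> {1..n}\<rbrakk> \<Longrightarrow> q i * c j = - (c j * q i)"
  by (cases "i = j"; cases "i < j") (simp_all add: q_def algebra_simps hc_simps)

text \<open>
  With \<open>X_recover\<close>, this says that the formulas for \<open>\<Phi>\<close> invert those for \<open>\<Psi>\<close>.
\<close>

lemma T_recover: "i \<in> {1..<n} \<Longrightarrow> - h * (R i * (c i - c (Suc i))) + h * (z * (e - c i * c (Suc i))) = T i"
  by (simp add: R_def algebra_simps hc_simps half_double' mem)

lemma X_recover: "i \<in> {1..n} \<Longrightarrow> p i - c i * q i = X i" "i \<in> {1..n} \<Longrightarrow> p i + c i * q i = Xi i"
  by (simp_all add: p_def q_def algebra_simps hc_simps half_double' mem)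

end


section \<open>Hecke-Clifford relations in a Clifford-spin system\<close>

text \<open>
  The last three assumptions are the supercommutation of the \<open>R\<^sub>i\<close>, \<open>p\<^sub>i\<close> and \<open>q\<^sub>i\<close> with the
  \<open>c\<^sub>j\<close>; the others are the relations of the spin affine Hecke algebra.
\<close>

locale clifford_spin_system = clifford_system M e z h n c
  for M :: "'w::ring set" and e z h and n :: nat and c :: "nat \<Rightarrow> 'w" +
  fixes R p q :: "nat \<Rightarrow> 'w"
  assumes R_mem: "i \<in> {1..<n} \<Longrightarrow> R i \<in> M"
    and p_mem: "i \<in> {1..n} \<Longrightarrow> p i \<in> M" and q_mem: "i \<in> {1..n} \<Longrightarrow> q i \<in> M"
    and R_sq: "i \<in> {1..<n} \<Longrightarrow> R i * R i = - (z * z) - e - e"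
    and R_braid: "\<lbrakk>i \<in> {1..<n}; Suc i \<in> {1..<n}\<rbrakk> \<Longrightarrow>
      R i * R (Suc i) * R i - R (Suc i) * R i * R (Suc i) = z * z * (R (Suc i) - R i)"
    and R_far: "\<lbrakk>i \<in> {1..<n}; j \<in> {1..<n}; Suc i < j\<rbrakk> \<Longrightarrow> R j * R i = - (R i * R j)"
    and p_p: "\<lbrakk>i \<in> {1..n}; j \<in> {1..n}\<rbrakk> \<Longrightarrow> p i * p j = p j * p i"
    and q_q: "\<lbrakk>i \<in> {1..n}; j \<in> {1..n}; i \<noteq> j\<rbrakk> \<Longrightarrow> q i * q j = - (q j * q i)"
    and p_sq_q_sq: "i \<in> {1..n} \<Longrightarrow> p i * p i + q i * q i = e"
    and p_q: "\<lbrakk>i \<in> {1..n}; j \<in> {1..n}\<rbrakk> \<Longrightarrow> p i * q j = q j * p i"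
    and R_p_far: "\<lbrakk>i \<in> {1..<n}; j \<in> {1..n}; j \<noteq> i; j \<noteq> Suc i\<rbrakk> \<Longrightarrow> R i * p j = p j * R i"
    and R_q_far: "\<lbrakk>i \<in> {1..<n}; j \<in> {1..n}; j \<noteq> i; j \<noteq> Suc i\<rbrakk> \<Longrightarrow> R i * q j = - (q j * R i)"
    and R_p: "i \<in> {1..<n} \<Longrightarrow> R i * p i = p (Suc i) * R i + z * (q i - q (Suc i))"
    and R_q: "i \<in> {1..<n} \<Longrightarrow> R i * q i = - (q (Suc i) * R i) - z * (p i + p (Suc i))"
    and R_c: "\<lbrakk>i \<in> {1..<n}; j \<in> {1..n}\<rbrakk> \<Longrightarrow> R i * c j = - (c j * R i)"
    and p_c: "\<lbrakk>i \<in> {1..n}; j \<in> {1..n}\<rbrakk> \<Longrightarrow> p i * c j = c j * p i"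
    and q_c: "\<lbrakk>i \<in> {1..n}; j \<in> {1..n}\<rbrakk> \<Longrightarrow> q i * c j = - (c j * q i)"
begin

lemmas mem = scalars_mem c_mem R_mem p_mem q_mem

lemmas unit_rules = unit[OF R_mem] unit[OF p_mem] unit[OF q_mem]
  central[OF R_mem] central[OF p_mem] central[OF q_mem]

lemmas unit_simps = unit_rules unit_rules[THEN mult_extend] scalar_simps

lemma R_braid': "\<lbrakk>i \<in> {1..<n}; Suc i \<in> {1..<n}\<rbrakk> \<Longrightarrow>
    R i * (R (Suc i) * R i) = R (Suc i) * (R i * R (Suc i)) + z * z * R (Suc i) - z * z * R i"
  using R_braid[of i] by (simp add: algebra_simps)

lemma pq_order:
  assumes "i \<in> {1..n}" "j \<in> {1..n}"
  shows "p i * (p j * x) = p j * (p i * x)" "i < j \<Longrightarrow> q j * q i = - (q i * q j)" "q j * p i = p i * q j"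
  using assms p_p[OF assms] q_q[of j i] p_q[of i j] by (metis mult.assoc, simp_all)

lemma q_sq: "i \<in> {1..n} \<Longrightarrow> q i * q i = e - p i * p i"
  using p_sq_q_sq[of i] by (simp add: algebra_simps)

lemmas spin_rules = R_sq R_far pq_order(2,3) q_sq R_p_far R_q_far R_p R_q R_c p_c q_c

text \<open>
  The \<open>c\<^sub>j\<close> move to the left and the \<open>R\<^sub>i\<close> to the right of the \<open>p\<^sub>j\<close> and \<open>q\<^sub>j\<close>, and \<open>p\<^sub>j\<close> goes before
  \<open>q\<^sub>k\<close>.
\<close>

lemmas spin_simps = spin_rules spin_rules[THEN mult_extend] R_braid' R_braid'[THEN mult_extend3]
  p_p pq_order(1) unit_simps c_simps

text \<open>
  Twice the image of \<open>T\<^sub>i\<close>.  It does not involve the factor \<open>1/2\<close>, which stays out of the larger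
  computations in this way.
\<close>

definition S :: "nat \<Rightarrow> 'w" where
  "S i = - (R i * (c i - c (Suc i))) + z * (e - c i * c (Suc i))"
definition T :: "nat \<Rightarrow> 'w" where "T i = h * S i"
definition X :: "nat \<Rightarrow> 'w" where "X i = p i - c i * q i"
definition Xi :: "nat \<Rightarrow> 'w" where "Xi i = p i + c i * q i"

lemma S_mem: "i \<in> {1..<n} \<Longrightarrow> S i \<in> M"
  by (simp add: S_def mem closed)

lemma h_central: "i \<in> {1..<n} \<Longrightarrow> S i * h = h * S i" "i \<in> {1..<n} \<Longrightarrow> S i * (h * x) = h * (S i * x)"
  using central(2)[OF S_mem] by (auto simp flip: mult.assoc)

lemma h_cancel: "x \<in> M \<Longrightarrow> h * (h * (x + x + x + x)) = x"
  using half_double[of x] half_double[of "x + x"] closed by (simp add: add.assoc)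

lemma S_sq: "i \<in> {1..<n} \<Longrightarrow> S i * S i = z * S i + z * S i + e + e + e + e"
  by (simp add: S_def algebra_simps spin_simps)

lemma T_sq:
  assumes i: "i \<in> {1..<n}" shows "T i * T i = z * T i + e"
proof -
  let ?y = "z * T i + e"
  have 1: "T i + T i = S i" using half_double'[OF S_mem[OF i]] by (simp add: T_def)
  have "S i * S i = z * (T i + T i) + z * (T i + T i) + e + e + e + e"
    unfolding 1 by (rule S_sq[OF i])
  also have "\<dots> = ?y + ?y + ?y + ?y + 0" by (simp add: distrib_left)
  finally have "h * (h * (S i * S i)) = ?y"
    using h_cancel[of ?y] i by (simp add: T_def closed mem S_mem)
  then show ?thesis using i by (simp add: T_def mult.assoc h_central)
qed

lemma S_braid: "\<lbrakk>i \<in> {1..<n}; Suc i \<in> {1..<n}\<rbrakk> \<Longrightarrow>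
    S i * (S (Suc i) * S i) = S (Suc i) * (S i * S (Suc i))"
  by (simp add: S_def algebra_simps spin_simps)

lemma T_braid: "\<lbrakk>i \<in> {1..<n}; Suc i \<in> {1..<n}\<rbrakk> \<Longrightarrow>
    T i * (T (Suc i) * T i) = T (Suc i) * (T i * T (Suc i))"
  using S_braid by (simp add: T_def mult.assoc h_central)

lemma T_far: "\<lbrakk>i \<in> {1..<n}; j \<in> {1..<n}; Suc i < j\<rbrakk> \<Longrightarrow> T j * T i = T i * T j"
  by (simp add: T_def S_def algebra_simps spin_simps)

lemma T_far_sym:
  assumes "i \<in> {1..<n}" "j \<in> {1..<n}" "\<bar>int i - int j\<bar> > 1"
  shows "T i * T j = T j * T i"
proof (cases "Suc i < j")
  case False
  then have "Suc j < i" using assms(3) by linarith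
  then show ?thesis using T_far[OF assms(2,1)] by simp
qed (use T_far[OF assms(1,2)] in simp)

lemma T_c: "i \<in> {1..<n} \<Longrightarrow> T i * c i = c (Suc i) * T i"
  by (simp add: T_def S_def algebra_simps spin_simps)

lemma T_c_far: "\<lbrakk>i \<in> {1..<n}; j \<in> {1..n}; j \<noteq> i; j \<noteq> Suc i\<rbrakk> \<Longrightarrow> T i * c j = c j * T i"
  by (cases "j < i") (simp_all add: T_def S_def algebra_simps spin_simps)

lemma X_Xi: "i \<in> {1..n} \<Longrightarrow> X i * Xi i = e" "i \<in> {1..n} \<Longrightarrow> Xi i * X i = e"
  by (simp_all add: X_def Xi_def algebra_simps spin_simps)

lemma S_X_S: "i \<in> {1..<n} \<Longrightarrow> (S i + (z * c i * c (Suc i) + z * c i * c (Suc i))) * X i * S i =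
    X (Suc i) + X (Suc i) + X (Suc i) + X (Suc i)"
  by (simp add: S_def X_def algebra_simps spin_simps)

lemma T_X_T:
  assumes i: "i \<in> {1..<n}"
  shows "(T i + z * c i * c (Suc i)) * X i * T i = X (Suc i)"
proof -
  have j: "i \<in> {1..n}" "Suc i \<in> {1..n}" using i by auto
  have X: "X i \<in> M" "X (Suc i) \<in> M" using j by (simp_all add: X_def mem closed)
  have "z * c i * c (Suc i) = h * (z * c i * c (Suc i) + z * c i * c (Suc i))"
    using half_double[of "z * c i * c (Suc i)"] j by (simp add: mem closed)
  then have "T i + z * c i * c (Suc i) = h * (S i + (z * c i * c (Suc i) + z * c i * c (Suc i)))"
    by (simp only: T_def distrib_left)
  moreover have "y * X i * T i = h * (y * X i * S i)" if "y \<in> M" for y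
  proof -
    have "y * X i \<in> M" using that X closed by blast
    then have "(y * X i) * h = h * (y * X i)" by (rule central(2))
    then show ?thesis unfolding T_def by (metis mult.assoc)
  qed
  ultimately have "(T i + z * c i * c (Suc i)) * X i * T i =
      h * (h * ((S i + (z * c i * c (Suc i) + z * c i * c (Suc i))) * X i * S i))"
    using i j by (simp add: mem closed S_mem mult.assoc)
  also have "\<dots> = X (Suc i)"
    unfolding S_X_S[OF i] by (rule h_cancel[OF X(2)])
  finally show ?thesis .
qed

lemma T_X_far: "\<lbrakk>i \<in> {1..<n}; j \<in> {1..n}; j \<noteq> i; j \<noteq> Suc i\<rbrakk> \<Longrightarrow> T i * X j = X j * T i"
  by (cases "j < i") (simp_all add: T_def S_def X_def algebra_simps spin_simps)

lemma X_comm: "\<lbrakk>i \<in> {1..n}; j \<in> {1..n}\<rbrakk> \<Longrightarrow> X i * X j = X j * X i"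
  by (cases i j rule: linorder_cases) (simp_all add: X_def algebra_simps spin_simps)

lemma X_c: "i \<in> {1..n} \<Longrightarrow> X i * c i = c i * Xi i"
  by (simp add: X_def Xi_def algebra_simps spin_simps)

lemma X_c_far: "\<lbrakk>i \<in> {1..n}; j \<in> {1..n}; i \<noteq> j\<rbrakk> \<Longrightarrow> X i * c j = c j * X i"
  by (cases "i < j") (simp_all add: X_def algebra_simps spin_simps)

lemma R_recover: "i \<in> {1..<n} \<Longrightarrow> (c i - c (Suc i)) * T i + z * c (Suc i) = R i"
  by (simp add: T_def S_def algebra_simps spin_simps half_double' half_double'' mem)

lemma p_recover: "i \<in> {1..n} \<Longrightarrow> h * (X i + Xi i) = p i"
  by (simp add: X_def Xi_def algebra_simps spin_simps half_double' mem)

lemma q_recover: "i \<in> {1..n} \<Longrightarrow> h * ((X i - Xi i) * c i) = q i"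
  by (simp add: X_def Xi_def algebra_simps spin_simps half_double' mem)

end

section \<open>The product of all rings on a type\<close>

text \<open>
  The product of all rings with elements in a given type.  As the index set consists of all ring
  structures on that type, the product can be formed as a type without reference to any of them.
\<close>

typedef 'a ring_product =
  "{f :: 'a ring \<Rightarrow> 'a. \<forall>R. if ring R then f R \<in> carrier R else f R = undefined}"
proof
  show "(\<lambda>R. if ring R then \<zero>\<^bsub>R\<^esub> else undefined) \<in>
      {f :: 'a ring \<Rightarrow> 'a. \<forall>R. if ring R then f R \<in> carrier R else f R = undefined}"
    by (auto intro: ring.ring_simprules)
qed

setup_lifting type_definition_ring_product

instantiation ring_product :: (type) ring
begin

lift_definition zero_ring_product :: "'a ring_product"
  is "\<lambda>R. if ring R then \<zero>\<^bsub>R\<^esub> else undefined"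
  by (auto intro: ring.ring_simprules)

lift_definition plus_ring_product :: "'a ring_product \<Rightarrow> 'a ring_product \<Rightarrow> 'a ring_product"
  is "\<lambda>f g R. if ring R then f R \<oplus>\<^bsub>R\<^esub> g R else undefined"
  by (auto intro: ring.ring_simprules)

lift_definition minus_ring_product :: "'a ring_product \<Rightarrow> 'a ring_product \<Rightarrow> 'a ring_product"
  is "\<lambda>f g R. if ring R then f R \<ominus>\<^bsub>R\<^esub> g R else undefined"
  by (auto intro: ring.ring_simprules)

lift_definition uminus_ring_product :: "'a ring_product \<Rightarrow> 'a ring_product"
  is "\<lambda>f R. if ring R then \<ominus>\<^bsub>R\<^esub> f R else undefined"
  by (auto intro: ring.ring_simprules)

lift_definition times_ring_product :: "'a ring_product \<Rightarrow> 'a ring_product \<Rightarrow> 'a ring_product"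
  is "\<lambda>f g R. if ring R then f R \<otimes>\<^bsub>R\<^esub> g R else undefined"
  by (auto intro: ring.ring_simprules)

instance
proof
  fix a b c :: "'a ring_product"
  show "a + b + c = a + (b + c)" by transfer (auto simp: fun_eq_iff ring.ring_simprules)
  show "a + b = b + a" by transfer (auto simp: fun_eq_iff intro: ring.ring_simprules)
  show "0 + a = a" by transfer (auto simp: fun_eq_iff ring.ring_simprules)
  show "- a + a = 0" by transfer (auto simp: fun_eq_iff ring.ring_simprules)
  show "a - b = a + - b" by transfer (auto simp: fun_eq_iff ring.ring_simprules)
  show "a * b * c = a * (b * c)" by transfer (auto simp: fun_eq_iff ring.ring_simprules)
  show "(a + b) * c = a * c + b * c" by transfer (auto simp: fun_eq_iff ring.ring_simprules)
  show "a * (b + c) = a * b + a * c" by transfer (auto simp: fun_eq_iff ring.ring_simprules)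
qed

end

definition plain_ring :: "('a, 'm) ring_scheme \<Rightarrow> 'a ring" where
  "plain_ring R = \<lparr>carrier = carrier R, mult = monoid.mult R, one = one R, zero = zero R, add = add R\<rparr>"

lemma plain_ring_simps [simp]:
  "carrier (plain_ring R) = carrier R" "monoid.mult (plain_ring R) = monoid.mult R"
  "one (plain_ring R) = one R" "zero (plain_ring R) = zero R" "add (plain_ring R) = add R"
  by (simp_all add: plain_ring_def)

text \<open>
  The inclusion of one factor, extended by zero in the other factors.
\<close>

definition factor_embed :: "('a, 'm) ring_scheme \<Rightarrow> 'a \<Rightarrow> 'a ring_product" where
  "factor_embed R x = Abs_ring_product
    (\<lambda>S. if S = plain_ring R then x else if ring S then \<zero>\<^bsub>S\<^esub> else undefined)"

context ring
begin

lemma plain_ring: "ring (plain_ring R)"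
proof (rule ringI)
  show "abelian_group (plain_ring R)"
    by (rule abelian_groupI) (auto simp: a_ac intro!: bexI[of _ "\<ominus> x" for x] l_neg)
  show "Group.monoid (plain_ring R)"
    by (rule monoidI) (auto simp: m_assoc)
qed (auto simp: l_distr r_distr)

lemma Rep_embed:
  assumes "x \<in> carrier R"
  shows "Rep_ring_product (factor_embed R x) =
    (\<lambda>S. if S = plain_ring R then x else if ring S then \<zero>\<^bsub>S\<^esub> else undefined)"
  unfolding factor_embed_def
  by (rule Abs_ring_product_inverse) (use assms plain_ring in \<open>auto intro: ring.ring_simprules\<close>)

lemma embed_eq_iff:
  assumes "x \<in> carrier R" "y \<in> carrier R"
  shows "factor_embed R x = factor_embed R y \<longleftrightarrow> x = y"
  using Rep_embed[OF assms(1)] Rep_embed[OF assms(2)] by (metis (full_types))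

lemma embed_zero: "factor_embed R \<zero> = 0"
  by (rule Rep_ring_product_inject[THEN iffD1])
    (auto simp: Rep_embed zero_ring_product.rep_eq fun_eq_iff plain_ring)

lemma embed_add: "\<lbrakk>x \<in> carrier R; y \<in> carrier R\<rbrakk> \<Longrightarrow> factor_embed R (x \<oplus> y) = factor_embed R x + factor_embed R y"
  by (rule Rep_ring_product_inject[THEN iffD1])
    (auto simp: Rep_embed plus_ring_product.rep_eq fun_eq_iff plain_ring ring.ring_simprules)

lemma embed_mult: "\<lbrakk>x \<in> carrier R; y \<in> carrier R\<rbrakk> \<Longrightarrow> factor_embed R (x \<otimes> y) = factor_embed R x * factor_embed R y"
  by (rule Rep_ring_product_inject[THEN iffD1])
    (auto simp: Rep_embed times_ring_product.rep_eq fun_eq_iff plain_ring ring.ring_simprules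
      semiring.semiring_simprules)

lemma embed_uminus: "x \<in> carrier R \<Longrightarrow> factor_embed R (\<ominus> x) = - factor_embed R x"
  using embed_add[of "\<ominus> x" x] by (simp add: l_neg embed_zero eq_neg_iff_add_eq_0)

lemma embed_diff: "\<lbrakk>x \<in> carrier R; y \<in> carrier R\<rbrakk> \<Longrightarrow> factor_embed R (x \<ominus> y) = factor_embed R x - factor_embed R y"
  by (simp add: minus_eq embed_add embed_uminus)

end

text \<open>
  The unit of a factor is in general only an idempotent of the product.
\<close>

lemma (in superalgebra) corner_embed:
  assumes "(2 :: 'k) \<noteq> 0"
  shows "corner (factor_embed A ` carrier A) (factor_embed A \<one>) (factor_embed A (k \<odot> \<one>)) (factor_embed A ((1/2) \<odot> \<one>))"
proof
  have c: "(x \<otimes> (k \<odot> \<one>)) = (k \<odot> \<one>) \<otimes> x" if "x \<in> carrier A" for k x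
    using that by (simp add: smult_mult_left smult_mult_right)
  fix x assume "x \<in> factor_embed A ` carrier A"
  then show "x * factor_embed A (k \<odot> \<one>) = factor_embed A (k \<odot> \<one>) * x"
     "x * factor_embed A ((1/2) \<odot> \<one>) = factor_embed A ((1/2) \<odot> \<one>) * x"
    by (auto simp: c simp flip: embed_mult)
next
  have "(1/2) \<odot> \<one> \<oplus> (1/2) \<odot> \<one> = (1 :: 'k) \<odot> \<one>"
    unfolding smult_add_left[OF one_closed, symmetric] using assms by (simp add: field_simps)
  then show "factor_embed A ((1/2) \<odot> \<one>) + factor_embed A ((1/2) \<odot> \<one>) = factor_embed A \<one>"
    by (simp flip: embed_add)
qed (auto simp flip: embed_mult embed_add embed_diff embed_uminus)


context superalgebra
begin

lemma embed_smult: "x \<in> carrier A \<Longrightarrow> factor_embed A (k \<odot> x) = factor_embed A (k \<odot> \<one>) * factor_embed A x"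
  by (simp add: smult_mult_left flip: embed_mult)

lemma scalar_embed:
  "factor_embed A ((k + l) \<odot> \<one>) = factor_embed A (k \<odot> \<one>) + factor_embed A (l \<odot> \<one>)"
  "factor_embed A ((k * l) \<odot> \<one>) = factor_embed A (k \<odot> \<one>) * factor_embed A (l \<odot> \<one>)"
  "factor_embed A ((- k) \<odot> \<one>) = - factor_embed A (k \<odot> \<one>)"
  "factor_embed A ((k - l) \<odot> \<one>) = factor_embed A (k \<odot> \<one>) - factor_embed A (l \<odot> \<one>)"
proof -
  show add: "factor_embed A ((k + l) \<odot> \<one>) = factor_embed A (k \<odot> \<one>) + factor_embed A (l \<odot> \<one>)" for k l
    by (simp add: smult_add_left embed_add)
  show "factor_embed A ((k * l) \<odot> \<one>) = factor_embed A (k \<odot> \<one>) * factor_embed A (l \<odot> \<one>)"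
    by (simp add: smult_mult_left smult_smult flip: embed_mult)
  have "factor_embed A (k \<odot> \<one>) + factor_embed A ((- k) \<odot> \<one>) = 0" for k
    by (simp add: embed_zero flip: add)
  then show minus: "factor_embed A ((- k) \<odot> \<one>) = - factor_embed A (k \<odot> \<one>)" for k
    by (simp add: eq_neg_iff_add_eq_0 add.commute)
  show "factor_embed A ((k - l) \<odot> \<one>) = factor_embed A (k \<odot> \<one>) - factor_embed A (l \<odot> \<one>)"
    using add[of k "- l"] by (simp add: minus)
qed

lemma scalar_embed_one: "factor_embed A (1 \<odot> \<one>) = factor_embed A \<one>"
  by simp

end

context free_evaluation
begin

definition eval_embed :: "('g list \<Rightarrow>\<^sub>0 'k) \<Rightarrow> 'a ring_product" where
  "eval_embed f = factor_embed A (free_eval A \<phi> f)"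

lemma eval_embed_simps [simp]:
  "a \<in> G \<Longrightarrow> eval_embed (var a) = factor_embed A (\<phi> a)" "eval_embed 0 = 0" "eval_embed 1 = factor_embed A \<one>"
  "\<lbrakk>keys f \<subseteq> lists G; keys g \<subseteq> lists G\<rbrakk> \<Longrightarrow> eval_embed (f + g) = eval_embed f + eval_embed g"
  "\<lbrakk>keys f \<subseteq> lists G; keys g \<subseteq> lists G\<rbrakk> \<Longrightarrow> eval_embed (f - g) = eval_embed f - eval_embed g"
  "\<lbrakk>keys f \<subseteq> lists G; keys g \<subseteq> lists G\<rbrakk> \<Longrightarrow> eval_embed (f * g) = eval_embed f * eval_embed g"
  "keys f \<subseteq> lists G \<Longrightarrow> eval_embed (- f) = - eval_embed f"
  by (simp_all add: eval_embed_def embed_zero embed_add embed_diff embed_mult embed_uminus)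

lemma eval_embed_eqD:
  "\<lbrakk>keys f \<subseteq> lists G; keys g \<subseteq> lists G; eval_embed f = eval_embed g\<rbrakk> \<Longrightarrow>
    free_eval A \<phi> f = free_eval A \<phi> g"
  by (simp add: eval_embed_def embed_eq_iff)

end

lemma eval_embed_scal:
  assumes "free_evaluation A G \<phi>"
  shows "free_evaluation.eval_embed A \<phi> (scal k) = factor_embed A (k \<odot>\<^bsub>A\<^esub> \<one>\<^bsub>A\<^esub>)"
  by (simp add: free_evaluation.eval_embed_def[OF assms] eval_scal[OF assms])

context presentation
begin

lemma free_evaluation_hom:
  assumes "superalgebra_hom Pres D h" shows "free_evaluation D G (\<lambda>g. h (gen g))"
proof -
  interpret h: superalgebra_hom Pres D h by (rule assms)
  show ?thesis using h.hom_carrier gen_carrier by unfold_locales auto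
qed

lemma hom_relation:
  assumes "superalgebra_hom Pres D h" "(l, r) \<in> Rel"
  shows "free_evaluation.eval_embed D (\<lambda>g. h (gen g)) l = free_evaluation.eval_embed D (\<lambda>g. h (gen g)) r"
proof -
  have "keys l \<subseteq> lists G" "keys r \<subseteq> lists G"
    using rel_keys[OF assms(2)] by blast+
  then have "free_eval D (\<lambda>g. h (gen g)) l = free_eval D (\<lambda>g. h (gen g)) r"
    using relation_gen[OF assms(2)] by (simp add: eval_gen flip: hom_eval[OF assms(1)])
  then show ?thesis by (simp add: free_evaluation.eval_embed_def[OF free_evaluation_hom[OF assms(1)]])
qed

lemma hom_exists_emb:
  assumes D: "superalgebra D" and part: "\<And>g. g \<in> G \<Longrightarrow> \<phi> g \<in> part D (par g)"
    and rel: "\<And>l r. (l, r) \<in> Rel \<Longrightarrow> free_evaluation.eval_embed D \<phi> l = free_evaluation.eval_embed D \<phi> r"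
  shows "\<exists>h. superalgebra_hom Pres D h \<and> (\<forall>g\<in>G. h (gen g) = \<phi> g)"
proof (rule hom_exists[OF D part])
  interpret D: superalgebra D by (rule D)
  interpret ev: free_evaluation D G \<phi> using part D.part_carrier by unfold_locales blast
  fix l r assume lr: "(l, r) \<in> Rel"
  have "keys l \<subseteq> lists G" "keys r \<subseteq> lists G"
    using rel_keys[OF lr] by blast+
  then show "free_eval D \<phi> l = free_eval D \<phi> r" using rel[OF lr] by (rule ev.eval_embed_eqD)
qed

end

section \<open>Supercommutation\<close>

context superalgebra
begin

definition supercommute :: "bit \<Rightarrow> bit \<Rightarrow> 'a \<Rightarrow> 'a \<Rightarrow> bool" where
  "supercommute s t y x \<longleftrightarrow> y \<otimes> x = koszul_sign s t \<odot> (x \<otimes> y)"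

lemma koszul_sign_simps: "koszul_sign 0 t = 1" "koszul_sign s 0 = 1"
  "koszul_sign s (t + u) = (koszul_sign s t * koszul_sign s u :: 'k)"
  "koszul_sign (s + v) t = (koszul_sign s t * koszul_sign v t :: 'k)"
  by (cases s; cases t; cases u; cases v; simp add: koszul_sign_def)+

lemma supercommute_one: "x \<in> carrier A \<Longrightarrow> supercommute s 0 x \<one>" "x \<in> carrier A \<Longrightarrow> supercommute 0 s \<one> x"
  by (simp_all add: supercommute_def koszul_sign_simps)

lemma supercommute_mult_right:
  assumes "y \<in> carrier A" "x \<in> carrier A" "x' \<in> carrier A"
    and "supercommute s t y x" "supercommute s t' y x'"
  shows "supercommute s (t + t') y (x \<otimes> x')"
proof -
  have "y \<otimes> (x \<otimes> x') = koszul_sign s t \<odot> (x \<otimes> (y \<otimes> x'))"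
    using assms by (simp add: supercommute_def smult_mult_left m_assoc flip: m_assoc[of y x x'])
  also have "\<dots> = (koszul_sign s t * koszul_sign s t') \<odot> ((x \<otimes> x') \<otimes> y)"
    using assms by (simp add: supercommute_def smult_mult_right smult_smult m_assoc)
  finally show ?thesis by (simp only: supercommute_def koszul_sign_simps)
qed

lemma supercommute_mult_left:
  assumes "x \<in> carrier A" "y \<in> carrier A" "y' \<in> carrier A"
    and "supercommute s t y x" "supercommute s' t y' x"
  shows "supercommute (s + s') t (y \<otimes> y') x"
proof -
  have "(y \<otimes> y') \<otimes> x = koszul_sign s' t \<odot> ((y \<otimes> x) \<otimes> y')"
    using assms by (simp add: supercommute_def smult_mult_right m_assoc flip: m_assoc[of y x y'])
  also have "\<dots> = (koszul_sign s' t * koszul_sign s t) \<odot> (x \<otimes> (y \<otimes> y'))"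
    using assms by (simp add: supercommute_def smult_mult_left smult_smult m_assoc)
  finally show ?thesis by (simp only: supercommute_def koszul_sign_simps mult.commute)
qed

lemma supercommute_add:
  "\<lbrakk>y \<in> carrier A; x \<in> carrier A; x' \<in> carrier A; supercommute s t y x; supercommute s t y x'\<rbrakk> \<Longrightarrow>
    supercommute s t y (x \<oplus> x')"
  "\<lbrakk>x \<in> carrier A; y \<in> carrier A; y' \<in> carrier A; supercommute s t y x; supercommute s t y' x\<rbrakk> \<Longrightarrow>
    supercommute s t (y \<oplus> y') x"
  by (simp_all add: supercommute_def l_distr r_distr smult_add_right)

lemma supercommute_smult:
  "\<lbrakk>y \<in> carrier A; x \<in> carrier A; supercommute s t y x\<rbrakk> \<Longrightarrow> supercommute s t y (k \<odot> x)"
  "\<lbrakk>x \<in> carrier A; y \<in> carrier A; supercommute s t y x\<rbrakk> \<Longrightarrow> supercommute s t (k \<odot> y) x"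
  by (simp_all add: supercommute_def smult_mult_left smult_mult_right smult_smult mult.commute)

end

lemma (in free_evaluation) supercommute_eval:
  assumes y: "y \<in> carrier A"
    and gens: "\<And>g. g \<in> G \<Longrightarrow> supercommute s (par g) y (\<phi> g)"
    and f: "f \<in> part (free_superalgebra G par) t"
  shows "supercommute s t y (free_eval A \<phi> f)"
proof -
  have word: "supercommute s (sum_list (map par w)) y (word_prod A \<phi> w)" if "w \<in> lists G" for w
    using that
  proof (induction w)
    case Nil
    then show ?case using supercommute_one y by simp
  next
    case (Cons g w)
    then show ?case
      using supercommute_mult_right[OF y \<phi>_carrier word_carrier gens] by simp
  qed
  have "keys f \<subseteq> {w \<in> lists G. sum_list (map par w) = t}" using f by simp
  then show ?thesis
  proof (induction f rule: poly_mapping_linear_induct)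
    case zero
    then show ?case using y by (simp add: supercommute_def)
  next
    case (single w k)
    then show ?case using word[of w] word_carrier[of w] y by (auto simp: eval_single intro!: supercommute_smult)
  next
    case (add f g)
    then have c: "keys f \<subseteq> lists G" "keys g \<subseteq> lists G" by auto
    show ?case unfolding eval_add[OF c]
      by (rule supercommute_add(1)[OF y eval_carrier[OF c(1)] eval_carrier[OF c(2)] add.IH])
  qed
qed

lemma (in free_evaluation) supercommute_eval':
  assumes x: "x \<in> carrier A"
    and gens: "\<And>g. g \<in> G \<Longrightarrow> supercommute (par g) t (\<phi> g) x"
    and f: "f \<in> part (free_superalgebra G par) s"
  shows "supercommute s t (free_eval A \<phi> f) x"
proof -
  have word: "supercommute (sum_list (map par w)) t (word_prod A \<phi> w) x" if "w \<in> lists G" for w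
    using that
  proof (induction w)
    case Nil
    then show ?case using supercommute_one x by simp
  next
    case (Cons g w)
    then show ?case
      using supercommute_mult_left[OF x \<phi>_carrier word_carrier gens] by simp
  qed
  have "keys f \<subseteq> {w \<in> lists G. sum_list (map par w) = s}" using f by simp
  then show ?thesis
  proof (induction f rule: poly_mapping_linear_induct)
    case zero
    then show ?case using x by (simp add: supercommute_def)
  next
    case (single w k)
    then show ?case using word[of w] word_carrier[of w] x by (auto simp: eval_single intro!: supercommute_smult)
  next
    case (add f g)
    then have c: "keys f \<subseteq> lists G" "keys g \<subseteq> lists G" by auto
    show ?case unfolding eval_add[OF c]
      by (rule supercommute_add(2)[OF x eval_carrier[OF c(1)] eval_carrier[OF c(2)] add.IH])
  qed
qed

text \<open>
  The elements that supercommute with a given one are closed under products and linear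
  combinations, with the degrees added up.  Applying this in both arguments reduces
  supercommutation of two homomorphic images to generators.
\<close>

lemma supercommute_generators:
  fixes D :: "('k::field, 'd, 'm) superalgebra_scheme"
  assumes "presentation G par Rel" "presentation G' par' Rel'"
    and f: "superalgebra_hom (presented G par Rel) D f" and g: "superalgebra_hom (presented G' par' Rel') D g"
    and gens: "\<And>a b. \<lbrakk>a \<in> G; b \<in> G'\<rbrakk> \<Longrightarrow> superalgebra.supercommute D (par' b) (par a)
        (g (generator G' par' Rel' b)) (f (generator G par Rel a))"
    and x: "x \<in> part (presented G par Rel) t" and y: "y \<in> part (presented G' par' Rel') s"
  shows "superalgebra.supercommute D s t (g y) (f x)"
proof -
  interpret A: presentation G par Rel by fact
  interpret B: presentation G' par' Rel' by fact
  interpret D: superalgebra D using f by (rule superalgebra_hom.axioms)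
  interpret f: free_evaluation D G "\<lambda>a. f (A.gen a)" by (rule A.free_evaluation_hom[OF f])
  interpret g: free_evaluation D G' "\<lambda>b. g (B.gen b)" by (rule B.free_evaluation_hom[OF g])
  obtain u where u: "u \<in> part (free_superalgebra G par) t" "x = A.P.cls u"
    using x by (auto simp: A.Pres_eq A.P.quot_part)
  obtain v where v: "v \<in> part (free_superalgebra G' par') s" "y = B.P.cls v"
    using y by (auto simp: B.Pres_eq B.P.quot_part)
  have uc: "keys u \<subseteq> lists G" and vc: "keys v \<subseteq> lists G'"
    using u v by auto
  have "D.supercommute s t (free_eval D (\<lambda>b. g (B.gen b)) v) (free_eval D (\<lambda>a. f (A.gen a)) u)"
    using u(1) vc by (intro f.supercommute_eval[where par = par] g.supercommute_eval'[OF _ _ v(1)])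
      (auto intro: gens f.\<phi>_carrier)
  then show ?thesis
    by (simp add: u v A.hom_eval[OF f uc] B.hom_eval[OF g vc])
qed

section \<open>The three presentations\<close>

lemma ball_pairs:
  "(\<forall>x\<in>{(a i, b i) | i. S i}. Q x) \<longleftrightarrow> (\<forall>i. S i \<longrightarrow> Q (a i, b i))"
  "(\<forall>x\<in>{(a' i j, b' i j) | i j. S' i j}. Q x) \<longleftrightarrow> (\<forall>i j. S' i j \<longrightarrow> Q (a' i j, b' i j))"
  by blast+

text \<open>
  One conjunct for each family of relations, here and for the other two presentations.  Used in
  one direction, this extracts a relation in an algebra where all of them hold; in the other
  direction it splits the task of verifying them.
\<close>

lemma clifford_rels_ball:
  "(\<forall>(l, r)\<in>clifford_rels n. Q l r) \<longleftrightarrow>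
    (\<forall>i. i \<in> {1..n} \<longrightarrow> Q (var (GenC i) * var (GenC i)) 1) \<and>
    (\<forall>i j. i \<in> {1..n} \<and> j \<in> {1..n} \<and> i \<noteq> j \<longrightarrow>
      Q (var (GenC i) * var (GenC j)) (- (var (GenC j) * var (GenC i))))"
  unfolding clifford_rels_def Let_def ball_Un ball_pairs by (simp only: prod.case)

lemma hc_rels_ball:
  "(\<forall>(l, r)\<in>hc_rels n. Q l r) \<longleftrightarrow>
    (\<forall>i. i \<in> {1..<n} \<longrightarrow> Q ((var (HT i) - scal qpar) * (var (HT i) + scal (inverse qpar))) 0) \<and>
    (\<forall>i. i \<in> {1..<n} \<and> i + 1 \<in> {1..<n} \<longrightarrow>
      Q (var (HT i) * var (HT (i+1)) * var (HT i)) (var (HT (i+1)) * var (HT i) * var (HT (i+1)))) \<and>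
    (\<forall>i j. i \<in> {1..<n} \<and> j \<in> {1..<n} \<and> \<bar>int i - int j\<bar> > 1 \<longrightarrow>
      Q (var (HT i) * var (HT j)) (var (HT j) * var (HT i))) \<and>
    (\<forall>i. i \<in> {1..<n} \<longrightarrow> Q (var (HT i) * var (HC i)) (var (HC (i+1)) * var (HT i))) \<and>
    (\<forall>i j. i \<in> {1..<n} \<and> j \<in> {1..n} \<and> j \<noteq> i \<and> j \<noteq> i + 1 \<longrightarrow>
      Q (var (HT i) * var (HC j)) (var (HC j) * var (HT i))) \<and>
    (\<forall>i. i \<in> {1..n} \<longrightarrow> Q (var (HC i) * var (HC i)) 1) \<and>
    (\<forall>i j. i \<in> {1..n} \<and> j \<in> {1..n} \<and> i \<noteq> j \<longrightarrow>
      Q (var (HC i) * var (HC j)) (- (var (HC j) * var (HC i)))) \<and>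
    (\<forall>i. i \<in> {1..n} \<longrightarrow> Q (var (HX i) * var (HXi i)) 1) \<and>
    (\<forall>i. i \<in> {1..n} \<longrightarrow> Q (var (HXi i) * var (HX i)) 1) \<and>
    (\<forall>i. i \<in> {1..<n} \<longrightarrow>
      Q ((var (HT i) + scal eps * var (HC i) * var (HC (i+1))) * var (HX i) * var (HT i)) (var (HX (i+1)))) \<and>
    (\<forall>i j. i \<in> {1..<n} \<and> j \<in> {1..n} \<and> j \<noteq> i \<and> j \<noteq> i + 1 \<longrightarrow>
      Q (var (HT i) * var (HX j)) (var (HX j) * var (HT i))) \<and>
    (\<forall>i j. i \<in> {1..n} \<and> j \<in> {1..n} \<longrightarrow> Q (var (HX i) * var (HX j)) (var (HX j) * var (HX i))) \<and>
    (\<forall>i. i \<in> {1..n} \<longrightarrow> Q (var (HX i) * var (HC i)) (var (HC i) * var (HXi i))) \<and>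
    (\<forall>i j. i \<in> {1..n} \<and> j \<in> {1..n} \<and> i \<noteq> j \<longrightarrow>
      Q (var (HX i) * var (HC j)) (var (HC j) * var (HX i)))"
  unfolding hc_rels_def Let_def ball_Un ball_pairs by (simp only: prod.case conj_assoc)

lemma spin_rels_ball:
  "(\<forall>(l, r)\<in>spin_rels n. Q l r) \<longleftrightarrow>
    (\<forall>i. i \<in> {1..<n} \<longrightarrow> Q (var (SR i) * var (SR i)) (scal (- (eps^2) - 2))) \<and>
    (\<forall>i j. i \<in> {1..<n} \<and> j \<in> {1..<n} \<and> \<bar>int i - int j\<bar> > 1 \<longrightarrow>
      Q (var (SR i) * var (SR j)) (- (var (SR j) * var (SR i)))) \<and>
    (\<forall>i. i \<in> {1..<n} \<and> i + 1 \<in> {1..<n} \<longrightarrow>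
      Q (var (SR i) * var (SR (i+1)) * var (SR i) - var (SR (i+1)) * var (SR i) * var (SR (i+1)))
        (scal (eps^2) * (var (SR (i+1)) - var (SR i)))) \<and>
    (\<forall>i j. i \<in> {1..n} \<and> j \<in> {1..n} \<and> i \<noteq> j \<longrightarrow> Q (var (SP i) * var (SP j)) (var (SP j) * var (SP i))) \<and>
    (\<forall>i j. i \<in> {1..n} \<and> j \<in> {1..n} \<and> i \<noteq> j \<longrightarrow> Q (var (SQ i) * var (SQ j)) (- (var (SQ j) * var (SQ i)))) \<and>
    (\<forall>i. i \<in> {1..n} \<longrightarrow> Q (var (SP i) * var (SP i) + var (SQ i) * var (SQ i)) 1) \<and>
    (\<forall>i j. i \<in> {1..n} \<and> j \<in> {1..n} \<longrightarrow> Q (var (SP i) * var (SQ j)) (var (SQ j) * var (SP i))) \<and>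
    (\<forall>i j. i \<in> {1..<n} \<and> j \<in> {1..n} \<and> j \<noteq> i \<and> j \<noteq> i + 1 \<longrightarrow>
      Q (var (SR i) * var (SP j)) (var (SP j) * var (SR i))) \<and>
    (\<forall>i j. i \<in> {1..<n} \<and> j \<in> {1..n} \<and> j \<noteq> i \<and> j \<noteq> i + 1 \<longrightarrow>
      Q (var (SR i) * var (SQ j)) (- (var (SQ j) * var (SR i)))) \<and>
    (\<forall>i. i \<in> {1..<n} \<longrightarrow>
      Q (var (SR i) * var (SP i)) (var (SP (i+1)) * var (SR i) + scal eps * (var (SQ i) - var (SQ (i+1))))) \<and>
    (\<forall>i. i \<in> {1..<n} \<longrightarrow>
      Q (var (SR i) * var (SQ i)) (- (var (SQ (i+1)) * var (SR i)) - scal eps * (var (SP i) + var (SP (i+1)))))"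
  unfolding spin_rels_def Let_def ball_Un ball_pairs by (simp only: prod.case conj_assoc)

text \<open>
  The equations between degrees are separate premises, so that the rules also apply while the
  degree is still unknown.
\<close>

lemma homogeneous_intros:
  fixes f g :: "'g list \<Rightarrow>\<^sub>0 'k::field"
  shows "\<lbrakk>a \<in> G; par a = s\<rbrakk> \<Longrightarrow> var a \<in> part (free_superalgebra G par) s"
    and "0 \<in> part (free_superalgebra G par) s"
    and "s = 0 \<Longrightarrow> 1 \<in> part (free_superalgebra G par) s"
    and "s = 0 \<Longrightarrow> scal k \<in> part (free_superalgebra G par) s"
    and "\<lbrakk>f \<in> part (free_superalgebra G par) s; g \<in> part (free_superalgebra G par) s\<rbrakk> \<Longrightarrow>
      f + g \<in> part (free_superalgebra G par) s"
    and "\<lbrakk>f \<in> part (free_superalgebra G par) s; g \<in> part (free_superalgebra G par) s\<rbrakk> \<Longrightarrow>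
      f - g \<in> part (free_superalgebra G par) s"
    and "f \<in> part (free_superalgebra G par) s \<Longrightarrow> - f \<in> part (free_superalgebra G par) s"
    and "\<lbrakk>f \<in> part (free_superalgebra G par) t; g \<in> part (free_superalgebra G par) u; t + u = s\<rbrakk> \<Longrightarrow>
      f * g \<in> part (free_superalgebra G par) s"
proof -
  note sub = subspace_keys[of "{w \<in> lists G. sum_list (map par w) = s}"]
  show "\<lbrakk>a \<in> G; par a = s\<rbrakk> \<Longrightarrow> var a \<in> part (free_superalgebra G par) s" by (simp add: var_def)
  show "0 \<in> part (free_superalgebra G par) s" by simp
  show "- f \<in> part (free_superalgebra G par) s" if "f \<in> part (free_superalgebra G par) s"
    using that by simp
  show "f + g \<in> part (free_superalgebra G par) s" "f - g \<in> part (free_superalgebra G par) s"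
    if "f \<in> part (free_superalgebra G par) s" "g \<in> part (free_superalgebra G par) s"
    using pscale.subspace_add[OF sub, of f g] pscale.subspace_diff[OF sub, of f g] that by simp_all
  show "1 \<in> part (free_superalgebra G par) s" if "s = 0" using that by (simp add: zero_list_def)
  show "scal k \<in> part (free_superalgebra G par) s" if "s = 0"
    using that keys_pscale[of k 1] by (auto simp: scal_def zero_list_def)
  show "f * g \<in> part (free_superalgebra G par) s"
    if "f \<in> part (free_superalgebra G par) t" "g \<in> part (free_superalgebra G par) u" "t + u = s"
    using that keys_mult[of f g] by (fastforce simp: sum_bit_word plus_list_def)
qed

lemma presentation_clifford: "presentation (clifford_gens n) clifford_parity (clifford_rels n)"
proof -
  let ?F = "free_superalgebra (clifford_gens n) clifford_parity"
  have "\<forall>(l, r)\<in>clifford_rels n. \<exists>s. l \<in> part ?F s \<and> r \<in> part ?F s"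
    unfolding clifford_rels_ball
    by (intro conjI allI impI;
        ((rule exI[of _ 0], intro conjI homogeneous_intros, (rule refl | simp add: clifford_gens_def clifford_parity_def; fail)+; fail) |
         (rule exI[of _ 1], intro conjI homogeneous_intros, (rule refl | simp add: clifford_gens_def clifford_parity_def; fail)+; fail)))
  then show ?thesis by unfold_locales blast
qed

lemma presentation_hc: "presentation (hc_gens n) hc_parity (hc_rels n)"
proof -
  let ?F = "free_superalgebra (hc_gens n) hc_parity"
  have "\<forall>(l, r)\<in>hc_rels n. \<exists>s. l \<in> part ?F s \<and> r \<in> part ?F s"
    unfolding hc_rels_ball
    by (intro conjI allI impI;
        ((rule exI[of _ 0], intro conjI homogeneous_intros, (rule refl | simp add: hc_gens_def; fail)+; fail) |
         (rule exI[of _ 1], intro conjI homogeneous_intros, (rule refl | simp add: hc_gens_def; fail)+; fail)))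
  then show ?thesis by unfold_locales blast
qed

lemma presentation_spin: "presentation (spin_gens n) spin_parity (spin_rels n)"
proof -
  let ?F = "free_superalgebra (spin_gens n) spin_parity"
  have "\<forall>(l, r)\<in>spin_rels n. \<exists>s. l \<in> part ?F s \<and> r \<in> part ?F s"
    unfolding spin_rels_ball
    by (intro conjI allI impI;
        ((rule exI[of _ 0], intro conjI homogeneous_intros, (rule refl | simp add: spin_gens_def; fail)+; fail) |
         (rule exI[of _ 1], intro conjI homogeneous_intros, (rule refl | simp add: spin_gens_def; fail)+; fail)))
  then show ?thesis by unfold_locales blast
qed

lemma two_Cq: "(2 :: Cq) \<noteq> 0"
proof -
  have two: "(2 :: Cq) = Fract (of_nat 2) 1" unfolding Fract_of_nat_eq by simp
  show ?thesis unfolding two Zero_fract_def by (simp add: eq_fract)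
qed

lemma qpar_nonzero: "qpar \<noteq> 0"
  by (simp add: qpar_def Zero_fract_def eq_fract)

section \<open>The systems of generators\<close>

abbreviation "unit_in D \<equiv> factor_embed D \<one>\<^bsub>D\<^esub>"

abbreviation "scalar_in D k \<equiv> factor_embed D (k \<odot>\<^bsub>D\<^esub> \<one>\<^bsub>D\<^esub>)"

lemma scalar_in_squares:
  fixes D :: "(Cq, 'd, 'm) superalgebra_scheme"
  assumes "superalgebra D"
  shows "scalar_in D (- (eps\<^sup>2) - 2) = - (scalar_in D eps * scalar_in D eps) - unit_in D - unit_in D"
    and "scalar_in D (eps\<^sup>2) = scalar_in D eps * scalar_in D eps"
proof -
  interpret D: superalgebra D by (rule assms)
  have "- (eps\<^sup>2) - 2 = - (eps * eps) - 1 - 1" by (simp add: power2_eq_square)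
  then show "scalar_in D (- (eps\<^sup>2) - 2) = - (scalar_in D eps * scalar_in D eps) - unit_in D - unit_in D"
    by (simp only: D.scalar_embed D.scalar_embed_one)
  show "scalar_in D (eps\<^sup>2) = scalar_in D eps * scalar_in D eps"
    by (simp add: power2_eq_square D.scalar_embed)
qed

lemma scalar_in_halves:
  fixes D :: "(Cq, 'd, 'm) superalgebra_scheme"
  assumes "superalgebra D"
  shows "scalar_in D (- (1/2)) = - scalar_in D (1/2)"
    and "scalar_in D (eps/2) = scalar_in D (1/2) * scalar_in D eps"
proof -
  interpret D: superalgebra D by (rule assms)
  show "scalar_in D (- (1/2)) = - scalar_in D (1/2)"
    "scalar_in D (eps/2) = scalar_in D (1/2) * scalar_in D eps"
    using D.scalar_embed(3)[of "1/2"] D.scalar_embed(2)[of "1/2" eps] by simp_all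
qed

lemma qpar_scalars:
  fixes D :: "(Cq, 'd, 'm) superalgebra_scheme"
  assumes "superalgebra D"
  shows "scalar_in D qpar * scalar_in D (inverse qpar) = unit_in D"
    and "scalar_in D eps = scalar_in D qpar - scalar_in D (inverse qpar)"
    and "x \<in> carrier D \<Longrightarrow>
      factor_embed D x * scalar_in D (inverse qpar) = scalar_in D (inverse qpar) * factor_embed D x"
proof -
  interpret D: superalgebra D by (rule assms)
  show "scalar_in D qpar * scalar_in D (inverse qpar) = unit_in D"
    unfolding D.scalar_embed(2)[symmetric] using qpar_nonzero by simp
  show "scalar_in D eps = scalar_in D qpar - scalar_in D (inverse qpar)"
    by (simp add: eps_def D.scalar_embed)
  show "factor_embed D x * scalar_in D (inverse qpar) = scalar_in D (inverse qpar) * factor_embed D x"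
    if "x \<in> carrier D"
    using that by (simp add: D.smult_mult_left D.smult_mult_right flip: D.embed_mult)
qed

lemma gens_iff [simp]:
  "GenC i \<in> clifford_gens n \<longleftrightarrow> i \<in> {1..n}"
  "HT i \<in> hc_gens n \<longleftrightarrow> i \<in> {1..<n}" "HC i \<in> hc_gens n \<longleftrightarrow> i \<in> {1..n}"
  "HX i \<in> hc_gens n \<longleftrightarrow> i \<in> {1..n}" "HXi i \<in> hc_gens n \<longleftrightarrow> i \<in> {1..n}"
  "SR i \<in> spin_gens n \<longleftrightarrow> i \<in> {1..<n}" "SP i \<in> spin_gens n \<longleftrightarrow> i \<in> {1..n}"
  "SQ i \<in> spin_gens n \<longleftrightarrow> i \<in> {1..n}"
  by (auto simp: clifford_gens_def hc_gens_def spin_gens_def)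

text \<open>
  With the identity for \<open>f\<close>, this turns the presentation into relations between elements of a type
  of class \<open>ring\<close>, which can be used for rewriting.
\<close>

lemma hc_system_of_hom:
  fixes D :: "(Cq, 'd, 'm) superalgebra_scheme"
  assumes f: "superalgebra_hom (affine_hc n) D f"
  shows "hc_system (factor_embed D ` carrier D) (unit_in D) (scalar_in D eps) (scalar_in D (1/2)) n
    (\<lambda>i. factor_embed D (f (affine_hc_gen n (HC i)))) (\<lambda>i. factor_embed D (f (affine_hc_gen n (HT i))))
    (\<lambda>i. factor_embed D (f (affine_hc_gen n (HX i)))) (\<lambda>i. factor_embed D (f (affine_hc_gen n (HXi i))))"
proof -
  interpret H: presentation "hc_gens n" hc_parity "hc_rels n" by (rule presentation_hc)
  have f': "superalgebra_hom H.Pres D f" using f by (simp add: affine_hc_def)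
  interpret D: superalgebra D using f by (rule superalgebra_hom.axioms)
  interpret f: superalgebra_hom H.Pres D f by (rule f')
  interpret ev: free_evaluation D "hc_gens n" "\<lambda>g. f (H.gen g)" by (rule H.free_evaluation_hom[OF f'])
  interpret K: corner "factor_embed D ` carrier D" "unit_in D" "scalar_in D eps" "scalar_in D (1/2)"
    by (rule D.corner_embed[OF two_Cq])
  have "\<forall>(l, r)\<in>hc_rels n. ev.eval_embed l = ev.eval_embed r" using H.hom_relation[OF f'] by blast
  note rel = this[unfolded hc_rels_ball]
  note scal = eval_embed_scal[OF ev.free_evaluation_axioms]
  have mem: "factor_embed D (f (H.gen g)) \<in> factor_embed D ` carrier D" if "g \<in> hc_gens n" for g
    using H.gen_carrier[OF that] f.hom_carrier by blast
  note rel1 = rel[THEN conjunct2]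
  note rel2 = rel1[THEN conjunct2]
  note rel3 = rel2[THEN conjunct2]
  note rel4 = rel3[THEN conjunct2]
  note rel5 = rel4[THEN conjunct2]
  note rel6 = rel5[THEN conjunct2]
  note rel7 = rel6[THEN conjunct2]
  note rel8 = rel7[THEN conjunct2]
  note rel9 = rel8[THEN conjunct2]
  note rel10 = rel9[THEN conjunct2]
  note rel11 = rel10[THEN conjunct2]
  note rel12 = rel11[THEN conjunct2]
  note rel13 = rel12[THEN conjunct2]
  note r = rel[THEN conjunct1, rule_format] rel1[THEN conjunct1, rule_format]
    rel2[THEN conjunct1, rule_format] rel3[THEN conjunct1, rule_format]
    rel4[THEN conjunct1, rule_format] rel5[THEN conjunct1, rule_format]
    rel6[THEN conjunct1, rule_format] rel7[THEN conjunct1, rule_format]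
    rel8[THEN conjunct1, rule_format] rel9[THEN conjunct1, rule_format]
    rel10[THEN conjunct1, rule_format] rel11[THEN conjunct1, rule_format]
    rel12[THEN conjunct1, rule_format]
    rel13[rule_format]
  let ?t = "\<lambda>i. factor_embed D (f (H.gen (HT i)))" and ?c = "\<lambda>i. factor_embed D (f (H.gen (HC i)))"
  let ?x = "\<lambda>i. factor_embed D (f (H.gen (HX i)))" and ?x' = "\<lambda>i. factor_embed D (f (H.gen (HXi i)))"
  let ?z = "scalar_in D eps"
  show ?thesis
    unfolding affine_hc_gen_def
  proof
    fix i assume i: "i \<in> {1..<n}"
    let ?ti = "?t i" and ?q = "scalar_in D qpar" and ?q' = "scalar_in D (inverse qpar)"
    have "(?ti - ?q) * (?ti + ?q') = 0" using r(1)[of i] i by (simp add: scal)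
    then have "?ti * ?ti = ?q * ?ti - ?ti * ?q' + ?q * ?q'" by (simp add: algebra_simps)
    moreover have "?ti * ?q' = ?q' * ?ti"
      using i f.hom_carrier[OF H.gen_carrier[of "HT i"]] by (intro qpar_scalars(3) D.superalgebra_axioms) simp
    ultimately show "?ti * ?ti = ?z * ?ti + unit_in D"
      unfolding qpar_scalars(2)[OF D.superalgebra_axioms]
      by (simp add: left_diff_distrib qpar_scalars(1)[OF D.superalgebra_axioms])
  next
    show "?t i * (?t (Suc i) * ?t i) = ?t (Suc i) * (?t i * ?t (Suc i))"
      if "i \<in> {1..<n}" "Suc i \<in> {1..<n}" for i
      using r(2)[of i] that by (simp add: mult.assoc)
    show "?t j * ?t i = ?t i * ?t j" if "i \<in> {1..<n}" "j \<in> {1..<n}" "Suc i < j" for i j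
      using r(3)[of j i] that by simp
    show "?t i * ?c i = ?c (Suc i) * ?t i" if "i \<in> {1..<n}" for i
      using r(4)[of i] that by simp
    show "?t i * ?c j = ?c j * ?t i" "?t i * ?x j = ?x j * ?t i"
      if "i \<in> {1..<n}" "j \<in> {1..n}" "j \<noteq> i" "j \<noteq> Suc i" for i j
      using r(5,11)[of i j] that by simp_all
    show "?c i * ?c i = unit_in D" "?x i * ?x' i = unit_in D" "?x' i * ?x i = unit_in D"
      "?x i * ?c i = ?c i * ?x' i" if "i \<in> {1..n}" for i
      using r(6,8,9,13)[of i] that by simp_all
    show "?c i * ?c j = - (?c j * ?c i)" if "i \<in> {1..n}" "j \<in> {1..n}" "i \<noteq> j" for i j
      using r(7)[of i j] that by simp
    show "(?t i + ?z * ?c i * ?c (Suc i)) * ?x i * ?t i = ?x (Suc i)" if "i \<in> {1..<n}" for i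
      using r(10)[of i] that by (simp add: scal)
    show "?x i * ?x j = ?x j * ?x i" if "i \<in> {1..n}" "j \<in> {1..n}" for i j
      using r(12)[of i j] that by simp
    show "?x i * ?c j = ?c j * ?x i" if "i \<in> {1..n}" "j \<in> {1..n}" "i \<noteq> j" for i j
      using r(14)[of i j] that by simp
  qed (use mem in simp_all)
qed

text \<open>
  For two homomorphisms with supercommuting images, such as the inclusions of the factors of the
  tensor product.
\<close>

lemma clifford_spin_system_of_homs:
  fixes D :: "(Cq, 'd, 'm) superalgebra_scheme"
  assumes f: "superalgebra_hom (clifford n) D f" and g: "superalgebra_hom (spin_affine_hecke n) D g"
    and super: "\<And>a b s t. \<lbrakk>a \<in> part (clifford n) t; b \<in> part (spin_affine_hecke n) s\<rbrakk> \<Longrightarrow>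
      superalgebra.supercommute D s t (g b) (f a)"
  shows "clifford_spin_system (factor_embed D ` carrier D) (unit_in D) (scalar_in D eps) (scalar_in D (1/2)) n
    (\<lambda>i. factor_embed D (f (clifford_c n i)))
    (\<lambda>i. factor_embed D (g (spin_affine_hecke_gen n (SR i)))) (\<lambda>i. factor_embed D (g (spin_affine_hecke_gen n (SP i))))
    (\<lambda>i. factor_embed D (g (spin_affine_hecke_gen n (SQ i))))"
proof -
  interpret C: presentation "clifford_gens n" clifford_parity "clifford_rels n" by (rule presentation_clifford)
  interpret S: presentation "spin_gens n" spin_parity "spin_rels n" by (rule presentation_spin)
  have f': "superalgebra_hom C.Pres D f" and g': "superalgebra_hom S.Pres D g"
    using f g by (simp_all add: clifford_def spin_affine_hecke_def)
  interpret D: superalgebra D using f by (rule superalgebra_hom.axioms)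
  interpret f: superalgebra_hom C.Pres D f by (rule f')
  interpret g: superalgebra_hom S.Pres D g by (rule g')
  interpret fe: free_evaluation D "clifford_gens n" "\<lambda>a. f (C.gen a)" by (rule C.free_evaluation_hom[OF f'])
  interpret ge: free_evaluation D "spin_gens n" "\<lambda>a. g (S.gen a)" by (rule S.free_evaluation_hom[OF g'])
  interpret K: corner "factor_embed D ` carrier D" "unit_in D" "scalar_in D eps" "scalar_in D (1/2)"
    by (rule D.corner_embed[OF two_Cq])
  have "\<forall>(l, r)\<in>clifford_rels n. fe.eval_embed l = fe.eval_embed r" using C.hom_relation[OF f'] by blast
  note crel = this[unfolded clifford_rels_ball]
  have "\<forall>(l, r)\<in>spin_rels n. ge.eval_embed l = ge.eval_embed r" using S.hom_relation[OF g'] by blast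
  note srel = this[unfolded spin_rels_ball]
  have scal: "ge.eval_embed (scal k) = scalar_in D k" for k by (rule eval_embed_scal[OF ge.free_evaluation_axioms])
  note sq = scalar_in_squares[OF D.superalgebra_axioms]
  have mem: "f (C.gen a) \<in> carrier D" "g (S.gen b) \<in> carrier D"
    if "a \<in> clifford_gens n" "b \<in> spin_gens n" for a b
    using C.gen_carrier S.gen_carrier f.hom_carrier g.hom_carrier that by blast+
  have mem': "a \<in> clifford_gens n \<Longrightarrow> factor_embed D (f (C.gen a)) \<in> factor_embed D ` carrier D"
    "b \<in> spin_gens n \<Longrightarrow> factor_embed D (g (S.gen b)) \<in> factor_embed D ` carrier D" for a b
    using C.gen_carrier S.gen_carrier f.hom_carrier g.hom_carrier by blast+
  have sc: "factor_embed D (g (S.gen b)) * factor_embed D (f (C.gen a)) =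
      (if spin_parity b = 1 then - (factor_embed D (f (C.gen a)) * factor_embed D (g (S.gen b)))
       else factor_embed D (f (C.gen a)) * factor_embed D (g (S.gen b)))"
    if "a \<in> clifford_gens n" "b \<in> spin_gens n" for a b
  proof -
    have "D.supercommute (spin_parity b) 1 (g (S.gen b)) (f (C.gen a))"
      using C.gen_part[OF that(1)] S.gen_part[OF that(2)]
      by (intro super) (simp_all add: clifford_def spin_affine_hecke_def clifford_parity_def)
    then show ?thesis
      using mem[OF that] by (auto simp: D.supercommute_def koszul_sign_def D.smult_neg_1 D.embed_uminus
          simp flip: D.embed_mult)
  qed
  note cr = crel[THEN conjunct1, rule_format] crel[THEN conjunct2, rule_format]
  note srel1 = srel[THEN conjunct2]
  note srel2 = srel1[THEN conjunct2]
  note srel3 = srel2[THEN conjunct2]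
  note srel4 = srel3[THEN conjunct2]
  note srel5 = srel4[THEN conjunct2]
  note srel6 = srel5[THEN conjunct2]
  note srel7 = srel6[THEN conjunct2]
  note srel8 = srel7[THEN conjunct2]
  note srel9 = srel8[THEN conjunct2]
  note srel10 = srel9[THEN conjunct2]
  note sr = srel[THEN conjunct1, rule_format] srel1[THEN conjunct1, rule_format]
    srel2[THEN conjunct1, rule_format] srel3[THEN conjunct1, rule_format]
    srel4[THEN conjunct1, rule_format] srel5[THEN conjunct1, rule_format]
    srel6[THEN conjunct1, rule_format] srel7[THEN conjunct1, rule_format]
    srel8[THEN conjunct1, rule_format] srel9[THEN conjunct1, rule_format]
    srel10[rule_format]
  let ?c = "\<lambda>i. factor_embed D (f (C.gen (GenC i)))" and ?R = "\<lambda>i. factor_embed D (g (S.gen (SR i)))"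
  let ?p = "\<lambda>i. factor_embed D (g (S.gen (SP i)))" and ?q = "\<lambda>i. factor_embed D (g (S.gen (SQ i)))"
  let ?z = "scalar_in D eps"
  show ?thesis
    unfolding clifford_c_def spin_affine_hecke_gen_def
  proof
    show "?c i * ?c i = unit_in D" if "i \<in> {1..n}" for i
      using cr(1)[of i] that by simp
    show "?c i * ?c j = - (?c j * ?c i)" if "i \<in> {1..n}" "j \<in> {1..n}" "i \<noteq> j" for i j
      using cr(2)[of i j] that by simp
    show "?R i * ?R i = - (?z * ?z) - unit_in D - unit_in D" if "i \<in> {1..<n}" for i
      using sr(1)[of i] that by (simp add: scal sq)
    show "?R i * ?R (Suc i) * ?R i - ?R (Suc i) * ?R i * ?R (Suc i) = ?z * ?z * (?R (Suc i) - ?R i)"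
      if "i \<in> {1..<n}" "Suc i \<in> {1..<n}" for i
      using sr(3)[of i] that by (simp add: scal sq)
    show "?R j * ?R i = - (?R i * ?R j)" if "i \<in> {1..<n}" "j \<in> {1..<n}" "Suc i < j" for i j
      using sr(2)[of j i] that by simp
    show "?p i * ?p j = ?p j * ?p i" if "i \<in> {1..n}" "j \<in> {1..n}" for i j
      using sr(4)[of i j] that by (cases "i = j") simp_all
    show "?q i * ?q j = - (?q j * ?q i)" if "i \<in> {1..n}" "j \<in> {1..n}" "i \<noteq> j" for i j
      using sr(5)[of i j] that by simp
    show "?p i * ?p i + ?q i * ?q i = unit_in D" if "i \<in> {1..n}" for i
      using sr(6)[of i] that by simp
    show "?p i * ?q j = ?q j * ?p i" if "i \<in> {1..n}" "j \<in> {1..n}" for i j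
      using sr(7)[of i j] that by simp
    show "?R i * ?p j = ?p j * ?R i" "?R i * ?q j = - (?q j * ?R i)"
      if "i \<in> {1..<n}" "j \<in> {1..n}" "j \<noteq> i" "j \<noteq> Suc i" for i j
      using sr(8,9)[of i j] that by simp_all
    show "?R i * ?p i = ?p (Suc i) * ?R i + ?z * (?q i - ?q (Suc i))"
      "?R i * ?q i = - (?q (Suc i) * ?R i) - ?z * (?p i + ?p (Suc i))" if "i \<in> {1..<n}" for i
      using sr(10,11)[of i] that by (simp_all add: scal)
    show "?R i * ?c j = - (?c j * ?R i)" if "i \<in> {1..<n}" "j \<in> {1..n}" for i j
      using sc[of "GenC j" "SR i"] that by simp
    show "?p i * ?c j = ?c j * ?p i" "?q i * ?c j = - (?c j * ?q i)" if "i \<in> {1..n}" "j \<in> {1..n}" for i j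
      using sc[of "GenC j" "SP i"] sc[of "GenC j" "SQ i"] that by simp_all
  qed (use mem' in simp_all)
qed

section \<open>The isomorphism\<close>

lemma (in superalgebra) part_minus: "\<lbrakk>x \<in> part A s; y \<in> part A s\<rbrakk> \<Longrightarrow> x \<ominus> y \<in> part A s"
  by (simp add: a_minus_def part_add part_uminus)

lemma (in superalgebra) part_mult': "\<lbrakk>x \<in> part A s; y \<in> part A t; s + t = u\<rbrakk> \<Longrightarrow> x \<otimes> y \<in> part A u"
  using part_mult by blast

lemma clifford_to_hc:
  "\<exists>\<iota>. superalgebra_hom (clifford n) (affine_hc n) \<iota> \<and>
    (\<forall>i\<in>{1..n}. \<iota> (clifford_c n i) = affine_hc_gen n (HC i))"
proof -
  interpret C: presentation "clifford_gens n" clifford_parity "clifford_rels n" by (rule presentation_clifford)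
  interpret H: presentation "hc_gens n" hc_parity "hc_rels n" by (rule presentation_hc)
  interpret D: superalgebra "affine_hc n" unfolding affine_hc_def by (rule H.superalgebra_Pres)
  interpret W: hc_system "factor_embed (affine_hc n) ` carrier (affine_hc n)" "unit_in (affine_hc n)"
    "scalar_in (affine_hc n) eps" "scalar_in (affine_hc n) (1/2)" n
    "\<lambda>i. factor_embed (affine_hc n) (affine_hc_gen n (HC i))" "\<lambda>i. factor_embed (affine_hc n) (affine_hc_gen n (HT i))"
    "\<lambda>i. factor_embed (affine_hc n) (affine_hc_gen n (HX i))" "\<lambda>i. factor_embed (affine_hc n) (affine_hc_gen n (HXi i))"
    using hc_system_of_hom[OF superalgebra_hom_id[OF D.superalgebra_axioms]] .
  define \<phi> where "\<phi> = (\<lambda>GenC i \<Rightarrow> affine_hc_gen n (HC i))"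
  have part: "\<phi> g \<in> part (affine_hc n) (clifford_parity g)" if "g \<in> clifford_gens n" for g
    using that H.gen_part[of "HC _"]
    by (cases g) (simp add: \<phi>_def affine_hc_gen_def affine_hc_def clifford_parity_def)
  interpret ev: free_evaluation "affine_hc n" "clifford_gens n" \<phi>
    using part D.part_carrier by unfold_locales blast
  have eval_embed_c: "factor_embed (affine_hc n) (\<phi> (GenC i)) = factor_embed (affine_hc n) (affine_hc_gen n (HC i))" for i
    by (simp add: \<phi>_def)
  have "\<forall>(l, r)\<in>clifford_rels n. ev.eval_embed l = ev.eval_embed r"
    unfolding clifford_rels_ball
  proof (intro conjI allI impI; (elim conjE)?)
    fix i j assume "i \<in> {1..n}" "j \<in> {1..n}" "i \<noteq> j"
    then show "ev.eval_embed (var (GenC i) * var (GenC j)) = ev.eval_embed (- (var (GenC j) * var (GenC i)))"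
      using W.c_anti[of i j] by (simp add: eval_embed_c)
  qed (simp add: eval_embed_c W.c_sq)
  then have "\<exists>h. superalgebra_hom C.Pres (affine_hc n) h \<and> (\<forall>g\<in>clifford_gens n. h (C.gen g) = \<phi> g)"
    by (intro C.hom_exists_emb D.superalgebra_axioms part) auto
  then obtain h where "superalgebra_hom C.Pres (affine_hc n) h" "\<And>g. g \<in> clifford_gens n \<Longrightarrow> h (C.gen g) = \<phi> g"
    by blast
  then show ?thesis by (intro exI[of _ h]) (simp add: clifford_def clifford_c_def \<phi>_def)
qed

text \<open>
  The spin relations for these images are the relations derived in \<open>hc_system\<close>.
\<close>

lemma spin_to_hc:
  "\<exists>\<psi>. superalgebra_hom (spin_affine_hecke n) (affine_hc n) \<psi> \<and>
    (\<forall>i\<in>{1..<n}. \<psi> (spin_affine_hecke_gen n (SR i)) =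
      (affine_hc_gen n (HC i) \<ominus>\<^bsub>affine_hc n\<^esub> affine_hc_gen n (HC (Suc i))) \<otimes>\<^bsub>affine_hc n\<^esub> affine_hc_gen n (HT i)
      \<oplus>\<^bsub>affine_hc n\<^esub> eps \<odot>\<^bsub>affine_hc n\<^esub> affine_hc_gen n (HC (Suc i))) \<and>
    (\<forall>i\<in>{1..n}. \<psi> (spin_affine_hecke_gen n (SP i)) =
      (1/2) \<odot>\<^bsub>affine_hc n\<^esub> (affine_hc_gen n (HX i) \<oplus>\<^bsub>affine_hc n\<^esub> affine_hc_gen n (HXi i))) \<and>
    (\<forall>i\<in>{1..n}. \<psi> (spin_affine_hecke_gen n (SQ i)) =
      (1/2) \<odot>\<^bsub>affine_hc n\<^esub> ((affine_hc_gen n (HX i) \<ominus>\<^bsub>affine_hc n\<^esub> affine_hc_gen n (HXi i))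
        \<otimes>\<^bsub>affine_hc n\<^esub> affine_hc_gen n (HC i)))"
proof -
  interpret S: presentation "spin_gens n" spin_parity "spin_rels n" by (rule presentation_spin)
  interpret H: presentation "hc_gens n" hc_parity "hc_rels n" by (rule presentation_hc)
  let ?H = "affine_hc n"
  let ?T = "\<lambda>i. affine_hc_gen n (HT i)" and ?c = "\<lambda>i. affine_hc_gen n (HC i)"
  let ?X = "\<lambda>i. affine_hc_gen n (HX i)" and ?Xi = "\<lambda>i. affine_hc_gen n (HXi i)"
  interpret D: superalgebra ?H unfolding affine_hc_def by (rule H.superalgebra_Pres)
  interpret W: hc_system "factor_embed ?H ` carrier ?H" "unit_in ?H" "scalar_in ?H eps" "scalar_in ?H (1/2)" n
    "\<lambda>i. factor_embed ?H (?c i)" "\<lambda>i. factor_embed ?H (?T i)" "\<lambda>i. factor_embed ?H (?X i)" "\<lambda>i. factor_embed ?H (?Xi i)"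
    using hc_system_of_hom[OF superalgebra_hom_id[OF D.superalgebra_axioms]] .
  have gen_part: "affine_hc_gen n g \<in> part ?H (hc_parity g)" if "g \<in> hc_gens n" for g
    using H.gen_part[OF that] by (simp add: affine_hc_gen_def affine_hc_def)
  have gen_mem [simp]: "affine_hc_gen n g \<in> carrier ?H" if "g \<in> hc_gens n" for g
    using gen_part[OF that] by (rule D.part_carrier)
  define \<phi> where "\<phi> = case_spin_gen
    (\<lambda>i. (?c i \<ominus>\<^bsub>?H\<^esub> ?c (Suc i)) \<otimes>\<^bsub>?H\<^esub> ?T i \<oplus>\<^bsub>?H\<^esub> eps \<odot>\<^bsub>?H\<^esub> ?c (Suc i))
    (\<lambda>i. (1/2) \<odot>\<^bsub>?H\<^esub> (?X i \<oplus>\<^bsub>?H\<^esub> ?Xi i)) (\<lambda>i. (1/2) \<odot>\<^bsub>?H\<^esub> ((?X i \<ominus>\<^bsub>?H\<^esub> ?Xi i) \<otimes>\<^bsub>?H\<^esub> ?c i))"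
  have parts: "?c i \<in> part ?H 1" "?X i \<in> part ?H 0" "?Xi i \<in> part ?H 0" if "i \<in> {1..n}" for i
    using that gen_part[of "HC i"] gen_part[of "HX i"] gen_part[of "HXi i"] by simp_all
  have part_T: "?T i \<in> part ?H 0" if "i \<in> {1..<n}" for i
    using that gen_part[of "HT i"] by simp
  have part: "\<phi> g \<in> part ?H (spin_parity g)" if "g \<in> spin_gens n" for g
  proof (cases g)
    case (SR i)
    then have "i \<in> {1..<n}" "i \<in> {1..n}" "Suc i \<in> {1..n}" using that by auto
    then have "\<phi> (SR i) \<in> part ?H 1"
      unfolding \<phi>_def spin_gen.case
      by (intro D.part_add D.part_smult D.part_mult'[of _ 1 _ 0] D.part_minus parts part_T) simp_all
    then show ?thesis by (simp add: SR)
  next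
    case (SP i)
    then have "\<phi> (SP i) \<in> part ?H 0"
      using that unfolding \<phi>_def spin_gen.case by (intro D.part_add D.part_smult parts) simp_all
    then show ?thesis by (simp add: SP)
  next
    case (SQ i)
    then have "\<phi> (SQ i) \<in> part ?H 1"
      using that unfolding \<phi>_def spin_gen.case
      by (intro D.part_smult D.part_mult'[of _ 0 _ 1] D.part_minus parts) simp_all
    then show ?thesis by (simp add: SQ)
  qed
  interpret ev: free_evaluation ?H "spin_gens n" \<phi>
    using part D.part_carrier by unfold_locales blast
  have R: "factor_embed ?H (\<phi> (SR i)) = W.R i" if "i \<in> {1..<n}" for i
    using that D.embed_smult[of "?c (Suc i)" eps]
    by (simp add: \<phi>_def W.R_def D.embed_add D.embed_diff D.embed_mult)
  have p: "factor_embed ?H (\<phi> (SP i)) = W.p i" and q: "factor_embed ?H (\<phi> (SQ i)) = W.q i" if "i \<in> {1..n}" for i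
    using that D.embed_smult[of "?X i \<oplus>\<^bsub>?H\<^esub> ?Xi i" "1/2"]
      D.embed_smult[of "(?X i \<ominus>\<^bsub>?H\<^esub> ?Xi i) \<otimes>\<^bsub>?H\<^esub> ?c i" "1/2"]
    by (simp_all add: \<phi>_def W.p_def W.q_def D.embed_add D.embed_diff D.embed_mult)
  have scal: "ev.eval_embed (scal k) = scalar_in ?H k" for k by (rule eval_embed_scal[OF ev.free_evaluation_axioms])
  note sq = scalar_in_squares[OF D.superalgebra_axioms]
  have "\<forall>(l, r)\<in>spin_rels n. ev.eval_embed l = ev.eval_embed r"
    unfolding spin_rels_ball
  proof (intro conjI allI impI; (elim conjE)?)
    fix i j assume "i \<in> {1..<n}" "j \<in> {1..<n}" "\<bar>int i - int j\<bar> > 1"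
    then show "ev.eval_embed (var (SR i) * var (SR j)) = ev.eval_embed (- (var (SR j) * var (SR i)))"
      using W.R_far_sym[of i j] by (simp add: R)
  next
    fix i j assume "i \<in> {1..n}" "j \<in> {1..n}"
    then show "ev.eval_embed (var (SP i) * var (SP j)) = ev.eval_embed (var (SP j) * var (SP i))"
      "ev.eval_embed (var (SP i) * var (SQ j)) = ev.eval_embed (var (SQ j) * var (SP i))"
      using W.p_p[of i j] W.p_q[of i j] by (simp_all add: p q)
  next
    fix i j assume "i \<in> {1..n}" "j \<in> {1..n}" "i \<noteq> j"
    then show "ev.eval_embed (var (SQ i) * var (SQ j)) = ev.eval_embed (- (var (SQ j) * var (SQ i)))"
      using W.q_q[of i j] by (simp add: q)
  next
    fix i assume "i \<in> {1..<n}" "i + 1 \<in> {1..<n}"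
    then show "ev.eval_embed (var (SR i) * var (SR (i+1)) * var (SR i) - var (SR (i+1)) * var (SR i) * var (SR (i+1))) =
        ev.eval_embed (scal (eps^2) * (var (SR (i+1)) - var (SR i)))"
      using W.R_braid[of i] by (simp add: R scal sq)
  qed (simp_all add: R p q scal sq W.R_sq W.p_sq_q_sq W.R_p_far W.R_q_far W.R_p W.R_q)
  then have "\<exists>h. superalgebra_hom S.Pres ?H h \<and> (\<forall>g\<in>spin_gens n. h (S.gen g) = \<phi> g)"
    by (intro S.hom_exists_emb D.superalgebra_axioms part) auto
  then obtain h where "superalgebra_hom S.Pres ?H h" "\<And>g. g \<in> spin_gens n \<Longrightarrow> h (S.gen g) = \<phi> g"
    by blast
  then show ?thesis
    by (intro exI[of _ h]) (simp add: spin_affine_hecke_def spin_affine_hecke_gen_def \<phi>_def)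
qed

text \<open>
  The Hecke-Clifford relations for these images are the relations derived in
  \<open>clifford_spin_system\<close>.
\<close>

lemma hc_to_tensor:
  fixes n :: nat
  defines "C \<equiv> clifford n" and "S \<equiv> spin_affine_hecke n" and "H \<equiv> affine_hc n"
  defines "B \<equiv> super_tensor C S"
  defines "c \<equiv> \<lambda>i. pure_tensor C S (clifford_c n i) \<one>\<^bsub>S\<^esub>"
    and "R \<equiv> \<lambda>i. pure_tensor C S \<one>\<^bsub>C\<^esub> (spin_affine_hecke_gen n (SR i))"
    and "p \<equiv> \<lambda>i. pure_tensor C S \<one>\<^bsub>C\<^esub> (spin_affine_hecke_gen n (SP i))"
    and "q \<equiv> \<lambda>i. pure_tensor C S \<one>\<^bsub>C\<^esub> (spin_affine_hecke_gen n (SQ i))"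
  shows "\<exists>\<Phi>. superalgebra_hom H B \<Phi> \<and>
    (\<forall>i\<in>{1..n}. \<Phi> (affine_hc_gen n (HC i)) = c i) \<and>
    (\<forall>i\<in>{1..<n}. \<Phi> (affine_hc_gen n (HT i)) =
      (- (1/2)) \<odot>\<^bsub>B\<^esub> (R i \<otimes>\<^bsub>B\<^esub> (c i \<ominus>\<^bsub>B\<^esub> c (Suc i))) \<oplus>\<^bsub>B\<^esub>
      (eps/2) \<odot>\<^bsub>B\<^esub> (\<one>\<^bsub>B\<^esub> \<ominus>\<^bsub>B\<^esub> c i \<otimes>\<^bsub>B\<^esub> c (Suc i))) \<and>
    (\<forall>i\<in>{1..n}. \<Phi> (affine_hc_gen n (HX i)) = p i \<ominus>\<^bsub>B\<^esub> c i \<otimes>\<^bsub>B\<^esub> q i) \<and>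
    (\<forall>i\<in>{1..n}. \<Phi> (affine_hc_gen n (HXi i)) = p i \<oplus>\<^bsub>B\<^esub> c i \<otimes>\<^bsub>B\<^esub> q i)"
proof -
  interpret C: presentation "clifford_gens n" clifford_parity "clifford_rels n" by (rule presentation_clifford)
  interpret S: presentation "spin_gens n" spin_parity "spin_rels n" by (rule presentation_spin)
  interpret H: presentation "hc_gens n" hc_parity "hc_rels n" by (rule presentation_hc)
  interpret CS: superalgebra_pair C S
    using C.superalgebra_Pres S.superalgebra_Pres
    by (simp add: superalgebra_pair_def C_def S_def clifford_def spin_affine_hecke_def)
  interpret D: superalgebra B unfolding B_def by (rule CS.superalgebra_Ten)
  have super: "D.supercommute s t (CS.inr b) (CS.inl a)" if "a \<in> part C t" "b \<in> part S s" for a b s t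
    using CS.inr_inl[OF that] unfolding D.supercommute_def unfolding B_def .
  interpret W: clifford_spin_system "factor_embed B ` carrier B" "unit_in B" "scalar_in B eps" "scalar_in B (1/2)" n
    "\<lambda>i. factor_embed B (c i)" "\<lambda>i. factor_embed B (R i)" "\<lambda>i. factor_embed B (p i)" "\<lambda>i. factor_embed B (q i)"
    unfolding c_def R_def p_def q_def
    using CS.inl_hom CS.inr_hom super
    by (intro clifford_spin_system_of_homs) (simp_all add: B_def C_def S_def)
  have parts: "c i \<in> part B 1" "p i \<in> part B 0" "q i \<in> part B 1" if "i \<in> {1..n}" for i
    using that C.gen_part[of "GenC i"] S.gen_part[of "SP i"] S.gen_part[of "SQ i"]
      CS.pure_part[OF _ CS.B.one_part, of "clifford_c n i" 1]
      CS.pure_part[OF CS.A.one_part, of "spin_affine_hecke_gen n (SP i)" 0]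
      CS.pure_part[OF CS.A.one_part, of "spin_affine_hecke_gen n (SQ i)" 1]
    by (simp_all add: B_def C_def S_def c_def p_def q_def clifford_c_def clifford_def clifford_parity_def
        spin_affine_hecke_def spin_affine_hecke_gen_def)
  have part_R: "R i \<in> part B 1" if "i \<in> {1..<n}" for i
    using that S.gen_part[of "SR i"] CS.pure_part[OF CS.A.one_part, of "spin_affine_hecke_gen n (SR i)" 1]
    by (simp add: B_def C_def S_def R_def spin_affine_hecke_def spin_affine_hecke_gen_def)
  have mem [simp]: "i \<in> {1..n} \<Longrightarrow> c i \<in> carrier B" "i \<in> {1..n} \<Longrightarrow> p i \<in> carrier B"
    "i \<in> {1..n} \<Longrightarrow> q i \<in> carrier B" "i \<in> {1..<n} \<Longrightarrow> R i \<in> carrier B" for i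
    using parts part_R D.part_carrier by blast+
  define \<phi> where "\<phi> = case_hc_gen
    (\<lambda>i. (- (1/2)) \<odot>\<^bsub>B\<^esub> (R i \<otimes>\<^bsub>B\<^esub> (c i \<ominus>\<^bsub>B\<^esub> c (Suc i))) \<oplus>\<^bsub>B\<^esub>
      (eps/2) \<odot>\<^bsub>B\<^esub> (\<one>\<^bsub>B\<^esub> \<ominus>\<^bsub>B\<^esub> c i \<otimes>\<^bsub>B\<^esub> c (Suc i)))
    c (\<lambda>i. p i \<ominus>\<^bsub>B\<^esub> c i \<otimes>\<^bsub>B\<^esub> q i) (\<lambda>i. p i \<oplus>\<^bsub>B\<^esub> c i \<otimes>\<^bsub>B\<^esub> q i)"
  have part: "\<phi> g \<in> part B (hc_parity g)" if "g \<in> hc_gens n" for g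
  proof (cases g)
    case (HT i)
    then have "i \<in> {1..<n}" "i \<in> {1..n}" "Suc i \<in> {1..n}" using that by auto
    then have "\<phi> (HT i) \<in> part B 0"
      unfolding \<phi>_def hc_gen.case
      by (intro D.part_add D.part_smult D.part_mult'[of _ 1 _ 1] D.part_minus D.one_part parts part_R) simp_all
    then show ?thesis by (simp add: HT)
  next
    case (HC i)
    then show ?thesis using that parts by (simp add: \<phi>_def)
  next
    case (HX i)
    then have "\<phi> (HX i) \<in> part B 0"
      using that unfolding \<phi>_def hc_gen.case
      by (intro D.part_minus D.part_mult'[of _ 1 _ 1] parts) simp_all
    then show ?thesis by (simp add: HX)
  next
    case (HXi i)
    then have "\<phi> (HXi i) \<in> part B 0"
      using that unfolding \<phi>_def hc_gen.case
      by (intro D.part_add D.part_mult'[of _ 1 _ 1] parts) simp_all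
    then show ?thesis by (simp add: HXi)
  qed
  interpret ev: free_evaluation B "hc_gens n" \<phi>
    using part D.part_carrier by unfold_locales blast
  note half = scalar_in_halves[OF D.superalgebra_axioms]
  have T: "factor_embed B (\<phi> (HT i)) = W.T i" if "i \<in> {1..<n}" for i
    using that D.embed_smult[of "R i \<otimes>\<^bsub>B\<^esub> (c i \<ominus>\<^bsub>B\<^esub> c (Suc i))" "- (1/2)"]
      D.embed_smult[of "\<one>\<^bsub>B\<^esub> \<ominus>\<^bsub>B\<^esub> c i \<otimes>\<^bsub>B\<^esub> c (Suc i)" "eps/2"]
    by (simp add: \<phi>_def W.T_def W.S_def D.embed_add D.embed_diff D.embed_mult half distrib_left right_diff_distrib mult.assoc)
  have cc: "factor_embed B (\<phi> (HC i)) = factor_embed B (c i)" for i by (simp add: \<phi>_def)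
  have X: "factor_embed B (\<phi> (HX i)) = W.X i" "factor_embed B (\<phi> (HXi i)) = W.Xi i" if "i \<in> {1..n}" for i
    using that by (simp_all add: \<phi>_def W.X_def W.Xi_def D.embed_add D.embed_diff D.embed_mult)
  have scal: "ev.eval_embed (scal k) = scalar_in B k" for k by (rule eval_embed_scal[OF ev.free_evaluation_axioms])
  have T_mem: "W.T i \<in> factor_embed B ` carrier B" if "i \<in> {1..<n}" for i
    using ev.\<phi>_carrier[of "HT i"] that by (auto simp flip: T)
  have T_quadratic: "(W.T i - scalar_in B qpar) * (W.T i + scalar_in B (inverse qpar)) = 0"
    if i: "i \<in> {1..<n}" for i
  proof -
    have "W.T i * scalar_in B (inverse qpar) = scalar_in B (inverse qpar) * W.T i"
      using T_mem[OF i] qpar_scalars(3)[OF D.superalgebra_axioms] by auto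
    then show ?thesis
      using W.T_sq[OF i] unfolding qpar_scalars(2)[OF D.superalgebra_axioms]
      by (simp add: left_diff_distrib distrib_left qpar_scalars(1)[OF D.superalgebra_axioms])
  qed
  have "\<forall>(l, r)\<in>hc_rels n. ev.eval_embed l = ev.eval_embed r"
    unfolding hc_rels_ball
  proof (intro conjI allI impI; (elim conjE)?)
    fix i j assume "i \<in> {1..<n}" "j \<in> {1..<n}" "\<bar>int i - int j\<bar> > 1"
    then show "ev.eval_embed (var (HT i) * var (HT j)) = ev.eval_embed (var (HT j) * var (HT i))"
      using W.T_far_sym[of i j] by (simp add: T)
  next
    fix i j assume "i \<in> {1..n}" "j \<in> {1..n}" "i \<noteq> j"
    then show "ev.eval_embed (var (HC i) * var (HC j)) = ev.eval_embed (- (var (HC j) * var (HC i)))"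
      using W.c_anti[of i j] by (simp add: cc)
  next
    fix i j assume "i \<in> {1..n}" "j \<in> {1..n}"
    then show "ev.eval_embed (var (HX i) * var (HX j)) = ev.eval_embed (var (HX j) * var (HX i))"
      using W.X_comm[of i j] by (simp add: X)
  next
    fix i assume "i \<in> {1..<n}"
    then show "ev.eval_embed ((var (HT i) + scal eps * var (HC i) * var (HC (i+1))) * var (HX i) * var (HT i)) =
        ev.eval_embed (var (HX (i+1)))"
      using W.T_X_T[of i] by (simp add: T X cc scal)
  next
    fix i assume "i \<in> {1..<n}" "i + 1 \<in> {1..<n}"
    then show "ev.eval_embed (var (HT i) * var (HT (i+1)) * var (HT i)) = ev.eval_embed (var (HT (i+1)) * var (HT i) * var (HT (i+1)))"
      using W.T_braid[of i] by (simp add: T mult.assoc)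
  qed (simp_all add: T X cc scal T_quadratic W.T_c W.T_c_far W.c_sq W.X_Xi W.T_X_far W.X_c W.X_c_far)
  then have "\<exists>h. superalgebra_hom H.Pres B h \<and> (\<forall>g\<in>hc_gens n. h (H.gen g) = \<phi> g)"
    by (intro H.hom_exists_emb D.superalgebra_axioms part) auto
  then obtain h where "superalgebra_hom H.Pres B h" "\<And>g. g \<in> hc_gens n \<Longrightarrow> h (H.gen g) = \<phi> g"
    by blast
  then show ?thesis
    by (intro exI[of _ h]) (simp add: H_def affine_hc_def affine_hc_gen_def \<phi>_def)
qed

theorem theorem5p1:
  fixes n :: nat
  assumes "n \<ge> 1"
  shows
    "let C = clifford n; S = spin_affine_hecke n; H = affine_hc n; B = super_tensor C S;
         T = (\<lambda>i. affine_hc_gen n (HT i)); c = (\<lambda>i. affine_hc_gen n (HC i));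
         X = (\<lambda>i. affine_hc_gen n (HX i)); Xi = (\<lambda>i. affine_hc_gen n (HXi i));
         inC = (\<lambda>a. pure_tensor C S a \<one>\<^bsub>S\<^esub>); inS = pure_tensor C S \<one>\<^bsub>C\<^esub>;
         c' = (\<lambda>i. inC (clifford_c n i));
         R = (\<lambda>i. inS (spin_affine_hecke_gen n (SR i)));
         p = (\<lambda>i. inS (spin_affine_hecke_gen n (SP i)));
         q = (\<lambda>i. inS (spin_affine_hecke_gen n (SQ i)))
     in
     \<exists>\<iota> \<Phi> \<Psi>.
       superalgebra_hom C H \<iota> \<and>
       (\<forall>i\<in>{1..n}. \<iota> (clifford_c n i) = c i) \<and>
       superalgebra_iso H B \<Phi> \<and>
       (\<forall>a\<in>carrier C. \<Phi> (\<iota> a) = inC a) \<and>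
       (\<forall>i\<in>{1..n-1}. \<Phi> (T i) =
          (- (1/2)) \<odot>\<^bsub>B\<^esub> (R i \<otimes>\<^bsub>B\<^esub> (c' i \<ominus>\<^bsub>B\<^esub> c' (i+1))) \<oplus>\<^bsub>B\<^esub>
          (eps/2) \<odot>\<^bsub>B\<^esub> (\<one>\<^bsub>B\<^esub> \<ominus>\<^bsub>B\<^esub> c' i \<otimes>\<^bsub>B\<^esub> c' (i+1))) \<and>
       (\<forall>i\<in>{1..n}. \<Phi> (X i) = p i \<ominus>\<^bsub>B\<^esub> c' i \<otimes>\<^bsub>B\<^esub> q i) \<and>
       (\<forall>i\<in>{1..n}. \<Phi> (Xi i) = p i \<oplus>\<^bsub>B\<^esub> c' i \<otimes>\<^bsub>B\<^esub> q i) \<and>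
       superalgebra_iso B H \<Psi> \<and>
       (\<forall>x\<in>carrier H. \<Psi> (\<Phi> x) = x) \<and>
       (\<forall>y\<in>carrier B. \<Phi> (\<Psi> y) = y) \<and>
       (\<forall>a\<in>carrier C. \<Psi> (inC a) = \<iota> a) \<and>
       (\<forall>i\<in>{1..n-1}. \<Psi> (R i) =
          (c i \<ominus>\<^bsub>H\<^esub> c (i+1)) \<otimes>\<^bsub>H\<^esub> T i \<oplus>\<^bsub>H\<^esub> eps \<odot>\<^bsub>H\<^esub> c (i+1)) \<and>
       (\<forall>i\<in>{1..n}. \<Psi> (p i) = (1/2) \<odot>\<^bsub>H\<^esub> (X i \<oplus>\<^bsub>H\<^esub> Xi i)) \<and>
       (\<forall>i\<in>{1..n}. \<Psi> (q i) = (1/2) \<odot>\<^bsub>H\<^esub> ((X i \<ominus>\<^bsub>H\<^esub> Xi i) \<otimes>\<^bsub>H\<^esub> c i))"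
proof -
  let ?C = "clifford n" and ?S = "spin_affine_hecke n" and ?H = "affine_hc n"
  let ?B = "super_tensor ?C ?S"
  let ?T = "\<lambda>i. affine_hc_gen n (HT i)" and ?c = "\<lambda>i. affine_hc_gen n (HC i)"
  let ?X = "\<lambda>i. affine_hc_gen n (HX i)" and ?Xi = "\<lambda>i. affine_hc_gen n (HXi i)"
  let ?inC = "\<lambda>a. pure_tensor ?C ?S a \<one>\<^bsub>?S\<^esub>" and ?inS = "\<lambda>b. pure_tensor ?C ?S \<one>\<^bsub>?C\<^esub> b"
  let ?c' = "\<lambda>i. ?inC (clifford_c n i)"
  let ?R = "\<lambda>i. ?inS (spin_affine_hecke_gen n (SR i))"
  let ?p = "\<lambda>i. ?inS (spin_affine_hecke_gen n (SP i))"
  let ?q = "\<lambda>i. ?inS (spin_affine_hecke_gen n (SQ i))"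
  interpret C: presentation "clifford_gens n" clifford_parity "clifford_rels n" by (rule presentation_clifford)
  interpret S: presentation "spin_gens n" spin_parity "spin_rels n" by (rule presentation_spin)
  interpret H: presentation "hc_gens n" hc_parity "hc_rels n" by (rule presentation_hc)
  have pres: "C.Pres = ?C" "S.Pres = ?S" "H.Pres = ?H"
    by (simp_all add: clifford_def spin_affine_hecke_def affine_hc_def)
  have gens: "C.gen (GenC i) = clifford_c n i" "S.gen b = spin_affine_hecke_gen n b" "H.gen a = affine_hc_gen n a" for i a b
    by (simp_all add: clifford_c_def spin_affine_hecke_gen_def affine_hc_gen_def)
  interpret CS: superalgebra_pair ?C ?S
    using C.superalgebra_Pres S.superalgebra_Pres unfolding pres superalgebra_pair_def by blast
  interpret A: superalgebra ?H using H.superalgebra_Pres unfolding pres .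
  obtain \<iota> where \<iota>: "superalgebra_hom ?C ?H \<iota>" "\<And>i. i \<in> {1..n} \<Longrightarrow> \<iota> (clifford_c n i) = ?c i"
    using clifford_to_hc[of n] by blast
  obtain \<psi> where \<psi>: "superalgebra_hom ?S ?H \<psi>"
    "\<And>i. i \<in> {1..<n} \<Longrightarrow> \<psi> (spin_affine_hecke_gen n (SR i)) =
      (?c i \<ominus>\<^bsub>?H\<^esub> ?c (Suc i)) \<otimes>\<^bsub>?H\<^esub> ?T i \<oplus>\<^bsub>?H\<^esub> eps \<odot>\<^bsub>?H\<^esub> ?c (Suc i)"
    "\<And>i. i \<in> {1..n} \<Longrightarrow> \<psi> (spin_affine_hecke_gen n (SP i)) = (1/2) \<odot>\<^bsub>?H\<^esub> (?X i \<oplus>\<^bsub>?H\<^esub> ?Xi i)"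
    "\<And>i. i \<in> {1..n} \<Longrightarrow> \<psi> (spin_affine_hecke_gen n (SQ i)) =
      (1/2) \<odot>\<^bsub>?H\<^esub> ((?X i \<ominus>\<^bsub>?H\<^esub> ?Xi i) \<otimes>\<^bsub>?H\<^esub> ?c i)"
    using spin_to_hc[of n] by blast
  obtain \<Phi> where \<Phi>: "superalgebra_hom ?H ?B \<Phi>" "\<And>i. i \<in> {1..n} \<Longrightarrow> \<Phi> (?c i) = ?c' i"
    "\<And>i. i \<in> {1..<n} \<Longrightarrow> \<Phi> (?T i) =
      (- (1/2)) \<odot>\<^bsub>?B\<^esub> (?R i \<otimes>\<^bsub>?B\<^esub> (?c' i \<ominus>\<^bsub>?B\<^esub> ?c' (Suc i))) \<oplus>\<^bsub>?B\<^esub>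
      (eps/2) \<odot>\<^bsub>?B\<^esub> (\<one>\<^bsub>?B\<^esub> \<ominus>\<^bsub>?B\<^esub> ?c' i \<otimes>\<^bsub>?B\<^esub> ?c' (Suc i))"
    "\<And>i. i \<in> {1..n} \<Longrightarrow> \<Phi> (?X i) = ?p i \<ominus>\<^bsub>?B\<^esub> ?c' i \<otimes>\<^bsub>?B\<^esub> ?q i"
    "\<And>i. i \<in> {1..n} \<Longrightarrow> \<Phi> (?Xi i) = ?p i \<oplus>\<^bsub>?B\<^esub> ?c' i \<otimes>\<^bsub>?B\<^esub> ?q i"
    using hc_to_tensor[of n] by blast
  interpret i: superalgebra_hom ?C ?H \<iota> by (rule \<iota>)
  interpret psi: superalgebra_hom ?S ?H \<psi> by (rule \<psi>)
  interpret Phi: superalgebra_hom ?H ?B \<Phi> by (rule \<Phi>)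
  interpret inl: superalgebra_hom ?C ?B ?inC by (rule CS.inl_hom)
  interpret inr: superalgebra_hom ?S ?B ?inS by (rule CS.inr_hom)
  have Hmem [simp]: "affine_hc_gen n g \<in> carrier ?H" if "g \<in> hc_gens n" for g
    using H.gen_carrier[OF that] unfolding pres gens .
  have Smem [simp]: "spin_affine_hecke_gen n g \<in> carrier ?S" if "g \<in> spin_gens n" for g
    using S.gen_carrier[OF that] unfolding pres gens .
  have Cmem [simp]: "clifford_c n i \<in> carrier ?C" if "i \<in> {1..n}" for i
    using C.gen_carrier[of "GenC i"] that unfolding pres gens by simp

  interpret W: hc_system "factor_embed ?H ` carrier ?H" "unit_in ?H" "scalar_in ?H eps" "scalar_in ?H (1/2)" n
    "\<lambda>i. factor_embed ?H (?c i)" "\<lambda>i. factor_embed ?H (?T i)" "\<lambda>i. factor_embed ?H (?X i)" "\<lambda>i. factor_embed ?H (?Xi i)"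
    using hc_system_of_hom[OF superalgebra_hom_id[OF A.superalgebra_axioms]] .
  have \<psi>W: "factor_embed ?H (\<psi> (spin_affine_hecke_gen n (SR i))) = W.R i" if "i \<in> {1..<n}" for i
    using that A.embed_smult[of "?c (Suc i)" eps]
    by (simp add: \<psi> W.R_def A.embed_add A.embed_diff A.embed_mult)
  have \<psi>W': "factor_embed ?H (\<psi> (spin_affine_hecke_gen n (SP i))) = W.p i"
    "factor_embed ?H (\<psi> (spin_affine_hecke_gen n (SQ i))) = W.q i" if "i \<in> {1..n}" for i
    using that A.embed_smult[of "?X i \<oplus>\<^bsub>?H\<^esub> ?Xi i" "1/2"]
      A.embed_smult[of "(?X i \<ominus>\<^bsub>?H\<^esub> ?Xi i) \<otimes>\<^bsub>?H\<^esub> ?c i" "1/2"]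
    by (simp_all add: \<psi> W.p_def W.q_def A.embed_add A.embed_diff A.embed_mult)

  \<comment> \<open>This is what the universal property of the tensor product asks for.\<close>
  have super_gens: "A.supercommute (spin_parity b) (clifford_parity a)
      (\<psi> (spin_affine_hecke_gen n b)) (\<iota> (C.gen a))"
    if ab: "a \<in> clifford_gens n" "b \<in> spin_gens n" for a b
  proof -
    obtain j where a: "a = GenC j" "j \<in> {1..n}" using ab(1) by (cases a) simp
    have mem: "\<psi> (spin_affine_hecke_gen n b) \<in> carrier ?H" "?c j \<in> carrier ?H"
      using ab(2) a(2) psi.hom_carrier by simp_all
    have "factor_embed ?H (\<psi> (spin_affine_hecke_gen n b) \<otimes>\<^bsub>?H\<^esub> ?c j) =
        factor_embed ?H (koszul_sign (spin_parity b) 1 \<odot>\<^bsub>?H\<^esub> (?c j \<otimes>\<^bsub>?H\<^esub> \<psi> (spin_affine_hecke_gen n b)))"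
      using ab(2) a(2) mem
      by (cases b) (simp_all add: koszul_sign_def A.smult_neg_1 A.embed_uminus A.embed_mult \<psi>W \<psi>W'
          W.R_c W.p_c W.q_c)
    then show ?thesis
      using mem a(2) by (simp add: A.supercommute_def A.embed_eq_iff a(1) gens \<iota>(2) clifford_parity_def)
  qed
  have super: "\<psi> b \<otimes>\<^bsub>?H\<^esub> \<iota> a = koszul_sign s t \<odot>\<^bsub>?H\<^esub> (\<iota> a \<otimes>\<^bsub>?H\<^esub> \<psi> b)"
    if "a \<in> part ?C t" "b \<in> part ?S s" for a b s t
    unfolding A.supercommute_def[symmetric]
    by (rule supercommute_generators[OF presentation_clifford presentation_spin, of n ?H \<iota> n \<psi> a t b s,
          unfolded pres gens, OF \<iota>(1) \<psi>(1) super_gens that])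
  obtain \<Psi> where \<Psi>: "superalgebra_hom ?B ?H \<Psi>" "\<And>a. a \<in> carrier ?C \<Longrightarrow> \<Psi> (?inC a) = \<iota> a"
    "\<And>b. b \<in> carrier ?S \<Longrightarrow> \<Psi> (?inS b) = \<psi> b"
    using CS.tensor_hom_exists[OF \<iota>(1) \<psi>(1) super] by blast
  interpret Psi: superalgebra_hom ?B ?H \<Psi> by (rule \<Psi>)

  have \<Phi>\<iota>: "\<Phi> (\<iota> a) = ?inC a" if "a \<in> carrier ?C" for a
  proof (rule C.hom_unique[where h = "\<lambda>a. \<Phi> (\<iota> a)" and h' = "\<lambda>a. ?inC a" and D = ?B], unfold pres)
    show "\<Phi> (\<iota> (C.gen g)) = ?inC (C.gen g)" if "g \<in> clifford_gens n" for g
      using that by (cases g) (simp add: gens \<iota>(2) \<Phi>(2))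
  qed (use that superalgebra_hom_comp[OF \<iota>(1) \<Phi>(1)] CS.inl_hom in auto)

  interpret V: clifford_spin_system "factor_embed ?B ` carrier ?B" "unit_in ?B" "scalar_in ?B eps" "scalar_in ?B (1/2)" n
    "\<lambda>i. factor_embed ?B (?c' i)" "\<lambda>i. factor_embed ?B (?R i)" "\<lambda>i. factor_embed ?B (?p i)" "\<lambda>i. factor_embed ?B (?q i)"
    using CS.inl_hom CS.inr_hom CS.inr_inl
    by (intro clifford_spin_system_of_homs) (simp_all add: CS.T.supercommute_def)
  have Bmem [simp]: "i \<in> {1..n} \<Longrightarrow> ?c' i \<in> carrier ?B" "g \<in> spin_gens n \<Longrightarrow> ?inS (spin_affine_hecke_gen n g) \<in> carrier ?B" for i g
    using inl.hom_carrier inr.hom_carrier by simp_all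
  note half = scalar_in_halves[OF CS.superalgebra_Ten]
  have \<Phi>V: "factor_embed ?B (\<Phi> (?T i)) = V.T i" if "i \<in> {1..<n}" for i
    using that CS.T.embed_smult[of "?R i \<otimes>\<^bsub>?B\<^esub> (?c' i \<ominus>\<^bsub>?B\<^esub> ?c' (Suc i))" "- (1/2)"]
      CS.T.embed_smult[of "\<one>\<^bsub>?B\<^esub> \<ominus>\<^bsub>?B\<^esub> ?c' i \<otimes>\<^bsub>?B\<^esub> ?c' (Suc i)" "eps/2"]
    by (simp add: \<Phi> V.T_def V.S_def CS.T.embed_add CS.T.embed_diff CS.T.embed_mult half distrib_left right_diff_distrib mult.assoc)
  have \<Phi>V': "factor_embed ?B (\<Phi> (?X i)) = V.X i" "factor_embed ?B (\<Phi> (?Xi i)) = V.Xi i" if "i \<in> {1..n}" for i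
    using that by (simp_all add: \<Phi> V.X_def V.Xi_def CS.T.embed_add CS.T.embed_diff CS.T.embed_mult)

  \<comment> \<open>Both sides are homomorphisms, so they are compared on generators, where the equation
    becomes an identity in the corner.\<close>
  have \<Phi>\<psi>: "\<Phi> (\<psi> b) = ?inS b" if "b \<in> carrier ?S" for b
  proof (rule S.hom_unique[where h = "\<lambda>b. \<Phi> (\<psi> b)" and h' = "\<lambda>b. ?inS b" and D = ?B], unfold pres)
    fix g assume g: "g \<in> spin_gens n"
    have mem: "\<Phi> (\<psi> (S.gen g)) \<in> carrier ?B" "?inS (S.gen g) \<in> carrier ?B"
      using g Phi.hom_carrier psi.hom_carrier by (simp_all add: gens)
    have "factor_embed ?B (\<Phi> (\<psi> (S.gen g))) = factor_embed ?B (?inS (S.gen g))"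
    proof (cases g)
      case (SR i)
      then have i: "i \<in> {1..<n}" using g by simp
      have "factor_embed ?B (eps \<odot>\<^bsub>?B\<^esub> ?c' (Suc i)) = scalar_in ?B eps * factor_embed ?B (?c' (Suc i))"
        using i by (intro CS.T.embed_smult) simp
      then show ?thesis using i V.R_recover[OF i] Phi.hom_carrier
        by (simp add: SR gens \<psi>(2) Phi.hom_add Phi.hom_mult Phi.hom_diff Phi.hom_smult \<Phi>(2)
            CS.T.embed_add CS.T.embed_mult CS.T.embed_diff \<Phi>V)
    next
      case (SP i)
      then have i: "i \<in> {1..n}" using g by simp
      have "factor_embed ?B ((1/2) \<odot>\<^bsub>?B\<^esub> \<Phi> (?X i \<oplus>\<^bsub>?H\<^esub> ?Xi i)) = scalar_in ?B (1/2) * factor_embed ?B (\<Phi> (?X i \<oplus>\<^bsub>?H\<^esub> ?Xi i))"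
        using i Phi.hom_carrier by (intro CS.T.embed_smult) simp
      also have "\<dots> = factor_embed ?B (?p i)"
        using i V.p_recover[OF i] Phi.hom_carrier by (simp add: Phi.hom_add CS.T.embed_add \<Phi>V')
      finally show ?thesis using i by (simp add: SP gens \<psi>(3) Phi.hom_smult)
    next
      case (SQ i)
      then have i: "i \<in> {1..n}" using g by simp
      let ?y = "(?X i \<ominus>\<^bsub>?H\<^esub> ?Xi i) \<otimes>\<^bsub>?H\<^esub> ?c i"
      have "factor_embed ?B ((1/2) \<odot>\<^bsub>?B\<^esub> \<Phi> ?y) = scalar_in ?B (1/2) * factor_embed ?B (\<Phi> ?y)"
        using i Phi.hom_carrier by (intro CS.T.embed_smult) simp
      also have "\<dots> = factor_embed ?B (?q i)"
        using i V.q_recover[OF i] Phi.hom_carrier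
        by (simp add: Phi.hom_diff Phi.hom_mult CS.T.embed_diff CS.T.embed_mult \<Phi>V' \<Phi>(2))
      finally show ?thesis using i by (simp add: SQ gens \<psi>(4) Phi.hom_smult)
    qed
    then show "\<Phi> (\<psi> (S.gen g)) = ?inS (S.gen g)" using mem by (simp add: CS.T.embed_eq_iff)
  qed (use that superalgebra_hom_comp[OF \<psi>(1) \<Phi>(1)] CS.inr_hom in auto)

  have \<Phi>\<Psi>: "\<Phi> (\<Psi> y) = y" if "y \<in> carrier ?B" for y
    by (rule CS.tensor_hom_unique[OF superalgebra_hom_comp[OF \<Psi>(1) \<Phi>(1)]
          superalgebra_hom_id[OF CS.T.superalgebra_axioms] _ _ that])
      (simp_all add: \<Psi> \<Phi>\<iota> \<Phi>\<psi>)

  have \<Psi>gens: "\<Psi> (?c' i) = ?c i" if "i \<in> {1..n}" for i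
    using that by (simp add: \<Psi>(2) \<iota>(2))
  have \<Psi>\<Phi>: "\<Psi> (\<Phi> x) = x" if "x \<in> carrier ?H" for x
  proof (rule H.hom_unique[where h = "\<lambda>x. \<Psi> (\<Phi> x)" and h' = "\<lambda>x. x" and D = ?H], unfold pres)
    fix g assume g: "g \<in> hc_gens n"
    have mem: "\<Psi> (\<Phi> (H.gen g)) \<in> carrier ?H" "H.gen g \<in> carrier ?H"
      using g Phi.hom_carrier Psi.hom_carrier by (simp_all add: gens)
    have "factor_embed ?H (\<Psi> (\<Phi> (H.gen g))) = factor_embed ?H (H.gen g)"
    proof (cases g)
      case (HT i)
      then have i: "i \<in> {1..<n}" "i \<in> {1..n}" "Suc i \<in> {1..n}" using g by auto
      let ?u = "?R i \<otimes>\<^bsub>?B\<^esub> (?c' i \<ominus>\<^bsub>?B\<^esub> ?c' (Suc i))"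
      let ?v = "\<one>\<^bsub>?B\<^esub> \<ominus>\<^bsub>?B\<^esub> ?c' i \<otimes>\<^bsub>?B\<^esub> ?c' (Suc i)"
      have uv: "?u \<in> carrier ?B" "?v \<in> carrier ?B" using i by simp_all
      note half' = scalar_in_halves[OF A.superalgebra_axioms]
      have u: "factor_embed ?H (\<Psi> ?u) = W.R i * (factor_embed ?H (?c i) - factor_embed ?H (?c (Suc i)))"
        using i psi.hom_carrier by (simp add: Psi.hom_mult Psi.hom_diff \<Psi>gens \<Psi>(3) A.embed_mult A.embed_diff \<psi>W)
      have v: "factor_embed ?H (\<Psi> ?v) = unit_in ?H - factor_embed ?H (?c i) * factor_embed ?H (?c (Suc i))"
        using i by (simp add: Psi.hom_mult Psi.hom_diff Psi.hom_one \<Psi>gens A.embed_mult A.embed_diff)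
      have "factor_embed ?H (\<Psi> (\<Phi> (?T i))) = scalar_in ?H (- (1/2)) * factor_embed ?H (\<Psi> ?u) + scalar_in ?H (eps/2) * factor_embed ?H (\<Psi> ?v)"
        using i uv Psi.hom_carrier A.embed_smult[of "\<Psi> ?u" "- (1/2)"] A.embed_smult[of "\<Psi> ?v" "eps/2"]
        by (simp add: \<Phi>(3) Psi.hom_add Psi.hom_smult A.embed_add)
      also have "\<dots> = factor_embed ?H (?T i)"
        using W.T_recover[OF i(1)] by (simp add: u v half' mult.assoc)
      finally show ?thesis by (simp add: HT gens)
    next
      case (HC i)
      then show ?thesis using g by (simp add: gens \<Phi>(2) \<Psi>gens)
    next
      case (HX i)
      then have i: "i \<in> {1..n}" using g by simp
      then show ?thesis using W.X_recover(1)[OF i] psi.hom_carrier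
        by (simp add: HX gens \<Phi>(4) Psi.hom_diff Psi.hom_mult \<Psi>gens \<Psi>(3) A.embed_diff A.embed_mult \<psi>W')
    next
      case (HXi i)
      then have i: "i \<in> {1..n}" using g by simp
      then show ?thesis using W.X_recover(2)[OF i] psi.hom_carrier
        by (simp add: HXi gens \<Phi>(5) Psi.hom_add Psi.hom_mult \<Psi>gens \<Psi>(3) A.embed_add A.embed_mult \<psi>W')
    qed
    then show "\<Psi> (\<Phi> (H.gen g)) = H.gen g" using mem by (simp add: A.embed_eq_iff)
  qed (use that superalgebra_hom_comp[OF \<Phi>(1) \<Psi>(1)] superalgebra_hom_id[OF A.superalgebra_axioms] in auto)

  have iso: "superalgebra_iso ?H ?B \<Phi>" "superalgebra_iso ?B ?H \<Psi>"
    using superalgebra_isoI[OF \<Phi>(1) \<Psi>(1)] superalgebra_isoI[OF \<Psi>(1) \<Phi>(1)] \<Phi>\<Psi> \<Psi>\<Phi> by blast+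
  have range: "{1..n-1} = {1..<n}" using assms by auto
  show ?thesis
    unfolding Let_def range
  proof (intro exI[of _ \<iota>] exI[of _ \<Phi>] exI[of _ \<Psi>] conjI ballI)
    show "superalgebra_hom ?C ?H \<iota>" "superalgebra_iso ?H ?B \<Phi>" "superalgebra_iso ?B ?H \<Psi>"
      by (fact \<iota> iso)+
  qed (simp_all add: \<iota>(2) \<Phi> \<Phi>\<iota> \<Phi>\<Psi> \<Psi>\<Phi> \<Psi>(2,3) \<psi>)
qed

end
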